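(* Let $L:\mathbb T^d\times\mathbb R^d\to\mathbb R$ be a smooth Tonelli Lagrangian such that - there is $c_0>0$ with $D^2_{qq}L\ge c_0I$; - there are $k_1,k_2$ such that for all $x,h,q,v\in\mathbb R^d$, $L(x+h,q+v)-2L(x,q)+L(x-h,q-v)\le k_1|h|^2+k_2|v|^2$. Let $\mathbf F:\mathbb T^d\times\mathcal P(\mathbb T^d)\to\mathbb R$ be continuous and such that - $\int_{\mathbb T^d}(\mathbf F(x,m)-\mathbf F(x,m'))\,d(m-m')(x)>0$ for all $m\ne m'$ in $\mathcal P(\mathbb T^d)$; - there is $k_0>0$ such that for all $x,h\in\mathbb R^d$, $m\in\mathcal P(\mathbb T^d)$, $\mathbf F(x+h,m)-2\mathbf F(x,m)+\mathbf F(x-h,m)\le k_0|h|^2$. Let $x_0\in\mathbb T^d$. For $\tau>0$ let $(\rho_\tau,u_\tau,\tilde\mu_\tau)\in\mathbb R\times C(\mathbb T^d)\times\mathcal C_\tau$ be a solution of the discrete MFG $$\begin{cases}\tau\rho_\tau=\mathcal L_\tau u_\tau(x)-u_\tau(x)-\tau\mathbf F(x,\mu_\tau)\quad\text{for all }x\in\mathbb T^d,\\ -\rho_\tau=\displaystyle\int_{\mathbb T^d\times\mathbb R^d}\big(L(x,q)+\mathbf F(x,\mu_\tau)\big)\,d\tilde\mu_\tau(x,q),\qquad\mu_\tau=\mathrm{Pr}_{1\#}\tilde\mu_\tau,\end{cases}$$ with $u_\tau(x_0)=0$. Let $(\rho,u,m)$ be a (classical) solution of the ergodic MFG $$\begin{cases}\Delta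 u+H(x,Du)=\rho+\mathbf F(x,m),\\ \Delta m-\operatorname{div}\big(m\,D_pH(x,Du)\big)=0,\quad m>0,\quad\int_{\mathbb T^d}m\,dx=1,\end{cases}$$ on $\mathbb T^d$, with $u(x_0)=0$. Then: (i) $\lim_{\tau\to0^+}\rho_\tau=\rho$; (ii) $\lim_{\tau\to0^+}u_\tau=u$ uniformly on $\mathbb T^d$; (iii) $\mu_\tau\rightharpoonup m$ weakly as measures on $\mathbb T^d$ as $\tau\to0^+$.
   Context: $\mathbb T^d=\mathbb R^d/\mathbb Z^d$; functions on $\mathbb T^d$ are identified with $\mathbb Z^d$-periodic functions on $\mathbb R^d$. $\mathcal P(X)$ denotes the Borel probability measures on $X$ (with the weak topology). A smooth Tonelli Lagrangian $L(x,q)$ is smooth, superlinear in $q$, with $D^2_{qq}L$ positive definite. The Hamiltonian is the Legendre transform $H(x,p)=\sup_{q\in\mathbb R^d}(p\cdot q-L(x,q))$. A density $m$ is identified with the measure $m\,dx$. Heat kernel: $\eta^\tau(z)=(4\pi\tau)^{-d/2}\sum_{k\in\mathbb Z^d}e^{-|z+k|^2/(4\tau)}$, $(\eta^\tau*u)(y)=\int_{\mathbb T^d}\eta^\tau(y-z)u(z)\,dz$. Lax operator: $\mathcal L_\tau u(x)=\max_{q\in\mathbb R^d}\big((\eta^\tau*u)(x+\tau q)-\tau L(x,q)\big)$. $\mathcal P_\ell$ is the set of $\tilde\mu\in\mathcal P(\mathbb T^d\times\mathbb R^d)$ with $\int|q|\,d\tilde\mu<\infty$. $\mathrm{Pr}_1$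 is the projection onto $\mathbb T^d$. $\mathcal C_\tau$ is the set of $\tilde\mu\in\mathcal P_\ell$ whose projection $\mu=\mathrm{Pr}_{1\#}\tilde\mu$ satisfies $\mu(A)=\int_A\int_{\mathbb T^d\times\mathbb R^d}\eta^\tau(x+\tau q-z)\,d\tilde\mu(x,q)\,dz$ for every Borel $A\subset\mathbb T^d$. *)

theory Defs
  imports "HOL-Probability.Probability"
begin

definition int_lattice :: "(real^'n) set" where
  "int_lattice = {k. \<forall>i. k $ i \<in> \<int>}"

lemma int_lattice_closed:
  "0 \<in> int_lattice"
  "x \<in> int_lattice \<Longrightarrow> - x \<in> int_lattice"
  "x \<in> int_lattice \<Longrightarrow> y \<in> int_lattice \<Longrightarrow> x + y \<in> int_lattice"
  "x \<in> int_lattice \<Longrightarrow> y \<in> int_lattice \<Longrightarrow> x - y \<in> int_lattice"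
  by (auto simp: int_lattice_def)

definition torus_rel :: "real^'n \<Rightarrow> real^'n \<Rightarrow> bool" where
  "torus_rel x y \<longleftrightarrow> x - y \<in> int_lattice"

lemma equivp_torus_rel: "equivp torus_rel" (is "equivp ?R")
proof (rule equivpI)
  show "reflp ?R"
    by (auto simp: reflp_def torus_rel_def int_lattice_closed)
  show "symp ?R"
    unfolding symp_def torus_rel_def by (metis int_lattice_closed(2) minus_diff_eq)
  show "transp ?R"
    unfolding transp_def torus_rel_def by (metis int_lattice_closed(3) diff_add_cancel add_diff_eq)
qed

quotient_type 'n torus = "real^'n" / torus_rel
  by (rule equivp_torus_rel)

lift_definition tproj :: "real^'n \<Rightarrow> 'n torus" is "\<lambda>x. x" .

instantiation torus :: (finite) topological_space
begin

definition open_torus :: "'a torus set \<Rightarrow> bool" where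
  "open_torus U \<longleftrightarrow> open (tproj -` U)"

instance
proof
  show "open (UNIV :: 'a torus set)"
    by (simp add: open_torus_def)
  show "open (S \<inter> T)" if "open S" "open T" for S T :: "'a torus set"
    using that by (auto simp: open_torus_def)
  show "open (\<Union>K)" if "\<forall>S\<in>K. open S" for K :: "'a torus set set"
    using that by (auto simp: open_torus_def vimage_Union)
qed

end

instantiation torus :: (finite) ab_group_add
begin

lift_definition zero_torus :: "'a torus" is 0 .

lift_definition plus_torus :: "'a torus \<Rightarrow> 'a torus \<Rightarrow> 'a torus" is "(+)"
  using int_lattice_closed(3) by (force simp: torus_rel_def add_diff_add)

lift_definition uminus_torus :: "'a torus \<Rightarrow> 'a torus" is uminus
  using int_lattice_closed(2) by (force simp: torus_rel_def)

lift_definition minus_torus :: "'a torus \<Rightarrow> 'a torus \<Rightarrow> 'a torus" is "(-)"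
proof -
  fix x x' y y' :: "real^'a"
  assume "torus_rel x x'" "torus_rel y y'"
  moreover have "x - y - (x' - y') = (x - x') - (y - y')" by simp
  ultimately show "torus_rel (x - y) (x' - y')"
    unfolding torus_rel_def by (metis int_lattice_closed(4))
qed

instance
  by standard (transfer; simp add: torus_rel_def int_lattice_closed)+

end

definition torus_lebesgue :: "'n::finite torus measure" where
  "torus_lebesgue = distr (restrict_space lborel {x. \<forall>i. 0 \<le> x $ i \<and> x $ i < 1}) borel tproj"

definition borel_prob_measures :: "'a::topological_space measure set" where
  "borel_prob_measures = {M. sets M = sets borel \<and> prob_space M}"

definition weak_topology :: "'a::topological_space measure topology" where
  "weak_topology = topology_generated_by
     {{M \<in> borel_prob_measures. (LINT x|M. f x) \<in> U} | (f :: 'a \<Rightarrow> real) U.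
        continuous_on UNIV f \<and> bounded (range f) \<and> open U}"

lift_definition heat_kernel :: "real \<Rightarrow> 'n::finite torus \<Rightarrow> real" is
  "\<lambda>t (z :: real^'n). (4 * pi * t) powr (- (real CARD('n) / 2)) *
     (\<Sum>\<^sub>\<infinity>k\<in>int_lattice. exp (- (norm (z + k))\<^sup>2 / (4 * t)))"
proof -
  fix t :: real and z z' :: "real^'n"
  assume "torus_rel z z'"
  then have l: "z - z' \<in> int_lattice" by (simp add: torus_rel_def)
  have "bij_betw (\<lambda>k. (z - z') + k) int_lattice int_lattice"
    by (rule bij_betw_byWitness[where f' = "\<lambda>k. k - (z - z')"])
      (use l in \<open>auto intro!: int_lattice_closed(3,4)\<close>)
  from infsum_reindex_bij_betw[OF this, of "\<lambda>k. exp (- (norm (z' + k))\<^sup>2 / (4 * t))"]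
  show "(4 * pi * t) powr (- (real CARD('n) / 2)) *
      (\<Sum>\<^sub>\<infinity>k\<in>int_lattice. exp (- (norm (z + k))\<^sup>2 / (4 * t))) =
    (4 * pi * t) powr (- (real CARD('n) / 2)) *
      (\<Sum>\<^sub>\<infinity>k\<in>int_lattice. exp (- (norm (z' + k))\<^sup>2 / (4 * t)))"
    by (simp add: algebra_simps)
qed

definition heat_conv :: "real \<Rightarrow> ('n::finite torus \<Rightarrow> real) \<Rightarrow> 'n torus \<Rightarrow> real" where
  "heat_conv t u y = (LINT z|torus_lebesgue. heat_kernel t (y - z) * u z)"

text \<open>Partial derivatives along an orthonormal basis; requiring differentiability at each stage
  makes \<open>Ck k\<close> the usual class of \<open>k\<close> times continuously differentiable functions.\<close>

primrec Ck :: "nat \<Rightarrow> ('a::euclidean_space \<Rightarrow> real) \<Rightarrow> bool" where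
  "Ck 0 f \<longleftrightarrow> continuous_on UNIV f"
| "Ck (Suc k) f \<longleftrightarrow> (\<forall>x. f differentiable (at x)) \<and>
     (\<forall>b\<in>Basis. Ck k (\<lambda>x. frechet_derivative f (at x) b))"

definition smooth :: "('a::euclidean_space \<Rightarrow> real) \<Rightarrow> bool" where
  "smooth f \<longleftrightarrow> (\<forall>k. Ck k f)"

definition gradient :: "(real^'n::finite \<Rightarrow> real) \<Rightarrow> real^'n \<Rightarrow> real^'n" where
  "gradient f x = (\<chi> i. frechet_derivative f (at x) (axis i 1))"

definition hessian :: "(real^'n::finite \<Rightarrow> real) \<Rightarrow> real^'n \<Rightarrow> real^'n^'n" where
  "hessian f x = (\<chi> i j. frechet_derivative (\<lambda>y. gradient f y $ j) (at x) (axis i 1))"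

definition divergence :: "(real^'n::finite \<Rightarrow> real^'n) \<Rightarrow> real^'n \<Rightarrow> real" where
  "divergence V x = (\<Sum>i\<in>UNIV. frechet_derivative (\<lambda>y. V y $ i) (at x) (axis i 1))"

definition laplacian :: "(real^'n::finite \<Rightarrow> real) \<Rightarrow> real^'n \<Rightarrow> real" where
  "laplacian f x = divergence (gradient f) x"

definition tonelli_lagrangian :: "('n::finite torus \<Rightarrow> real^'n \<Rightarrow> real) \<Rightarrow> bool" where
  "tonelli_lagrangian L \<longleftrightarrow>
     smooth (\<lambda>(x :: real^'n, q). L (tproj x) q) \<and>
     (\<forall>x. filterlim (\<lambda>q. L x q / norm q) at_top at_infinity) \<and>
     (\<forall>x q v. v \<noteq> 0 \<longrightarrow> v \<bullet> (hessian (L x) q *v v) > 0)"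

text \<open>For a Tonelli Lagrangian and a continuous \<open>u\<close>, superlinearity makes the suprema in
  \<open>hamiltonian\<close> and \<open>lax_operator\<close> finite and attained.\<close>

definition hamiltonian ::
  "('n::finite torus \<Rightarrow> real^'n \<Rightarrow> real) \<Rightarrow> 'n torus \<Rightarrow> real^'n \<Rightarrow> real" where
  "hamiltonian L x p = (SUP q. p \<bullet> q - L x q)"

definition lax_operator ::
  "('n::finite torus \<Rightarrow> real^'n \<Rightarrow> real) \<Rightarrow> real \<Rightarrow> ('n torus \<Rightarrow> real) \<Rightarrow> 'n torus \<Rightarrow> real" where
  "lax_operator L t u x = (SUP q. heat_conv t u (x + tproj (t *\<^sub>R q)) - t * L x q)"

definition Pr1 :: "('n::finite torus \<times> (real^'n)) measure \<Rightarrow> 'n torus measure" where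
  "Pr1 M = distr M borel fst"

definition P_ell :: "('n::finite torus \<times> (real^'n)) measure set" where
  "P_ell = {M \<in> borel_prob_measures. integrable M (\<lambda>(x, q). norm q)}"

definition C_set :: "real \<Rightarrow> ('n::finite torus \<times> (real^'n)) measure set" where
  "C_set t = {M \<in> P_ell. \<forall>A \<in> sets borel.
     measure (Pr1 M) A =
       (LINT z:A|torus_lebesgue. LINT (x, q)|M. heat_kernel t (x + tproj (t *\<^sub>R q) - z))}"

text \<open>The integrability clause says that the last integral is a genuine finite integral:
  the Bochner integral of a non-integrable function is \<open>0\<close> by convention.\<close>

definition discrete_mfg_solution ::
  "('n::finite torus \<Rightarrow> real^'n \<Rightarrow> real) \<Rightarrow> ('n torus \<Rightarrow> 'n torus measure \<Rightarrow> real) \<Rightarrow> real \<Rightarrow>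
   real \<Rightarrow> ('n torus \<Rightarrow> real) \<Rightarrow> ('n torus \<times> (real^'n)) measure \<Rightarrow> bool" where
  "discrete_mfg_solution L F t r u M \<longleftrightarrow>
     continuous_on UNIV u \<and> M \<in> C_set t \<and>
     (\<forall>x. t * r = lax_operator L t u x - u x - t * F x (Pr1 M)) \<and>
     integrable M (\<lambda>(x, q). L x q + F x (Pr1 M)) \<and>
     - r = (LINT (x, q)|M. L x q + F x (Pr1 M))"

definition density_measure :: "('n::finite torus \<Rightarrow> real) \<Rightarrow> 'n torus measure" where
  "density_measure m = density torus_lebesgue (\<lambda>x. ennreal (m x))"

text \<open>Functions on the torus are differentiated through their periodic lifts \<open>f \<circ> tproj\<close>.\<close>

definition ergodic_mfg_solution ::
  "('n::finite torus \<Rightarrow> real^'n \<Rightarrow> real) \<Rightarrow> ('n torus \<Rightarrow> 'n torus measure \<Rightarrow> real) \<Rightarrow>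
   real \<Rightarrow> ('n torus \<Rightarrow> real) \<Rightarrow> ('n torus \<Rightarrow> real) \<Rightarrow> bool" where
  "ergodic_mfg_solution L F r u m \<longleftrightarrow>
     Ck 2 (u \<circ> tproj) \<and> Ck 2 (m \<circ> tproj) \<and>
     (\<forall>x. laplacian (u \<circ> tproj) x + hamiltonian L (tproj x) (gradient (u \<circ> tproj) x)
        = r + F (tproj x) (density_measure m)) \<and>
     (\<forall>x. laplacian (m \<circ> tproj) x
        - divergence (\<lambda>y. m (tproj y) *\<^sub>R
            gradient (hamiltonian L (tproj y)) (gradient (u \<circ> tproj) y)) x = 0) \<and>
     (\<forall>x. m x > 0) \<and>
     (LINT x|torus_lebesgue. m x) = 1"

end

theory Submission
  imports Defs
begin

text \<open>
  The heat semigroup is averaging over Gaussian displacements. Comparing the discrete equation at three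
  points with velocities \<open>q \<plusminus> v\<close>, \<open>v = - h\<close>, shows that the second differences of \<open>u\<^sub>\<tau>\<close> are bounded
  below uniformly in \<open>\<tau>\<close>; hence the \<open>u\<^sub>\<tau>\<close> are equi-Lipschitz.

  Neither system needs to be solved: each is tested with the solution of the other. Integrating the
  expansion of the Lax operator at \<open>u\<close> against \<open>\<mu>\<^sub>\<tau>\<close> gives
  \<open>\<rho>\<^sub>\<tau> - \<rho> \<le> \<integral> (F(x,m) - F(x,\<mu>\<^sub>\<tau>)) d\<mu>\<^sub>\<tau> + o(1)\<close>. Conversely the discrete equation, used with the optimal
  drift \<open>Q = D\<^sub>p H(x,Du)\<close> and integrated against \<open>m\<close>, gives
  \<open>\<rho> - \<rho>\<^sub>\<tau> \<le> \<integral> (F(x,\<mu>\<^sub>\<tau>) - F(x,m)) dm + o(1)\<close>; here the semiconvexity of \<open>u\<^sub>\<tau> - u\<close> compensates for the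
  missing regularity of \<open>u\<^sub>\<tau>\<close>. Adding the two, strict monotonicity of \<open>F\<close> and compactness of the
  probability measures give \<open>\<mu>\<^sub>\<tau> \<rightharpoonup> m\<close>, and then \<open>\<rho>\<^sub>\<tau> \<rightarrow> \<rho>\<close>.

  Perturbing the drift to \<open>Q + \<epsilon> (g / m) e\<^sub>i\<close> costs only \<open>O(\<epsilon>\<^sup>2)\<close> by optimality of \<open>Q\<close>, so \<open>u\<^sub>\<tau> - u\<close> is
  nearly orthogonal to every discrete derivative. With \<open>g\<close> a discrete primitive of \<open>u\<^sub>\<tau> - u\<close>, the
  increments of \<open>u\<^sub>\<tau> - u\<close> tend to zero in mean square, hence uniformly by the Lipschitz bound.
\<close>

text \<open>Every comparison is made over one time step and then divided by \<tau>, so errors must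
  be o(\<tau>). The obstacle is that u_\<tau> is controlled only by a one-sided second-order bound,
  so the Lax operator cannot be expanded at u_\<tau>. The choice v = - h sends x + h and x - h to
  the points displaced by (1 - \<tau>) h and - (1 - \<tau>) h from x + \<tau> q; a lower bound - C
  |h|^2 therefore improves to - (C (1 - \<tau>)^2 + \<tau> K) |h|^2, and the least admissible C
  satisfies C (2 - \<tau>) \<le> K. Where derivatives of u_\<tau> would appear, translation
  invariance of Lebesgue measure moves differences of step \<tau> onto m Q, whose divergence is
  known from the Fokker-Planck equation. The second differences met there have no pointwise upper
  bound, yet with C \<tau>^2 added they are nonnegative with integral C \<tau>^2, which is
  o(\<tau>). In the last step the gain is linear and the cost quadratic in \<epsilon>, so \<epsilon>
  is fixed from the desired accuracy before \<tau> tends to 0.\<close>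

section \<open>The quotient torus, its fractional-part section and its Borel sets\<close>

definition unit_cube :: "(real^'n) set" where
  "unit_cube = {x. \<forall>i. 0 \<le> x $ i \<and> x $ i < 1}"

text \<open>A right inverse of \<open>tproj\<close> that is Borel though not continuous. It reduces
  measurability on the torus to \<open>real^'n\<close> and lets periodic functions descend.\<close>

lift_definition torus_section :: "'n::finite torus \<Rightarrow> real^'n" is "\<lambda>x. \<chi> i. frac (x $ i)"
proof -
  fix x y :: "real^'n" assume "torus_rel x y"
  then have "x $ i - y $ i \<in> \<int>" for i by (auto simp: torus_rel_def int_lattice_def)
  then have "frac (x $ i) = frac (y $ i)" for i
    by (metis Ints_cases add.commute diff_add_cancel frac_add_int_right)
  then show "(\<chi> i. frac (x $ i)) = (\<chi> i. frac (y $ i))" by simp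
qed

lemma tproj_section [simp]: "tproj (torus_section x) = x"
proof (transfer)
  fix x :: "real^'n"
  show "torus_rel (\<chi> i. frac (x $ i)) x"
    by (auto simp: torus_rel_def int_lattice_def frac_def)
qed

lemma section_tproj: "torus_section (tproj y) = (\<chi> i. frac (y $ i))"
  by transfer simp

lemma section_in_cube: "torus_section x \<in> unit_cube"
  by transfer (simp add: unit_cube_def frac_lt_1)

lemma section_tproj_cube: "y \<in> unit_cube \<Longrightarrow> torus_section (tproj y) = y"
  by (simp add: section_tproj unit_cube_def vec_eq_iff frac_eq)

lemma tproj_add: "tproj (x + y) = tproj x + tproj y"
  by transfer (simp add: torus_rel_def int_lattice_closed)

lemma tproj_diff: "tproj (x - y) = tproj x - tproj y"
  by transfer (simp add: torus_rel_def int_lattice_closed)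

lemma tproj_minus: "tproj (- x) = - tproj x"
  by transfer (simp add: torus_rel_def int_lattice_closed)

lemma tproj_0 [simp]: "tproj 0 = 0"
  by transfer (simp add: torus_rel_def int_lattice_closed)

lemma tproj_eq_iff: "tproj x = tproj y \<longleftrightarrow> x - y \<in> int_lattice"
  by transfer (simp add: torus_rel_def)

lemma tproj_lattice: "k \<in> int_lattice \<Longrightarrow> tproj (x + k) = tproj x"
  by (simp add: tproj_eq_iff)

lemma tproj_cases: obtains y where "x = tproj y" "y \<in> unit_cube"
  using section_in_cube tproj_section by metis

lemma continuous_tproj: "continuous_on S tproj"
proof -
  have "continuous_on UNIV (tproj :: real^'n \<Rightarrow> _)"
    by (subst continuous_on_open_vimage) (auto simp: open_torus_def)
  then show ?thesis using continuous_on_subset by blast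
qed

lemma continuous_torus_iff:
  fixes f :: "'n::finite torus \<Rightarrow> 'b::topological_space"
  shows "continuous_on UNIV f \<longleftrightarrow> continuous_on UNIV (\<lambda>y. f (tproj y))"
  by (simp add: continuous_on_open_vimage open_torus_def vimage_def)

lemma compact_torus: "compact (UNIV :: 'n::finite torus set)"
proof -
  have "UNIV = tproj ` cbox (0::real^'n) 1"
  proof -
    have "x \<in> tproj ` cbox (0::real^'n) 1" for x :: "'n torus"
    proof -
      obtain y where "x = tproj y" "y \<in> unit_cube" by (rule tproj_cases)
      then show ?thesis by (auto simp: unit_cube_def mem_box_cart less_imp_le)
    qed
    then show ?thesis by auto
  qed
  then show ?thesis using compact_continuous_image[OF continuous_tproj compact_cbox] by metis
qed

lemma countable_int_lattice: "countable (int_lattice :: (real^'n::finite) set)"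
proof -
  have "int_lattice \<subseteq> range (\<lambda>f :: 'n \<Rightarrow> int. (\<chi> i. of_int (f i)) :: real^'n)"
  proof
    fix x :: "real^'n" assume "x \<in> int_lattice"
    then have "\<forall>i. \<exists>z::int. x $ i = of_int z" by (auto simp: int_lattice_def Ints_def)
    then obtain f :: "'n \<Rightarrow> int" where "\<forall>i. x $ i = of_int (f i)" by metis
    then have "x = (\<chi> i. of_int (f i))" by (simp add: vec_eq_iff)
    then show "x \<in> range (\<lambda>f :: 'n \<Rightarrow> int. (\<chi> i. of_int (f i)) :: real^'n)" by blast
  qed
  moreover have "countable (UNIV :: ('n \<Rightarrow> int) set)"
    using countable_PiE[of "UNIV :: 'n set" "\<lambda>_. UNIV :: int set"] by (simp add: PiE_UNIV_domain)
  ultimately show ?thesis by (meson countable_image countable_subset)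
qed

lemma closed_int_lattice: "closed (int_lattice :: (real^'n::finite) set)"
proof -
  have eq: "(int_lattice :: (real^'n) set) = (\<Inter>i. (\<lambda>x. x $ i) -` \<int>)" by (auto simp: int_lattice_def)
  have "closed ((\<lambda>x::real^'n. x $ i) -` (\<int> :: real set))" for i
    by (intro closed_vimage) (auto intro: continuous_intros closed_Ints)
  then show ?thesis unfolding eq by (intro closed_INT ballI)
qed

lemma compact_closed_sums':
  fixes S T :: "'a::real_normed_vector set"
  assumes "compact S" "closed T" shows "closed {x + y |x y. x \<in> S \<and> y \<in> T}"
proof -
  have "{x + y |x y. x \<in> S \<and> y \<in> T} = (\<Union>x\<in>S. \<Union>y\<in>T. {x + y})" by auto
  then show ?thesis using compact_closed_sums[OF assms] by argo
qed

text \<open>The saturation of K is K plus the lattice, a sum of a compact and a closed set.\<close>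

lemma closed_tproj_image:
  assumes "compact (K :: (real^'n::finite) set)" shows "closed (tproj ` K)"
proof -
  have "tproj -` (tproj ` K) = {x + y |x y. x \<in> K \<and> y \<in> int_lattice}"
  proof safe
    fix x y assume "tproj x = tproj y" "y \<in> K"
    then have "x - y \<in> int_lattice" by (simp add: tproj_eq_iff)
    then show "\<exists>y' k. x = y' + k \<and> y' \<in> K \<and> k \<in> int_lattice" using \<open>y \<in> K\<close>
      by (intro exI[of _ y] exI[of _ "x - y"]) auto
  qed (auto simp: tproj_lattice)
  then have "closed (tproj -` (tproj ` K))"
    using compact_closed_sums'[OF assms closed_int_lattice] by simp
  then show ?thesis unfolding closed_def open_torus_def by (simp add: vimage_Compl)
qed

text \<open>The half-open cube is a countable union of compact boxes on which the section inverts
  \<open>tproj\<close>. The preimage of a closed set is thus a countable union of projected compact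
  sets, each closed.\<close>

lemma section_measurable [measurable]:
  "torus_section \<in> borel_measurable (borel :: 'n::finite torus measure)"
proof -
  have "torus_section -` C \<in> sets (borel :: 'n torus measure)" if C: "closed C" for C :: "(real^'n) set"
  proof -
    define K where "K k = C \<inter> cbox 0 (\<chi> i. 1 - 1 / real (Suc k))" for k
    have eq: "torus_section -` C = (\<Union>k. tproj ` K k)"
    proof (intro set_eqI iffI)
      fix x :: "'n torus" assume "x \<in> torus_section -` C"
      then have x: "torus_section x \<in> C" by simp
      let ?y = "torus_section x"
      have lt: "?y $ i < 1" and ge: "0 \<le> ?y $ i" for i using section_in_cube[of x] by (auto simp: unit_cube_def)
      have "\<exists>k. ?y $ i \<le> 1 - 1 / real (Suc k)" for i
      proof -
        obtain k where "inverse (real (Suc k)) < 1 - ?y $ i" using reals_Archimedean[of "1 - ?y $ i"] lt[of i] by auto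
        then show ?thesis by (intro exI[of _ k]) (simp add: inverse_eq_divide)
      qed
      then obtain k where k: "\<And>i. ?y $ i \<le> 1 - 1 / real (Suc (k i))" by metis
      define m where "m = Max (range k)"
      have "?y $ i \<le> 1 - 1 / real (Suc m)" for i
      proof -
        have "k i \<le> m" by (simp add: m_def)
        then have "1 / real (Suc m) \<le> 1 / real (Suc (k i))" by (intro divide_left_mono) auto
        then show ?thesis using k[of i] by linarith
      qed
      then have "?y \<in> K m" using x ge by (auto simp: K_def mem_box_cart)
      then show "x \<in> (\<Union>k. tproj ` K k)" using tproj_section[of x] by (metis UN_I UNIV_I imageI)
    next
      fix y assume "y \<in> (\<Union>k. tproj ` K k)"
      then obtain k x where y: "y = tproj x" and "x \<in> K k" by blast
      then have "x \<in> C" and le: "0 \<le> x $ i" "x $ i \<le> 1 - 1 / real (Suc k)" for i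
        by (auto simp: K_def mem_box_cart)
      moreover have "1 - 1 / real (Suc k) < 1" by simp
      ultimately have "x \<in> C" "x \<in> unit_cube"
        unfolding unit_cube_def by (auto intro: order_le_less_trans[OF le(2)])
      then show "y \<in> torus_section -` C" by (simp add: y section_tproj_cube)
    qed
    have "closed (tproj ` K k)" for k
      by (intro closed_tproj_image) (auto simp: K_def intro!: closed_Int_compact C)
    then show ?thesis unfolding eq by (intro sets.countable_UN image_subsetI borel_closed)
  qed
  then have "torus_section \<in> borel \<rightarrow>\<^sub>M sigma (UNIV :: (real^'n) set) (Collect closed)"
    by (intro measurable_measure_of) auto
  then show ?thesis unfolding borel_eq_closed[where 'a="real^'n", symmetric] .
qed

lemma tproj_measurable [measurable]: "tproj \<in> borel \<rightarrow>\<^sub>M borel"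
  by (rule borel_measurable_continuous_onI) (rule continuous_tproj)

lemma measurable_torus_comp_iff:
  "f \<in> borel \<rightarrow>\<^sub>M N \<longleftrightarrow> (\<lambda>y. f (tproj y)) \<in> borel \<rightarrow>\<^sub>M N"
proof
  assume "(\<lambda>y. f (tproj y)) \<in> borel \<rightarrow>\<^sub>M N"
  then have "(\<lambda>x. f (tproj (torus_section x))) \<in> borel \<rightarrow>\<^sub>M N" by measurable
  then show "f \<in> borel \<rightarrow>\<^sub>M N" by simp
next
  assume [measurable]: "f \<in> borel \<rightarrow>\<^sub>M N"
  show "(\<lambda>y. f (tproj y)) \<in> borel \<rightarrow>\<^sub>M N" by measurable
qed

subsection \<open>Lebesgue measure on the torus\<close>

lemma unit_cube_measurable [measurable]: "(unit_cube :: (real^'n::finite) set) \<in> sets borel"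
proof -
  have eq: "(unit_cube :: (real^'n) set) = (\<Inter>i. (\<lambda>x. x $ i) -` {0..<1})" by (auto simp: unit_cube_def)
  have "(\<lambda>x::real^'n. x $ i) -` {0..<1::real} \<in> sets borel" for i
  proof -
    have "(\<lambda>x::real^'n. x $ i) \<in> borel_measurable borel"
      by (intro borel_measurable_continuous_onI continuous_intros)
    from measurable_sets[OF this, of "{0..<1}"] show ?thesis by simp
  qed
  then show ?thesis unfolding eq by (intro sets.finite_INT) auto
qed

lemma torus_lebesgue_sets [simp, measurable_cong]: "sets torus_lebesgue = sets borel"
  by (simp add: torus_lebesgue_def)

lemma torus_lebesgue_space [simp]: "space torus_lebesgue = UNIV"
  by (simp add: torus_lebesgue_def)

lemma torus_lebesgue_alt: "torus_lebesgue = distr (restrict_space lborel unit_cube) borel tproj"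
  by (simp add: torus_lebesgue_def unit_cube_def)

lemma nn_integral_torus:
  fixes f :: "'n::finite torus \<Rightarrow> ennreal"
  assumes [measurable]: "f \<in> borel_measurable borel"
  shows "(\<integral>\<^sup>+x. f x \<partial>torus_lebesgue) = (\<integral>\<^sup>+y. f (tproj y) * indicator unit_cube y \<partial>lborel)"
  unfolding torus_lebesgue_alt
  by (subst nn_integral_distr) (auto simp: nn_integral_restrict_space intro: measurable_restrict_space1)

lemma Basis_vec_eq: "(Basis :: (real^'n::finite) set) = range (\<lambda>i. axis i 1)"
  by (auto simp: Basis_vec_def)

lemma prod_Basis_vec: "(\<Prod>b\<in>(Basis :: (real^'n::finite) set). f b) = (\<Prod>i\<in>UNIV. f (axis i 1))"
  unfolding Basis_vec_eq by (subst prod.reindex) (auto simp: inj_on_def axis_eq_axis)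

lemma sum_Basis_vec: "(\<Sum>b\<in>(Basis :: (real^'n::finite) set). f b) = (\<Sum>i\<in>UNIV. f (axis i 1))"
  unfolding Basis_vec_eq by (subst sum.reindex) (auto simp: inj_on_def axis_eq_axis)

lemma nn_integral_lborel_prod_vec:
  fixes f :: "'n::finite \<Rightarrow> real \<Rightarrow> ennreal"
  assumes [measurable]: "\<And>i. f i \<in> borel_measurable borel"
  shows "(\<integral>\<^sup>+x. (\<Prod>i\<in>UNIV. f i ((x::real^'n) $ i)) \<partial>lborel) = (\<Prod>i\<in>UNIV. (\<integral>\<^sup>+x. f i x \<partial>lborel))"
proof -
  define F where "F b = f (SOME i. b = axis i 1)" for b :: "real^'n"
  have F: "F (axis i 1) = f i" for i
    unfolding F_def by (rule arg_cong[of _ _ f]) (auto simp: axis_eq_axis)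
  have "(\<integral>\<^sup>+x. (\<Prod>b\<in>Basis. F b ((x::real^'n) \<bullet> b)) \<partial>lborel) = (\<Prod>b\<in>Basis. (\<integral>\<^sup>+x. F b x \<partial>lborel))"
    by (rule nn_integral_lborel_prod) (auto simp: F_def)
  then show ?thesis unfolding prod_Basis_vec by (simp add: F inner_axis)
qed

lemma integral_lborel_prod_vec:
  fixes f :: "'n::finite \<Rightarrow> real \<Rightarrow> real"
  assumes int: "\<And>i. integrable lborel (f i)"
  shows "(LINT x|lborel. (\<Prod>i\<in>UNIV. f i ((x::real^'n) $ i))) = (\<Prod>i\<in>UNIV. (LINT x|lborel. f i x))"
    and "integrable lborel (\<lambda>x::real^'n. (\<Prod>i\<in>UNIV. f i (x $ i)))"
proof -
  have [measurable]: "f i \<in> borel_measurable borel" for i using int[of i] by auto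
  interpret product_sigma_finite "\<lambda>b::real^'n. lborel :: real measure" by standard
  define F where "F b = f (SOME i. b = axis i 1)" for b :: "real^'n"
  have F: "F (axis i 1) = f i" for i
    unfolding F_def by (rule arg_cong[of _ _ f]) (auto simp: axis_eq_axis)
  have [measurable]: "F b \<in> borel_measurable borel" for b by (simp add: F_def)
  have Fi: "integrable lborel (F b)" for b by (simp add: F_def int)
  have "(LINT x|lborel. (\<Prod>b\<in>Basis. F b ((x::real^'n) \<bullet> b)))
      = (LINT x|(\<Pi>\<^sub>M b\<in>(Basis::(real^'n) set). lborel). (\<Prod>b\<in>Basis. F b (x b)))"
    by (subst lborel_eq, subst integral_distr) (auto intro!: Bochner_Integration.integral_cong prod.cong)
  also have "\<dots> = (\<Prod>b\<in>Basis. (LINT x|lborel. F b x))"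
    by (rule product_integral_prod) (auto simp: Fi)
  finally show "(LINT x|lborel. (\<Prod>i\<in>UNIV. f i ((x::real^'n) $ i))) = (\<Prod>i\<in>UNIV. (LINT x|lborel. f i x))"
    unfolding prod_Basis_vec by (simp add: F inner_axis)
  have "integrable lborel (\<lambda>x::real^'n. (\<Prod>b\<in>Basis. F b (x \<bullet> b)))"
    by (subst lborel_eq, subst integrable_distr_eq)
       (auto intro!: product_integrable_prod Fi simp: inner_sum_left inner_Basis if_distrib cong: if_cong prod.cong)
  then show "integrable lborel (\<lambda>x::real^'n. (\<Prod>i\<in>UNIV. f i (x $ i)))"
    unfolding prod_Basis_vec by (simp add: F inner_axis)
qed

lemma emeasure_unit_cube: "emeasure lborel (unit_cube :: (real^'n::finite) set) = 1"
proof -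
  have "emeasure lborel (unit_cube :: (real^'n::finite) set) = (\<integral>\<^sup>+x. indicator unit_cube (x::real^'n) \<partial>lborel)" by simp
  also have "\<dots> = (\<integral>\<^sup>+x. (\<Prod>i\<in>UNIV. indicator {0..<1} ((x::real^'n) $ i)) \<partial>lborel)"
    by (intro nn_integral_cong) (auto simp: unit_cube_def indicator_def)
  also have "\<dots> = 1" by (subst nn_integral_lborel_prod_vec) auto
  finally show ?thesis .
qed

lemma prob_space_torus_lebesgue: "prob_space (torus_lebesgue :: 'n::finite torus measure)"
proof
  have "emeasure (torus_lebesgue :: 'n torus measure) UNIV = (\<integral>\<^sup>+x. 1 \<partial>(torus_lebesgue :: 'n torus measure))" by simp
  also have "\<dots> = 1" by (subst nn_integral_torus) (auto simp: emeasure_unit_cube)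
  finally show "emeasure (torus_lebesgue :: 'n torus measure) (space torus_lebesgue) = 1" by simp
qed

lemma nn_integral_lborel_shift:
  fixes f :: "'a::euclidean_space \<Rightarrow> ennreal"
  assumes [measurable]: "f \<in> borel_measurable borel"
  shows "(\<integral>\<^sup>+x. f (x + c) \<partial>lborel) = (\<integral>\<^sup>+x. f x \<partial>lborel)"
  by (subst lborel_distr_plus[symmetric, of c], subst nn_integral_distr) (auto simp: add.commute)

text \<open>The tiling of space by the lattice translates of the cube, written as an integral over
  counting measure so that it can be inserted under another integral and exchanged with it.\<close>

lemma nn_integral_lattice_cube:
  "(\<integral>\<^sup>+k. indicator unit_cube (y - k) \<partial>count_space int_lattice) = 1" for y :: "real^'n::finite"
proof -
  define k0 where "k0 = y - (\<chi> i. frac (y $ i))"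
  have k0: "k0 \<in> int_lattice" by (auto simp: k0_def int_lattice_def frac_def)
  have "(indicator unit_cube (y - k) :: ennreal) = indicator {k0} k" if "k \<in> int_lattice" for k
  proof -
    have "y - k \<in> unit_cube \<longleftrightarrow> k = k0"
    proof
      assume c: "y - k \<in> unit_cube"
      have "y - k = torus_section (tproj (y - k))" by (simp add: section_tproj_cube c)
      also have "\<dots> = torus_section (tproj y)" using that by (metis tproj_lattice diff_add_cancel)
      finally show "k = k0" by (simp add: k0_def section_tproj algebra_simps)
    qed (auto simp: k0_def unit_cube_def frac_lt_1)
    then show ?thesis by (simp add: indicator_def)
  qed
  then have "(\<integral>\<^sup>+k. indicator unit_cube (y - k) \<partial>count_space int_lattice) = (\<integral>\<^sup>+k. indicator {k0} k \<partial>count_space int_lattice)"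
    by (intro nn_integral_cong) auto
  also have "\<dots> = 1" using k0 by (subst nn_integral_indicator) auto
  finally show ?thesis .
qed

text \<open>Insert the tiling as a partition of unity, exchange the two integrals and translate each
  cell back to the cube.\<close>

lemma nn_integral_unfold:
  fixes g :: "real^'n::finite \<Rightarrow> ennreal"
  assumes [measurable]: "g \<in> borel_measurable borel"
  shows "(\<integral>\<^sup>+y. g y \<partial>lborel) =
    (\<integral>\<^sup>+y. (\<integral>\<^sup>+k. g (y + k) \<partial>count_space int_lattice) * indicator unit_cube y \<partial>lborel)"
proof -
  have "(\<integral>\<^sup>+y. g y \<partial>lborel) = (\<integral>\<^sup>+y. (\<integral>\<^sup>+k. g y * indicator unit_cube (y - k) \<partial>count_space int_lattice) \<partial>lborel)"
    by (subst nn_integral_cmult) (auto simp: nn_integral_lattice_cube)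
  also have "\<dots> = (\<integral>\<^sup>+k. (\<integral>\<^sup>+y. g y * indicator unit_cube (y - k) \<partial>lborel) \<partial>count_space int_lattice)"
    by (subst nn_integral_count_space_nn_integral) (auto simp: countable_int_lattice)
  also have "\<dots> = (\<integral>\<^sup>+k. (\<integral>\<^sup>+y. g (y + k) * indicator unit_cube y \<partial>lborel) \<partial>count_space int_lattice)"
  proof (rule nn_integral_cong)
    fix k :: "real^'n"
    have "(\<lambda>y. g y * indicator unit_cube (y - k)) \<in> borel_measurable borel" by measurable
    from nn_integral_lborel_shift[OF this, of k]
    show "(\<integral>\<^sup>+y. g y * indicator unit_cube (y - k) \<partial>lborel) = (\<integral>\<^sup>+y. g (y + k) * indicator unit_cube y \<partial>lborel)"
      by simp
  qed
  also have "\<dots> = (\<integral>\<^sup>+y. (\<integral>\<^sup>+k. g (y + k) * indicator unit_cube y \<partial>count_space int_lattice) \<partial>lborel)"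
    by (subst nn_integral_count_space_nn_integral) (auto simp: countable_int_lattice)
  also have "\<dots> = (\<integral>\<^sup>+y. (\<integral>\<^sup>+k. g (y + k) \<partial>count_space int_lattice) * indicator unit_cube y \<partial>lborel)"
    by (intro nn_integral_cong, subst nn_integral_multc) auto
  finally show ?thesis .
qed

lemma torus_shift_measurable [measurable]: "(\<lambda>x. x + a) \<in> borel \<rightarrow>\<^sub>M (borel :: 'n::finite torus measure)"
proof -
  obtain b where "a = tproj b" by (rule tproj_cases)
  then have "(\<lambda>y. tproj y + a) = (\<lambda>y. tproj (y + b))" by (simp add: tproj_add)
  then show ?thesis by (subst measurable_torus_comp_iff) simp
qed

text \<open>A translation in \<open>real^'n\<close> replaces the cube by a shifted cube. Unfolding
  restores the original one, because the lattice translates of the shifted cube also cover every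
  point exactly once.\<close>

lemma nn_integral_torus_shift:
  fixes f :: "'n::finite torus \<Rightarrow> ennreal"
  assumes [measurable]: "f \<in> borel_measurable borel"
  shows "(\<integral>\<^sup>+x. f (x + a) \<partial>torus_lebesgue) = (\<integral>\<^sup>+x. f x \<partial>torus_lebesgue)"
proof -
  obtain b where b: "a = tproj b" by (rule tproj_cases)
  have "(\<integral>\<^sup>+x. f (x + a) \<partial>torus_lebesgue) = (\<integral>\<^sup>+y. f (tproj (y + b)) * indicator unit_cube y \<partial>lborel)"
    by (subst nn_integral_torus) (auto simp: b tproj_add)
  also have "\<dots> = (\<integral>\<^sup>+y. f (tproj y) * indicator unit_cube (y - b) \<partial>lborel)"
  proof -
    have "(\<lambda>y. f (tproj y) * indicator unit_cube (y - b)) \<in> borel_measurable borel" by measurable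
    from nn_integral_lborel_shift[OF this, of b] show ?thesis by simp
  qed
  also have "\<dots> = (\<integral>\<^sup>+y. (\<integral>\<^sup>+k. f (tproj (y + k)) * indicator unit_cube (y + k - b) \<partial>count_space int_lattice)
                      * indicator unit_cube y \<partial>lborel)"
    by (subst nn_integral_unfold) auto
  also have "\<dots> = (\<integral>\<^sup>+y. f (tproj y) * indicator unit_cube y \<partial>lborel)"
  proof (intro nn_integral_cong arg_cong2[where f="(*)"] refl)
    fix y :: "real^'n"
    have "(\<integral>\<^sup>+k. f (tproj (y + k)) * indicator unit_cube (y + k - b) \<partial>count_space int_lattice)
        = (\<integral>\<^sup>+k. f (tproj y) * indicator unit_cube (y - b + k) \<partial>count_space int_lattice)"
      by (intro nn_integral_cong) (auto simp: tproj_lattice add_diff_eq diff_add_eq)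
    also have "\<dots> = f (tproj y) * (\<integral>\<^sup>+k. indicator unit_cube (y - b + k) \<partial>count_space int_lattice)"
      by (subst nn_integral_cmult) auto
    also have "(\<integral>\<^sup>+k. indicator unit_cube (y - b + k) \<partial>count_space int_lattice)
        = (\<integral>\<^sup>+k. indicator unit_cube (y - b - k) \<partial>count_space int_lattice)"
      by (rule nn_integral_bij_count_space[symmetric, where g="uminus" and f="\<lambda>k. indicator unit_cube (y - b + k)", simplified])
         (auto intro!: bij_betwI[where g=uminus] simp: int_lattice_closed)
    finally show "(\<integral>\<^sup>+k. f (tproj (y + k)) * indicator unit_cube (y + k - b) \<partial>count_space int_lattice) = f (tproj y)"
      by (simp add: nn_integral_lattice_cube)
  qed
  also have "\<dots> = (\<integral>\<^sup>+x. f x \<partial>torus_lebesgue)" by (subst nn_integral_torus) auto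
  finally show ?thesis .
qed

lemma distr_torus_shift: "distr torus_lebesgue borel (\<lambda>x. x + a) = (torus_lebesgue :: 'n::finite torus measure)"
proof (rule measure_eqI)
  fix A assume "A \<in> sets (distr torus_lebesgue borel (\<lambda>x::'n torus. x + a))"
  then have [measurable]: "A \<in> sets borel" by simp
  have "emeasure (distr torus_lebesgue borel (\<lambda>x::'n torus. x + a)) A = (\<integral>\<^sup>+x. indicator A (x + a) \<partial>torus_lebesgue)"
    using nn_integral_distr[of "\<lambda>x::'n torus. x + a" torus_lebesgue borel "indicator A"] by simp
  also have "\<dots> = emeasure torus_lebesgue A"
    by (subst nn_integral_torus_shift) auto
  finally show "emeasure (distr torus_lebesgue borel (\<lambda>x::'n torus. x + a)) A = emeasure torus_lebesgue A" .
qed simp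

lemma integral_torus_shift:
  fixes f :: "'n::finite torus \<Rightarrow> real"
  assumes [measurable]: "f \<in> borel_measurable borel"
  shows "(LINT x|torus_lebesgue. f (x + a)) = (LINT x|torus_lebesgue. f x)"
  by (subst (2) distr_torus_shift[of a, symmetric], subst integral_distr) auto

subsection \<open>Gaussian measures\<close>

text \<open>The heat kernel of \<open>real^'n\<close> at time t: a centred Gaussian with variance 2
  t in each coordinate.\<close>

definition gauss :: "real \<Rightarrow> real^'n::finite \<Rightarrow> real" where
  "gauss t w = (4 * pi * t) powr (- (real CARD('n) / 2)) * exp (- (norm w)\<^sup>2 / (4 * t))"

definition gauss_measure :: "real \<Rightarrow> (real^'n::finite) measure" where
  "gauss_measure t = density lborel (\<lambda>w. ennreal (gauss t w))"

lemma gauss_nonneg [simp]: "0 \<le> gauss t w"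
  by (simp add: gauss_def)

lemma gauss_measurable [measurable]: "gauss t \<in> borel_measurable borel"
  unfolding gauss_def by measurable

lemma sets_gauss [simp, measurable_cong]: "sets (gauss_measure t) = sets borel"
  by (simp add: gauss_measure_def)

lemma space_gauss [simp]: "space (gauss_measure t) = UNIV"
  by (simp add: gauss_measure_def)

lemma norm_sq_vec: "(norm (w :: real^'n::finite))\<^sup>2 = (\<Sum>i\<in>UNIV. (w $ i)\<^sup>2)"
  by (simp add: norm_vec_def L2_set_def sum_nonneg)

lemma gauss_prod:
  assumes "t > 0"
  shows "gauss t (w :: real^'n::finite) = (\<Prod>i\<in>UNIV. normal_density 0 (sqrt (2 * t)) (w $ i))"
proof -
  have "(\<Prod>i\<in>(UNIV::'n set). normal_density 0 (sqrt (2 * t)) (w $ i))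
      = (\<Prod>i\<in>(UNIV::'n set). (1 / sqrt (4 * pi * t)) * exp (- (w $ i)\<^sup>2 / (4 * t)))"
    using assms by (intro prod.cong) (auto simp: normal_density_def mult_ac)
  also have "\<dots> = (1 / sqrt (4 * pi * t)) ^ CARD('n) * exp (\<Sum>i\<in>UNIV. - (w $ i)\<^sup>2 / (4 * t))"
    by (simp add: prod.distrib exp_sum prod_dividef power_divide)
  also have "(\<Sum>i\<in>UNIV. - (w $ i)\<^sup>2 / (4 * t)) = - (norm w)\<^sup>2 / (4 * t)"
    by (simp add: norm_sq_vec sum_divide_distrib[symmetric] sum_negf)
  also have "(1 / sqrt (4 * pi * t)) ^ CARD('n) = (4 * pi * t) powr (- (real CARD('n) / 2))"
  proof -
    have "(4 * pi * t) powr (- (real CARD('n) / 2)) = ((4 * pi * t) powr (1/2)) powr (- real CARD('n))"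
      by (simp add: powr_powr)
    also have "\<dots> = sqrt (4 * pi * t) powr (- real CARD('n))" using assms by (simp add: powr_half_sqrt)
    also have "\<dots> = (1 / sqrt (4 * pi * t)) ^ CARD('n)" using assms
      by (simp add: powr_minus powr_realpow power_one_over inverse_eq_divide)
    finally show ?thesis by simp
  qed
  finally show ?thesis by (simp add: gauss_def)
qed

lemma integral_gauss_prod:
  fixes f :: "'n::finite \<Rightarrow> real \<Rightarrow> real"
  assumes t: "t > 0" and int: "\<And>i. integrable lborel (\<lambda>x. normal_density 0 (sqrt (2 * t)) x * f i x)"
    and [measurable]: "\<And>i. f i \<in> borel_measurable borel"
  shows "integrable (gauss_measure t) (\<lambda>w::real^'n. \<Prod>i\<in>UNIV. f i (w $ i))"
    and "(LINT w|gauss_measure t. (\<Prod>i\<in>UNIV. f i ((w::real^'n) $ i)))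
      = (\<Prod>i\<in>UNIV. (LINT x|lborel. normal_density 0 (sqrt (2 * t)) x * f i x))"
proof -
  have eq: "gauss t w * (\<Prod>i\<in>UNIV. f i (w $ i)) = (\<Prod>i\<in>UNIV. normal_density 0 (sqrt (2 * t)) (w $ i) * f i (w $ i))"
    for w :: "real^'n" by (simp add: gauss_prod[OF t] prod.distrib)
  show "integrable (gauss_measure t) (\<lambda>w::real^'n. \<Prod>i\<in>UNIV. f i (w $ i))"
    unfolding gauss_measure_def
    by (subst integrable_density) (auto simp: eq intro!: integral_lborel_prod_vec(2)[OF int])
  show "(LINT w|gauss_measure t. (\<Prod>i\<in>UNIV. f i ((w::real^'n) $ i)))
      = (\<Prod>i\<in>UNIV. (LINT x|lborel. normal_density 0 (sqrt (2 * t)) x * f i x))"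
    unfolding gauss_measure_def
    by (subst integral_density) (auto simp: eq intro!: integral_lborel_prod_vec(1)[OF int])
qed

lemma prob_space_gauss:
  assumes t: "t > 0" shows "prob_space (gauss_measure t :: (real^'n::finite) measure)"
proof
  have "emeasure (gauss_measure t :: (real^'n) measure) UNIV = (\<integral>\<^sup>+w. ennreal (gauss t (w::real^'n)) \<partial>lborel)"
    by (simp add: gauss_measure_def emeasure_density)
  also have "\<dots> = (\<integral>\<^sup>+w. (\<Prod>i\<in>UNIV. ennreal (normal_density 0 (sqrt (2 * t)) ((w::real^'n) $ i))) \<partial>lborel)"
    by (simp add: gauss_prod[OF t] prod_ennreal)
  also have "\<dots> = (\<Prod>i\<in>(UNIV::'n set). (\<integral>\<^sup>+x. ennreal (normal_density 0 (sqrt (2 * t)) x) \<partial>lborel))"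
    by (subst nn_integral_lborel_prod_vec) auto
  also have "\<dots> = 1"
    using t by (simp add: nn_integral_eq_integral)
  finally show "emeasure (gauss_measure t :: (real^'n) measure) (space (gauss_measure t)) = 1" by simp
qed

text \<open>Moment of order k of the normal law with mean 0 and variance 2 t.\<close>

definition gmom :: "real \<Rightarrow> nat \<Rightarrow> real" where
  "gmom t k = (LINT x|lborel. normal_density 0 (sqrt (2 * t)) x * x ^ k)"

lemma gmom_values:
  assumes "t > 0"
  shows "gmom t 0 = 1" "gmom t (Suc 0) = 0" "gmom t 2 = 2 * t" "gmom t 4 = 12 * t\<^sup>2"
proof -
  have s: "sqrt (2 * t) > 0" using assms by simp
  show "gmom t 0 = 1" using s by (simp add: gmom_def)
  show "gmom t (Suc 0) = 0" unfolding gmom_def using integral_normal_moment_odd[OF s, of 0 0] by simp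
  show "gmom t 2 = 2 * t" unfolding gmom_def using integral_normal_moment_even[OF s, of 0 1] assms by simp
  show "gmom t 4 = 12 * t\<^sup>2" unfolding gmom_def using integral_normal_moment_even[OF s, of 0 2] assms
    by (simp add: power2_eq_square fact_numeral)
qed

lemma gauss_moment:
  fixes a :: "'n::finite \<Rightarrow> nat"
  assumes t: "t > 0"
  shows "integrable (gauss_measure t) (\<lambda>w::real^'n. \<Prod>i\<in>UNIV. (w $ i) ^ a i)"
    and "(LINT w|gauss_measure t. (\<Prod>i\<in>UNIV. ((w::real^'n) $ i) ^ a i)) = (\<Prod>i\<in>UNIV. gmom t (a i))"
proof -
  have "integrable lborel (\<lambda>x. normal_density 0 (sqrt (2 * t)) x * x ^ k)" for k
    using integrable_normal_moment[of "sqrt (2*t)" 0 k] t by simp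
  then show "integrable (gauss_measure t) (\<lambda>w::real^'n. \<Prod>i\<in>UNIV. (w $ i) ^ a i)"
    "(LINT w|gauss_measure t. (\<Prod>i\<in>UNIV. ((w::real^'n) $ i) ^ a i)) = (\<Prod>i\<in>UNIV. gmom t (a i))"
    using integral_gauss_prod[OF t, of "\<lambda>i x. x ^ a i"] by (auto simp: gmom_def)
qed

lemma prod_delta_power: "(\<Prod>j\<in>UNIV. (w $ j) ^ (if j = i then k else 0)) = ((w::real^'n::finite) $ i) ^ k"
  by (simp add: if_distrib[of "\<lambda>k. _ ^ k"] prod.delta cong: if_cong)

lemma gauss_moment1:
  fixes i :: "'n::finite"
  assumes t: "t > 0"
  shows "integrable (gauss_measure t) (\<lambda>w::real^'n. (w $ i) ^ k)"
    and "(LINT w|gauss_measure t. ((w::real^'n) $ i) ^ k) = gmom t k"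
proof -
  show "integrable (gauss_measure t) (\<lambda>w::real^'n. (w $ i) ^ k)"
    using gauss_moment(1)[OF t, of "\<lambda>j. if j = i then k else 0"] by (simp add: prod_delta_power)
  have "(\<Prod>j\<in>(UNIV::'n set). gmom t (if j = i then k else 0)) = (\<Prod>j\<in>UNIV. if j = i then gmom t k else 1)"
    by (intro prod.cong) (auto simp: gmom_values(1)[OF t])
  then show "(LINT w|gauss_measure t. ((w::real^'n) $ i) ^ k) = gmom t k"
    using gauss_moment(2)[OF t, of "\<lambda>j. if j = i then k else 0"] by (simp add: prod_delta_power)
qed

lemma gauss_moment2:
  fixes i j :: "'n::finite"
  assumes t: "t > 0"
  shows "integrable (gauss_measure t) (\<lambda>w::real^'n. (w $ i) ^ k * (w $ j) ^ l)"
    and "i \<noteq> j \<Longrightarrow> (LINT w|gauss_measure t. ((w::real^'n) $ i) ^ k * (w $ j) ^ l) = gmom t k * gmom t l"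
proof -
  have e: "(\<Prod>m\<in>UNIV. (w $ m) ^ ((if m = i then k else 0) + (if m = j then l else 0))) = (w $ i) ^ k * (w $ j) ^ l"
    for w :: "real^'n"
    by (simp only: power_add prod.distrib prod_delta_power)
  show "integrable (gauss_measure t) (\<lambda>w::real^'n. (w $ i) ^ k * (w $ j) ^ l)"
    using gauss_moment(1)[OF t, of "\<lambda>m. (if m = i then k else 0) + (if m = j then l else 0)"] by (simp only: e)
  assume ij: "i \<noteq> j"
  have "(\<Prod>m\<in>(UNIV::'n set). gmom t ((if m = i then k else 0) + (if m = j then l else 0)))
    = (\<Prod>m\<in>UNIV. (if m = i then gmom t k else 1) * (if m = j then gmom t l else 1))"
    using ij by (intro prod.cong) (auto simp: gmom_values(1)[OF t])
  also have "\<dots> = gmom t k * gmom t l" by (simp add: prod.distrib)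
  finally show "(LINT w|gauss_measure t. ((w::real^'n) $ i) ^ k * (w $ j) ^ l) = gmom t k * gmom t l"
    using gauss_moment(2)[OF t, of "\<lambda>m. (if m = i then k else 0) + (if m = j then l else 0)"] by (simp only: e)
qed

lemma gauss_mean:
  assumes t: "t > 0"
  shows "integrable (gauss_measure t) (\<lambda>w::real^'n::finite. w $ i)"
    and "(LINT w|gauss_measure t. (w::real^'n::finite) $ i) = 0"
  using gauss_moment1[OF t, where i=i and k=1] by (auto simp: gmom_values[OF t])

lemma gauss_covariance:
  assumes t: "t > 0"
  shows "integrable (gauss_measure t) (\<lambda>w::real^'n::finite. w $ i * w $ j)"
    and "(LINT w|gauss_measure t. (w::real^'n::finite) $ i * w $ j) = (if i = j then 2 * t else 0)"
  using gauss_moment2[OF t, where i=i and j=j and k=1 and l=1] gauss_moment1[OF t, where i=i and k=2]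
  by (auto simp: gmom_values[OF t] power2_eq_square)

lemma gauss_norm_sq:
  assumes t: "t > 0"
  shows "integrable (gauss_measure t) (\<lambda>w::real^'n::finite. (norm w)\<^sup>2)"
    and "(LINT w|gauss_measure t. (norm (w::real^'n::finite))\<^sup>2) = 2 * real CARD('n) * t"
proof -
  have i: "integrable (gauss_measure t) (\<lambda>w::real^'n. (w $ i)\<^sup>2)" for i using gauss_moment1(1)[OF t] .
  then show "integrable (gauss_measure t) (\<lambda>w::real^'n. (norm w)\<^sup>2)" unfolding norm_sq_vec by auto
  show "(LINT w|gauss_measure t. (norm (w::real^'n::finite))\<^sup>2) = 2 * real CARD('n) * t"
    unfolding norm_sq_vec using i by (simp add: gauss_moment1(2)[OF t] gmom_values[OF t])
qed

text \<open>The order t^2 makes fourth-order Taylor remainders negligible against t. The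
  Cauchy-Schwarz inequality over the coordinates reduces the bound to pure fourth moments.\<close>

lemma gauss_norm4:
  assumes t: "t > 0"
  shows "integrable (gauss_measure t) (\<lambda>w::real^'n::finite. (norm w) ^ 4)"
    and "(LINT w|gauss_measure t. (norm (w::real^'n::finite)) ^ 4) \<le> 12 * (real CARD('n))\<^sup>2 * t\<^sup>2"
proof -
  have e: "(norm w) ^ 4 = (\<Sum>i\<in>UNIV. \<Sum>j\<in>UNIV. (w $ i)^2 * (w $ j)^2)" for w :: "real^'n"
  proof -
    have "(norm w) ^ 4 = ((norm w)\<^sup>2)\<^sup>2" by simp
    then show ?thesis by (simp only: norm_sq_vec power2_eq_square[of "sum _ _"] sum_product)
  qed
  show i: "integrable (gauss_measure t) (\<lambda>w::real^'n. (norm w) ^ 4)"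
    unfolding e by (intro Bochner_Integration.integrable_sum gauss_moment2(1)[OF t])
  have i2: "integrable (gauss_measure t) (\<lambda>w::real^'n. real CARD('n) * (\<Sum>i\<in>UNIV. (w $ i)^4))"
    by (intro integrable_mult_right Bochner_Integration.integrable_sum gauss_moment1(1)[OF t])
  have le: "(norm w) ^ 4 \<le> real CARD('n) * (\<Sum>i\<in>UNIV. (w $ i)^4)" for w :: "real^'n"
  proof -
    have "(norm w) ^ 4 = (\<Sum>i\<in>UNIV. (w $ i)\<^sup>2)\<^sup>2" by (simp only: norm_sq_vec[symmetric]) simp
    also have "\<dots> \<le> real CARD('n) * (\<Sum>i\<in>UNIV. ((w $ i)\<^sup>2)\<^sup>2)"
      using sum_squared_le_sum_of_squares[of "\<lambda>i. (w $ i)\<^sup>2" UNIV] by (simp add: mult.commute)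
    finally show ?thesis by simp
  qed
  have "(LINT w|gauss_measure t. (norm (w::real^'n::finite)) ^ 4)
      \<le> (LINT w|gauss_measure t. real CARD('n) * (\<Sum>i\<in>UNIV. ((w::real^'n) $ i)^4))"
    by (intro integral_mono i i2 le)
  also have "\<dots> = 12 * (real CARD('n))\<^sup>2 * t\<^sup>2"
    using gauss_moment1(1)[OF t, where 'n='n and k=4]
    by (simp add: gauss_moment1(2)[OF t] gmom_values[OF t] power2_eq_square)
  finally show "(LINT w|gauss_measure t. (norm (w::real^'n::finite)) ^ 4) \<le> 12 * (real CARD('n))\<^sup>2 * t\<^sup>2" .
qed

lemma gauss_norm:
  assumes t: "t > 0"
  shows "integrable (gauss_measure t) (\<lambda>w::real^'n::finite. norm w)"
    and "(LINT w|gauss_measure t. norm (w::real^'n::finite)) \<le> (real CARD('n) + 1) * sqrt t"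
proof -
  interpret prob_space "gauss_measure t :: (real^'n) measure" by (rule prob_space_gauss[OF t])
  \<comment> \<open>Arithmetic-geometric mean inequality with weight sqrt t, the typical size of w,
    so that the second moment gives the right order.\<close>
  define b where "b w = (norm w)\<^sup>2 / (2 * sqrt t) + sqrt t / 2" for w :: "real^'n"
  have le: "norm w \<le> b w" for w :: "real^'n"
  proof -
    have "0 \<le> (norm w - sqrt t)\<^sup>2" by simp
    then have "2 * norm w * sqrt t \<le> (norm w)\<^sup>2 + (sqrt t)\<^sup>2" by (simp add: power2_diff)
    moreover have "b w = ((norm w)\<^sup>2 + (sqrt t)\<^sup>2) / (2 * sqrt t)" using t
      unfolding b_def by (simp add: add_divide_distrib power2_eq_square real_div_sqrt)
    ultimately show ?thesis using t by (simp add: pos_le_divide_eq mult_ac)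
  qed
  have ib: "integrable (gauss_measure t) b" unfolding b_def using gauss_norm_sq(1)[OF t] by auto
  show i: "integrable (gauss_measure t) (\<lambda>w::real^'n. norm w)"
    by (rule Bochner_Integration.integrable_bound[OF ib]) (auto simp: abs_of_nonneg intro: order_trans[OF le abs_ge_self])
  have "(LINT w|gauss_measure t. norm (w::real^'n::finite)) \<le> (LINT w|gauss_measure t. b w)"
    by (intro integral_mono i ib le)
  also have "\<dots> = (2 * real CARD('n) * t) / (2 * sqrt t) + sqrt t / 2"
    unfolding b_def using gauss_norm_sq(1)[OF t, where 'n='n] gauss_norm_sq(2)[OF t, where 'n='n]
    by (simp add: prob_space[simplified])
  also have "\<dots> = (real CARD('n) + 1/2) * sqrt t"
  proof -
    have "2 * real CARD('n) * (s * s) / (2 * s) = real CARD('n) * s" if "s > 0" for s :: real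
      using that by (simp add: field_simps)
    from this[of "sqrt t"] have "2 * real CARD('n) * t / (2 * sqrt t) = real CARD('n) * sqrt t"
      using t by (simp only: real_sqrt_gt_0_iff real_sqrt_mult_self abs_of_pos)
    then show ?thesis by (simp add: algebra_simps)
  qed
  also have "\<dots> \<le> (real CARD('n) + 1) * sqrt t" using t by (intro mult_right_mono) auto
  finally show "(LINT w|gauss_measure t. norm (w::real^'n::finite)) \<le> (real CARD('n) + 1) * sqrt t" .
qed

lemma distr_gauss_uminus: "distr (gauss_measure t) borel uminus = (gauss_measure t :: (real^'n::finite) measure)"
proof -
  have l: "distr lborel borel uminus = (lborel :: (real^'n) measure)"
    using lborel_affine[of "-1" "0::real^'n"] by (simp add: density_1)
  show ?thesis
  proof (rule measure_eqI)
    fix A assume "A \<in> sets (distr (gauss_measure t) borel (uminus :: real^'n \<Rightarrow> _))"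
    then have [measurable]: "A \<in> sets borel" by simp
    have [measurable]: "uminus -` A \<in> sets borel"
      using measurable_sets[of uminus borel borel A] by simp
    have "emeasure (distr (gauss_measure t) borel uminus) A = (\<integral>\<^sup>+w. ennreal (gauss t (w::real^'n)) * indicator A (- w) \<partial>lborel)"
      unfolding gauss_measure_def
      by (subst emeasure_distr, simp, simp, subst emeasure_density) (auto intro!: nn_integral_cong simp: indicator_def)
    also have "\<dots> = (\<integral>\<^sup>+w. ennreal (gauss t (w::real^'n)) * indicator A w \<partial>lborel)"
      by (subst (2) l[symmetric], subst nn_integral_distr) (auto simp: gauss_def)
    also have "\<dots> = emeasure (gauss_measure t) A"
      unfolding gauss_measure_def by (subst emeasure_density) auto
    finally show "emeasure (distr (gauss_measure t) borel uminus) A = emeasure (gauss_measure t) A" .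
  qed simp
qed

subsection \<open>The heat semigroup on the torus\<close>

lemma heat_kernel_tproj:
  "heat_kernel t (tproj z) = (4 * pi * t) powr (- (real CARD('n::finite) / 2)) *
     (\<Sum>\<^sub>\<infinity>k\<in>int_lattice. exp (- (norm ((z::real^'n) + k))\<^sup>2 / (4 * t)))"
  by transfer simp

text \<open>From |y + k|^2 \<le> 2 |z + k|^2 + 2 |y - z|^2, each term at z times a fixed positive
  function of y is at most the Gaussian of doubled time at y + k. Integrating y over the cube turns
  the lattice sum on the right into a finite Gaussian integral over the whole space.\<close>

lemma lattice_gauss_finite:
  assumes t: "t > 0"
  shows "(\<integral>\<^sup>+k. ennreal (exp (- (norm ((z::real^'n::finite) + k))\<^sup>2 / (4 * t))) \<partial>count_space int_lattice) < \<infinity>"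
proof -
  let ?S = "\<integral>\<^sup>+k. ennreal (exp (- (norm (z + k))\<^sup>2 / (4 * t))) \<partial>count_space int_lattice"
  define h where "h y = ennreal (exp (- (norm y)\<^sup>2 / (4 * (2 * t))))" for y :: "real^'n"
  have [measurable]: "h \<in> borel_measurable borel" unfolding h_def by measurable
  have ge: "h (y + k) \<ge> ennreal (exp (- (norm (z + k))\<^sup>2 / (4 * t))) * ennreal (exp (- (norm (y - z))\<^sup>2 / (4 * t)))" for y k
  proof -
    have "(norm (y + k))\<^sup>2 \<le> (norm (z + k) + norm (y - z))\<^sup>2"
      by (intro power_mono) (use norm_triangle_ineq[of "z + k" "y - z"] in \<open>auto simp: algebra_simps\<close>)
    also have "\<dots> \<le> 2 * (norm (z + k))\<^sup>2 + 2 * (norm (y - z))\<^sup>2"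
      using sum_squares_bound[of "norm (z + k)" "norm (y - z)"] by (simp add: power2_sum)
    finally have "(norm (y + k))\<^sup>2 / (8 * t) \<le> (2 * (norm (z + k))\<^sup>2 + 2 * (norm (y - z))\<^sup>2) / (8 * t)"
      using t by (intro divide_right_mono) auto
    also have "\<dots> = (norm (z + k))\<^sup>2 / (4 * t) + (norm (y - z))\<^sup>2 / (4 * t)" by (simp add: add_divide_distrib)
    finally have "exp (- (norm (z + k))\<^sup>2 / (4 * t)) * exp (- (norm (y - z))\<^sup>2 / (4 * t)) \<le> exp (- (norm (y + k))\<^sup>2 / (8 * t))"
      by (simp add: exp_add[symmetric])
    then show ?thesis unfolding h_def by (simp add: ennreal_mult'[symmetric])
  qed
  define J where "J = (\<integral>\<^sup>+y. ennreal (exp (- (norm (y - z))\<^sup>2 / (4 * t))) * indicator unit_cube y \<partial>lborel)"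
  have "?S * J = (\<integral>\<^sup>+y. ?S * (ennreal (exp (- (norm (y - z))\<^sup>2 / (4 * t))) * indicator unit_cube y) \<partial>lborel)"
    unfolding J_def by (subst nn_integral_cmult) auto
  also have "\<dots> \<le> (\<integral>\<^sup>+y. (\<integral>\<^sup>+k. h (y + k) \<partial>count_space int_lattice) * indicator unit_cube y \<partial>lborel)"
    unfolding mult.assoc[symmetric]
    by (intro nn_integral_mono mult_right_mono) (auto simp: nn_integral_multc[symmetric] simp del: divide_minus_left intro!: nn_integral_mono ge)
  also have "\<dots> = (\<integral>\<^sup>+y. h y \<partial>lborel)" by (rule nn_integral_unfold[symmetric]) measurable
  also have "\<dots> < \<infinity>"
  proof -
    let ?c = "(4 * pi * (2 * t)) powr (- (real CARD('n) / 2))"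
    have c: "?c > 0" using t by simp
    interpret prob_space "gauss_measure (2 * t) :: (real^'n) measure" using t by (intro prob_space_gauss) simp
    have "ennreal ?c * (\<integral>\<^sup>+y. h y \<partial>lborel) = (\<integral>\<^sup>+y. ennreal (gauss (2 * t) (y::real^'n)) \<partial>lborel)"
      by (subst nn_integral_cmult[symmetric]) (auto simp: h_def gauss_def ennreal_mult'[symmetric])
    also have "\<dots> = emeasure (gauss_measure (2 * t)) (UNIV :: (real^'n) set)"
      by (simp add: gauss_measure_def emeasure_density)
    also have "\<dots> = 1" using emeasure_space_1 by simp
    finally show ?thesis using c by (auto simp: ennreal_mult_eq_top_iff less_top[symmetric])
  qed
  finally have fin: "?S * J < \<infinity>" .
  have "J \<noteq> 0"
  proof
    assume "J = 0"
    then have "AE y in lborel. (y::real^'n) \<notin> unit_cube"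
      unfolding J_def by (subst (asm) nn_integral_0_iff_AE) (auto simp: indicator_def)
    then have "emeasure lborel (unit_cube :: (real^'n) set) = 0"
      by (subst (asm) AE_iff_measurable[of unit_cube]) auto
    then show False by (simp add: emeasure_unit_cube)
  qed
  then show ?thesis using fin by (auto simp: ennreal_mult_less_top)
qed

text \<open>Finiteness excludes the default value of \<open>infsum\<close>, so the defining series
  agrees with a nonnegative integral that can be exchanged with others.\<close>

lemma ennreal_heat_kernel:
  assumes t: "t > 0"
  shows "ennreal (heat_kernel t (tproj (z::real^'n::finite))) = (\<integral>\<^sup>+k. ennreal (gauss t (z + k)) \<partial>count_space int_lattice)"
proof -
  let ?c = "(4 * pi * t) powr (- (real CARD('n) / 2))"
  let ?f = "\<lambda>k. exp (- (norm (z + k))\<^sup>2 / (4 * t))"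
  have i: "integrable (count_space int_lattice) ?f"
    using lattice_gauss_finite[OF t, of z] by (intro integrableI_nonneg) auto
  have "infsum ?f int_lattice = (LINT k|count_space int_lattice. ?f k)"
    using infsetsum_infsum[of ?f int_lattice] i unfolding abs_summable_on_def infsetsum_def by simp
  then have "ennreal (infsum ?f int_lattice) = (\<integral>\<^sup>+k. ennreal (?f k) \<partial>count_space int_lattice)"
    using nn_integral_eq_integral[OF i] by simp
  then show ?thesis unfolding heat_kernel_tproj gauss_def
    by (simp add: ennreal_mult' nn_integral_cmult)
qed

lemma heat_kernel_nonneg [simp]: "0 \<le> heat_kernel t x"
proof -
  obtain z where "x = tproj z" by (rule tproj_cases)
  then show ?thesis by (auto simp: heat_kernel_tproj intro!: mult_nonneg_nonneg infsum_nonneg)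
qed

lemma heat_kernel_minus: "heat_kernel t (- x) = heat_kernel t x"
proof -
  obtain z where z: "x = tproj z" by (rule tproj_cases)
  have "infsum (\<lambda>k. exp (- (norm (- z + k))\<^sup>2 / (4 * t))) int_lattice
      = infsum (\<lambda>k. exp (- (norm (- z + - k))\<^sup>2 / (4 * t))) int_lattice"
    by (rule infsum_reindex_bij_betw[symmetric, where g=uminus and A=int_lattice])
       (auto intro!: bij_betwI[where g=uminus] simp: int_lattice_closed)
  also have "\<dots> = infsum (\<lambda>k. exp (- (norm (z + k))\<^sup>2 / (4 * t))) int_lattice"
    by (simp only: minus_add_distrib[symmetric] norm_minus_cancel)
  finally show ?thesis by (simp add: z tproj_minus[symmetric] heat_kernel_tproj)
qed

lemma heat_kernel_measurable [measurable]:
  assumes t: "t > 0" shows "heat_kernel t \<in> borel_measurable (borel :: 'n::finite torus measure)"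
proof (subst measurable_torus_comp_iff)
  have "(\<lambda>y::real^'n. heat_kernel t (tproj y)) = (\<lambda>y. enn2real (\<integral>\<^sup>+k. ennreal (gauss t (y + k)) \<partial>count_space int_lattice))"
    by (simp add: ennreal_heat_kernel[OF t, symmetric])
  moreover have "(\<lambda>y::real^'n. \<integral>\<^sup>+k. ennreal (gauss t (y + k)) \<partial>count_space int_lattice) \<in> borel_measurable borel"
  proof -
    have "(\<lambda>(y, k). ennreal (gauss t (y + k))) \<in> borel_measurable (borel \<Otimes>\<^sub>M count_space (int_lattice :: (real^'n) set))"
      using measurable_pair_swap[OF measurable_pair_measure_countable1[OF countable_int_lattice,
          where f="\<lambda>(k, y::real^'n). ennreal (gauss t (y + k))" and N=borel and K=borel]]
      by (simp add: split_beta')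
    then show ?thesis
      by (rule sigma_finite_measure.borel_measurable_nn_integral[OF sigma_finite_measure_count_space_countable[OF countable_int_lattice]])
  qed
  ultimately show "(\<lambda>y::real^'n. heat_kernel t (tproj y)) \<in> borel_measurable borel" by simp
qed

text \<open>Unfolding over the lattice periodises the Gaussian density. This is where lattice sums
  disappear: convolution with the kernel becomes an expectation over a vector w.\<close>

lemma distr_gauss_tproj:
  assumes t: "t > 0"
  shows "distr (gauss_measure t) borel tproj = density (torus_lebesgue :: 'n::finite torus measure) (\<lambda>x. ennreal (heat_kernel t x))"
proof (rule measure_eqI)
  note [measurable] = heat_kernel_measurable[OF t]
  fix A assume "A \<in> sets (distr (gauss_measure t) borel (tproj :: _ \<Rightarrow> 'n torus))"
  then have [measurable]: "A \<in> sets borel" by simp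
  have [measurable]: "tproj -` A \<in> sets borel"
    using measurable_sets[OF tproj_measurable, of A] by simp
  have "emeasure (distr (gauss_measure t) borel tproj) A = (\<integral>\<^sup>+w. ennreal (gauss t w) * indicator A (tproj w) \<partial>lborel)"
    unfolding gauss_measure_def
    by (subst emeasure_distr, simp, simp, subst emeasure_density) (auto intro!: nn_integral_cong simp: indicator_def)
  also have "\<dots> = (\<integral>\<^sup>+y. (\<integral>\<^sup>+k. ennreal (gauss t (y + k)) * indicator A (tproj (y + k)) \<partial>count_space int_lattice)
                      * indicator unit_cube y \<partial>lborel)"
    by (subst nn_integral_unfold) auto
  also have "\<dots> = (\<integral>\<^sup>+y. (ennreal (heat_kernel t (tproj y)) * indicator A (tproj y)) * indicator unit_cube y \<partial>lborel)"
  proof (intro nn_integral_cong arg_cong2[where f="(*)"] refl)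
    fix y :: "real^'n"
    have "(\<integral>\<^sup>+k. ennreal (gauss t (y + k)) * indicator A (tproj (y + k)) \<partial>count_space int_lattice)
       = (\<integral>\<^sup>+k. ennreal (gauss t (y + k)) * indicator A (tproj y) \<partial>count_space int_lattice)"
      by (intro nn_integral_cong) (auto simp: tproj_lattice)
    then show "(\<integral>\<^sup>+k. ennreal (gauss t (y + k)) * indicator A (tproj (y + k)) \<partial>count_space int_lattice)
        = ennreal (heat_kernel t (tproj y)) * indicator A (tproj y)"
      by (simp add: nn_integral_multc ennreal_heat_kernel[OF t])
  qed
  also have "\<dots> = (\<integral>\<^sup>+x. ennreal (heat_kernel t x) * indicator A x \<partial>torus_lebesgue)"
    by (subst nn_integral_torus) auto
  also have "\<dots> = emeasure (density torus_lebesgue (\<lambda>x. ennreal (heat_kernel t x))) A"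
    by (subst emeasure_density) auto
  finally show "emeasure (distr (gauss_measure t) borel tproj) A = emeasure (density torus_lebesgue (\<lambda>x. ennreal (heat_kernel t x))) A" .
qed simp

lemma heat_conv_eq:
  fixes u :: "'n::finite torus \<Rightarrow> real"
  assumes t: "t > 0" and [measurable]: "u \<in> borel_measurable borel"
  shows "heat_conv t u y = (LINT w|gauss_measure t. u (y + tproj w))"
proof -
  note [measurable] = heat_kernel_measurable[OF t]
  have [measurable]: "(\<lambda>z. z - y) \<in> borel \<rightarrow>\<^sub>M borel"
    using torus_shift_measurable[of "- y"] by simp
  have [measurable]: "(\<lambda>z. y + z) \<in> borel \<rightarrow>\<^sub>M borel"
    using torus_shift_measurable[of "y"] by (simp add: add.commute)
  have "heat_conv t u y = (LINT z|torus_lebesgue. heat_kernel t (z - y) * u z)"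
    unfolding heat_conv_def by (metis heat_kernel_minus minus_diff_eq)
  also have "\<dots> = (LINT z|torus_lebesgue. heat_kernel t z * u (y + z))"
    using integral_torus_shift[of "\<lambda>z. heat_kernel t (z - y) * u z" y] by (simp add: add.commute)
  also have "\<dots> = (LINT z|density torus_lebesgue (\<lambda>x. ennreal (heat_kernel t x)). u (y + z))"
    by (subst integral_density) auto
  also have "\<dots> = (LINT w|gauss_measure t. u (y + tproj w))"
    unfolding distr_gauss_tproj[OF t, symmetric] by (subst integral_distr) auto
  finally show ?thesis .
qed

lemma heat_conv_eq_minus:
  fixes u :: "'n::finite torus \<Rightarrow> real"
  assumes t: "t > 0" and [measurable]: "u \<in> borel_measurable borel"
  shows "heat_conv t u y = (LINT w|gauss_measure t. u (y - tproj w))"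
proof -
  have [measurable]: "(\<lambda>z. y + z) \<in> borel \<rightarrow>\<^sub>M borel"
    using torus_shift_measurable[of "y"] by (simp add: add.commute)
  show ?thesis
    unfolding heat_conv_eq[OF assms] by (subst distr_gauss_uminus[symmetric], subst integral_distr) (auto simp: tproj_minus)
qed

lemma heat_conv_const: "t > 0 \<Longrightarrow> heat_conv t (\<lambda>_. c) (y :: 'n::finite torus) = c"
proof -
  assume t: "t > 0"
  interpret prob_space "gauss_measure t :: (real^'n) measure" by (rule prob_space_gauss[OF t])
  show ?thesis by (subst heat_conv_eq[OF t]) (auto simp: prob_space[simplified])
qed

lemma torus_continuous_bounded:
  fixes f :: "'n::finite torus \<Rightarrow> real"
  assumes "continuous_on UNIV f"
  obtains B where "0 < B" "\<And>x. \<bar>f x\<bar> \<le> B"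
proof -
  have "bounded (range f)" using compact_continuous_image[OF assms compact_torus] by (rule compact_imp_bounded)
  then obtain B where "\<And>x. \<bar>f x\<bar> \<le> B" unfolding bounded_iff by auto
  then have "\<bar>f x\<bar> \<le> max B 1" for x by (simp add: le_max_iff_disj)
  then show ?thesis by (intro that[of "max B 1"]) auto
qed

lemma torus_plus_measurable [measurable]: "(\<lambda>z. a + z) \<in> borel \<rightarrow>\<^sub>M (borel :: 'n::finite torus measure)"
  using torus_shift_measurable[of a] by (simp add: add.commute)

lemma torus_minus_measurable [measurable]: "(\<lambda>z. z - a) \<in> borel \<rightarrow>\<^sub>M (borel :: 'n::finite torus measure)"
  using torus_shift_measurable[of "- a"] by simp

lemma continuous_torus_shift:
  assumes "continuous_on UNIV (f :: 'n::finite torus \<Rightarrow> 'b::topological_space)"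
  shows "continuous_on UNIV (\<lambda>x. f (x + a))"
proof -
  obtain b where b: "a = tproj b" by (rule tproj_cases)
  have "continuous_on UNIV (\<lambda>y. f (tproj (y + b)))"
    by (rule continuous_on_compose2[OF assms[unfolded continuous_torus_iff]]) (auto intro!: continuous_intros)
  then show ?thesis by (subst continuous_torus_iff) (simp add: b tproj_add)
qed

lemma continuous_torus_shift_minus:
  assumes "continuous_on UNIV (f :: 'n::finite torus \<Rightarrow> 'b::topological_space)"
  shows "continuous_on UNIV (\<lambda>x. f (x - a))"
  using continuous_torus_shift[OF assms, of "- a"] by simp

lemma continuous_torus_displace:
  fixes f :: "'n::finite torus \<Rightarrow> 'b::topological_space" and V :: "'n torus \<Rightarrow> real^'n"
  assumes f: "continuous_on UNIV f" and V: "continuous_on UNIV V"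
  shows "continuous_on UNIV (\<lambda>x. f (x + tproj (V x)))"
proof -
  have "continuous_on UNIV (\<lambda>y. f (tproj (y + V (tproj y))))"
    by (rule continuous_on_compose2[OF f[unfolded continuous_torus_iff]])
       (use V in \<open>auto intro!: continuous_intros simp: continuous_torus_iff\<close>)
  then show ?thesis by (subst continuous_torus_iff) (simp add: tproj_add)
qed

lemma continuous_borel [measurable_dest]:
  "continuous_on UNIV f \<Longrightarrow> f \<in> borel_measurable borel"
  by (rule borel_measurable_continuous_onI)

lemma integrable_torus:
  fixes f :: "'n::finite torus \<Rightarrow> real"
  assumes "continuous_on UNIV f"
  shows "integrable torus_lebesgue f"
proof -
  interpret prob_space "torus_lebesgue :: 'n torus measure" by (rule prob_space_torus_lebesgue)
  obtain B where "\<And>x. \<bar>f x\<bar> \<le> B" using torus_continuous_bounded[OF assms] by metis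
  moreover have "f \<in> borel_measurable torus_lebesgue"
    using continuous_borel[OF assms] measurable_cong_sets[OF torus_lebesgue_sets refl] by blast
  ultimately show ?thesis by (intro integrable_const_bound[of _ B]) auto
qed

lemma integrable_torus_prob:
  fixes f :: "'n::finite torus \<Rightarrow> real"
  assumes "continuous_on UNIV f" "M \<in> borel_prob_measures"
  shows "integrable M f"
proof -
  interpret prob_space M using assms by (simp add: borel_prob_measures_def)
  have [simp, measurable_cong]: "sets M = sets borel" using assms by (simp add: borel_prob_measures_def)
  obtain B where "\<And>x. \<bar>f x\<bar> \<le> B" using torus_continuous_bounded[OF assms(1)] by metis
  have "f \<in> borel_measurable M"
    using continuous_borel[OF assms(1)] measurable_cong_sets[OF \<open>sets M = sets borel\<close> refl] by blast
  with \<open>\<And>x. \<bar>f x\<bar> \<le> B\<close> show ?thesis by (intro integrable_const_bound[of _ B]) auto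
qed

lemma integrable_gauss:
  fixes f :: "'n::finite torus \<Rightarrow> real"
  assumes t: "t > 0" and "continuous_on UNIV f"
  shows "integrable (gauss_measure t) (\<lambda>w. f (x + tproj w))" "integrable (gauss_measure t) (\<lambda>w. f (x - tproj w))"
proof -
  interpret prob_space "gauss_measure t :: (real^'n) measure" by (rule prob_space_gauss[OF t])
  note [measurable] = continuous_borel[OF assms(2)]
  obtain B where "\<And>x. \<bar>f x\<bar> \<le> B" using torus_continuous_bounded[OF assms(2)] by metis
  then show "integrable (gauss_measure t) (\<lambda>w. f (x + tproj w))" by (intro integrable_const_bound[of _ B]) auto
  have "(\<lambda>w. f (x + tproj (- w))) \<in> borel_measurable (borel :: (real^'n) measure)" by measurable
  then have "(\<lambda>w. f (x - tproj w)) \<in> borel_measurable (borel :: (real^'n) measure)" by (simp add: tproj_minus)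
  then show "integrable (gauss_measure t) (\<lambda>w. f (x - tproj w))"
    using \<open>\<And>x. \<bar>f x\<bar> \<le> B\<close> by (intro integrable_const_bound[of _ B]) auto
qed

lemma heat_conv_cont:
  assumes "t > 0" "continuous_on UNIV u"
  shows "heat_conv t u y = (LINT w|gauss_measure t. u (y + tproj w))"
  using heat_conv_eq[OF assms(1) continuous_borel[OF assms(2)]] .

lemma heat_conv_mono:
  fixes u :: "'n::finite torus \<Rightarrow> real"
  assumes t: "t > 0" and "continuous_on UNIV u" "continuous_on UNIV v" and "\<And>w. u (x + w) \<le> v (y + w)"
  shows "heat_conv t u x \<le> heat_conv t v y"
  unfolding heat_conv_cont[OF t assms(2)] heat_conv_cont[OF t assms(3)]
  by (intro integral_mono integrable_gauss assms)

lemma heat_conv_bound: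
  fixes u :: "'n::finite torus \<Rightarrow> real"
  assumes t: "t > 0" and "continuous_on UNIV u" and "\<And>x. \<bar>u x\<bar> \<le> B"
  shows "\<bar>heat_conv t u x\<bar> \<le> B"
proof -
  have "heat_conv t u x \<le> B" "- B \<le> heat_conv t u x"
    using heat_conv_mono[OF t assms(2), of "\<lambda>_. B" x x] heat_conv_mono[OF t _ assms(2), of "\<lambda>_. - B" x x]
      assms(3) by (auto simp: heat_conv_const[OF t] abs_le_iff) (metis minus_le_iff)
  then show ?thesis by auto
qed

section \<open>Lipschitz functions on the torus and the heat flow\<close>

definition torus_lip :: "real \<Rightarrow> ('n::finite torus \<Rightarrow> real) \<Rightarrow> bool" where
  "torus_lip K f \<longleftrightarrow> (\<forall>x h. \<bar>f (x + tproj h) - f x\<bar> \<le> K * norm h)"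

lemma torus_lipD: "torus_lip K f \<Longrightarrow> \<bar>f (x + tproj h) - f x\<bar> \<le> K * norm h"
  by (simp add: torus_lip_def)

lemma torus_lip_nonneg: "torus_lip K (f :: 'n::finite torus \<Rightarrow> real) \<Longrightarrow> 0 \<le> K"
  using torus_lipD[of K f 0 "axis undefined 1"] by (auto intro: order_trans[OF abs_ge_zero])

lemma torus_lip_continuous: "torus_lip K f \<Longrightarrow> continuous_on UNIV f"
proof -
  assume f: "torus_lip K f"
  have "K-lipschitz_on UNIV (\<lambda>y. f (tproj y))"
  proof (rule lipschitz_onI)
    show "dist (f (tproj x)) (f (tproj y)) \<le> K * dist x y" for x y
      using torus_lipD[OF f, of "tproj y" "x - y"] by (simp add: tproj_add[symmetric] dist_norm)
  qed (rule torus_lip_nonneg[OF f])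
  then show ?thesis by (subst continuous_torus_iff) (rule lipschitz_on_continuous_on)
qed

lemma norm_cube_le: "h \<in> unit_cube \<Longrightarrow> norm (h :: real^'n::finite) \<le> real CARD('n)"
proof -
  assume "h \<in> unit_cube"
  then have "norm h \<le> (\<Sum>i\<in>UNIV. \<bar>h $ i\<bar>)" "\<And>i. \<bar>h $ i\<bar> \<le> 1" using norm_le_l1_cart[of h] by (auto simp: unit_cube_def less_imp_le)
  moreover have "(\<Sum>i\<in>(UNIV::'n set). \<bar>h $ i\<bar>) \<le> real CARD('n) * 1" using calculation(2) by (intro sum_bounded_above) auto
  ultimately show ?thesis by simp
qed

lemma torus_lip_osc:
  fixes f :: "'n::finite torus \<Rightarrow> real"
  assumes "torus_lip K f" shows "\<bar>f x - f y\<bar> \<le> K * real CARD('n)"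
proof -
  obtain h where h: "x - y = tproj h" "h \<in> unit_cube" by (rule tproj_cases)
  have "\<bar>f x - f y\<bar> \<le> K * norm h" using torus_lipD[OF assms, of y h] by (simp add: h(1)[symmetric])
  also have "\<dots> \<le> K * real CARD('n)" using norm_cube_le[OF h(2)] torus_lip_nonneg[OF assms] by (rule mult_left_mono)
  finally show ?thesis .
qed

lemma heat_conv_lip:
  assumes t: "t > 0" and f: "torus_lip K f" shows "torus_lip K (heat_conv t f)"
  unfolding torus_lip_def
proof (intro allI)
  fix x and h :: "real^'a"
  note c = torus_lip_continuous[OF f]
  interpret prob_space "gauss_measure t :: (real^'a) measure" by (rule prob_space_gauss[OF t])
  have "heat_conv t f (x + tproj h) - heat_conv t f x = (LINT w|gauss_measure t. f (x + tproj h + tproj w) - f (x + tproj w))"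
    unfolding heat_conv_cont[OF t c] by (subst Bochner_Integration.integral_diff) (auto intro: integrable_gauss t c)
  also have "\<bar>\<dots>\<bar> \<le> (LINT w|gauss_measure t. \<bar>f (x + tproj h + tproj w) - f (x + tproj w)\<bar>)"
    using integral_norm_bound[of "gauss_measure t" "\<lambda>w. f (x + tproj h + tproj w) - f (x + tproj w)"] by simp
  also have "\<dots> \<le> (LINT w|(gauss_measure t :: (real^'a) measure). K * norm h)"
  proof (intro integral_mono)
    show "\<bar>f (x + tproj h + tproj w) - f (x + tproj w)\<bar> \<le> K * norm h" for w :: "real^'a"
      using torus_lipD[OF f, of "x + tproj w" h] by (simp add: add_ac)
  qed (auto intro!: integrable_gauss t c Bochner_Integration.integrable_diff integrable_abs)
  also have "\<dots> = K * norm h" by (simp add: prob_space[simplified])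
  finally show "\<bar>heat_conv t f (x + tproj h) - heat_conv t f x\<bar> \<le> K * norm h" .
qed

lemma heat_conv_close:
  fixes f :: "'n::finite torus \<Rightarrow> real"
  assumes t: "t > 0" and f: "torus_lip K f"
  shows "\<bar>heat_conv t f x - f x\<bar> \<le> K * (real CARD('n) + 1) * sqrt t"
proof -
  note c = torus_lip_continuous[OF f]
  interpret prob_space "gauss_measure t :: (real^'n) measure" by (rule prob_space_gauss[OF t])
  have "heat_conv t f x - f x = (LINT w|gauss_measure t. f (x + tproj w) - f x)"
    unfolding heat_conv_cont[OF t c] by (subst Bochner_Integration.integral_diff) (auto intro: integrable_gauss t c simp: prob_space[simplified])
  also have "\<bar>\<dots>\<bar> \<le> (LINT w|gauss_measure t. \<bar>f (x + tproj w) - f x\<bar>)"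
    using integral_norm_bound[of "gauss_measure t" "\<lambda>w. f (x + tproj w) - f x"] by simp
  also have "\<dots> \<le> (LINT w|(gauss_measure t :: (real^'n) measure). K * norm w)"
    by (intro integral_mono torus_lipD[OF f])
       (auto intro!: integrable_gauss t c Bochner_Integration.integrable_diff integrable_abs integrable_mult_right gauss_norm(1))
  also have "\<dots> \<le> K * ((real CARD('n) + 1) * sqrt t)"
    using gauss_norm[OF t, where 'n='n] torus_lip_nonneg[OF f] by (auto intro: mult_left_mono)
  finally show ?thesis by simp
qed

text \<open>Self-adjointness of the heat semigroup: Fubini, a translation for each displacement w,
  and the symmetry of the Gaussian law. It lets the Laplacian fall on the density instead of the
  value function.\<close>

lemma heat_conv_duality:
  fixes u v :: "'n::finite torus \<Rightarrow> real"
  assumes t: "t > 0" and u: "continuous_on UNIV u" and v: "continuous_on UNIV v"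
  shows "(LINT y|torus_lebesgue. heat_conv t u y * v y) = (LINT y|torus_lebesgue. u y * heat_conv t v y)"
proof -
  note [measurable] = continuous_borel[OF u] continuous_borel[OF v]
  interpret G: prob_space "gauss_measure t :: (real^'n) measure" by (rule prob_space_gauss[OF t])
  interpret T: prob_space "torus_lebesgue :: 'n torus measure" by (rule prob_space_torus_lebesgue)
  interpret pair_prob_space "gauss_measure t :: (real^'n) measure" "torus_lebesgue :: 'n torus measure" ..
  \<comment> \<open>Joint measurability of the displaced argument is obtained by lifting y through
    the section, where addition is Borel; c is 1 for u and -1 for v.\<close>
  have m: "(\<lambda>(w, y). f (tproj (torus_section y + c *\<^sub>R w))) \<in> borel_measurable (gauss_measure t \<Otimes>\<^sub>M torus_lebesgue)"
    if [measurable]: "f \<in> borel_measurable borel" for f :: "'n torus \<Rightarrow> real" and c :: real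
    by measurable
  have [measurable]: "(\<lambda>(w, y). u (y + tproj w)) \<in> borel_measurable (gauss_measure t \<Otimes>\<^sub>M torus_lebesgue)"
    using m[of u 1] by (simp add: tproj_add)
  have [measurable]: "(\<lambda>(w, y). v (y - tproj w)) \<in> borel_measurable (gauss_measure t \<Otimes>\<^sub>M torus_lebesgue)"
    using m[of v "-1"] by (simp add: tproj_diff)
  obtain A where A: "\<And>x. \<bar>u x\<bar> \<le> A" using torus_continuous_bounded[OF u] by metis
  obtain B where B: "\<And>x. \<bar>v x\<bar> \<le> B" using torus_continuous_bounded[OF v] by metis
  have A0: "0 \<le> A" using A[of 0] by linarith
  have b: "\<bar>u x * v y\<bar> \<le> A * B" for x y unfolding abs_mult by (intro mult_mono A B A0) auto
  have "(LINT y|torus_lebesgue. heat_conv t u y * v y) = (LINT y|torus_lebesgue. LINT w|gauss_measure t. u (y + tproj w) * v y)"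
    by (simp add: heat_conv_cont[OF t u])
  also have "\<dots> = (LINT w|gauss_measure t. LINT y|torus_lebesgue. u (y + tproj w) * v y)"
  proof (rule Fubini_integral)
    show "integrable (gauss_measure t \<Otimes>\<^sub>M torus_lebesgue) (\<lambda>(w, y). u (y + tproj w) * v y)"
      using b by (intro integrable_const_bound[of _ "A * B"]) (auto simp: split_beta')
  qed
  also have "\<dots> = (LINT w|gauss_measure t. LINT y|torus_lebesgue. u y * v (y - tproj w))"
  proof (rule Bochner_Integration.integral_cong[OF refl])
    fix w :: "real^'n"
    show "(LINT y|torus_lebesgue. u (y + tproj w) * v y) = (LINT y|torus_lebesgue. u y * v (y - tproj w))"
      using integral_torus_shift[of "\<lambda>y. u y * v (y - tproj w)" "tproj w"] by simp
  qed
  also have "\<dots> = (LINT y|torus_lebesgue. LINT w|gauss_measure t. u y * v (y - tproj w))"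
  proof -
    have "integrable (gauss_measure t \<Otimes>\<^sub>M torus_lebesgue) (\<lambda>(w, y). u y * v (y - tproj w))"
      using b by (intro integrable_const_bound[of _ "A * B"]) (auto simp: split_beta')
    from Fubini_integral[OF this] show ?thesis by simp
  qed
  also have "\<dots> = (LINT y|torus_lebesgue. u y * heat_conv t v y)"
    by (simp add: heat_conv_eq_minus[OF t])
  finally show ?thesis .
qed

subsection \<open>Semiconvex functions\<close>

definition semiconvex :: "real \<Rightarrow> ('n::finite torus \<Rightarrow> real) \<Rightarrow> bool" where
  "semiconvex C f \<longleftrightarrow> (\<forall>x h. - C * (norm h)\<^sup>2 \<le> f (x + tproj h) + f (x - tproj h) - 2 * f x)"

lemma semiconvexD: "semiconvex C f \<Longrightarrow> - C * (norm h)\<^sup>2 \<le> f (x + tproj h) + f (x - tproj h) - 2 * f x"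
  by (simp add: semiconvex_def)

text \<open>Let g be the deviation from the chord. If its maximum were positive, its leftmost
  maximiser s would be interior; since g is strictly smaller at s - d and no larger at s + d, the
  midpoint inequality at s would fail.\<close>

lemma midpoint_convex_imp_convex:
  fixes f :: "'a::real_normed_vector \<Rightarrow> real"
  assumes c: "continuous_on UNIV f" and mid: "\<And>a b. 2 * f ((1/2) *\<^sub>R (a + b)) \<le> f a + f b"
  shows "convex_on UNIV f"
proof (rule convex_onI)
  fix t :: real and a b :: 'a assume t: "0 < t" "t < 1"
  define g where "g s = f ((1 - s) *\<^sub>R a + s *\<^sub>R b) - ((1 - s) * f a + s * f b)" for s
  have cg: "continuous_on {0..1} g" unfolding g_def
    by (intro continuous_intros continuous_on_compose2[OF c]) auto
  have gmid: "2 * g ((x + y) / 2) \<le> g x + g y" for x y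
  proof -
    have half: "(1/2) *\<^sub>R c + (1/2) *\<^sub>R c = c" for c :: 'a
      by (metis scaleR_half_double scaleR_right_distrib)
    have "(1/2) *\<^sub>R (((1 - x) *\<^sub>R a + x *\<^sub>R b) + ((1 - y) *\<^sub>R a + y *\<^sub>R b)) = (1 - (x + y) / 2) *\<^sub>R a + ((x + y) / 2) *\<^sub>R b"
      by (simp add: algebra_simps add_divide_distrib half)
    from mid[of "(1 - x) *\<^sub>R a + x *\<^sub>R b" "(1 - y) *\<^sub>R a + y *\<^sub>R b", unfolded this]
    show ?thesis
      unfolding g_def by (simp add: algebra_simps add_divide_distrib)
  qed
  have "\<exists>x\<in>{0..1}. \<forall>y\<in>{0..1}. g y \<le> g x" using cg by (intro continuous_attains_sup) auto
  then obtain x where x: "x \<in> {0..1}" "\<And>y. y \<in> {0..1} \<Longrightarrow> g y \<le> g x" by blast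
  define A where "A = {s\<in>{0..1}. g s = g x}"
  have "closed A" unfolding A_def using continuous_closed_preimage_constant[OF cg closed_atLeastAtMost, of "g x"] by simp
  then have "compact A" using compact_Int_closed[of "{0..1}" A] by (simp add: A_def Int_absorb1 subset_iff Int_commute)
  moreover have "A \<noteq> {}" using x(1) by (auto simp: A_def)
  ultimately obtain s where s: "s \<in> A" "\<And>r. r \<in> A \<Longrightarrow> s \<le> r" using compact_attains_inf by metis
  have "g x \<le> 0"
  proof (rule ccontr)
    assume pos: "\<not> g x \<le> 0"
    have "g 0 = 0" "g 1 = 0" by (auto simp: g_def)
    with pos s(1) have s01: "0 < s" "s < 1" unfolding A_def by (auto simp: less_le)
    define d where "d = min s (1 - s)"
    have d: "0 < d" "0 \<le> s - d" "s + d \<le> 1" using s01 by (auto simp: d_def)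
    have "s - d \<notin> A" using s(2)[of "s - d"] d by auto
    then have "g (s - d) < g x" using x(2)[of "s - d"] d s01 by (auto simp: A_def less_le)
    moreover have "g (s + d) \<le> g x" using x(2)[of "s + d"] d s01 by auto
    moreover have "g s = g x" using s(1) by (simp add: A_def)
    ultimately show False using gmid[of "s - d" "s + d"] by simp
  qed
  then have "g t \<le> 0" using x(2)[of t] t by auto
  then show "f ((1 - t) *\<^sub>R a + t *\<^sub>R b) \<le> (1 - t) * f a + t * f b" by (simp add: g_def)
qed simp

text \<open>By the parallelogram law the added quadratic has second difference C |d|^2, exactly
  compensating the lower bound; continuity then upgrades midpoint convexity.\<close>

lemma semiconvex_convex:
  fixes f :: "'n::finite torus \<Rightarrow> real"
  assumes f: "semiconvex C f" and c: "continuous_on UNIV f"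
  shows "convex_on UNIV (\<lambda>h. f (x + tproj h) + C / 2 * (norm h)\<^sup>2)"
proof (rule midpoint_convex_imp_convex)
  have "continuous_on UNIV (\<lambda>h. f (tproj h + x))"
    using continuous_torus_shift[OF c, of x] by (subst (asm) continuous_torus_iff)
  then show "continuous_on UNIV (\<lambda>h. f (x + tproj h) + C / 2 * (norm h)\<^sup>2)"
    by (intro continuous_intros) (simp add: add.commute)
  fix a b :: "real^'n"
  define p where "p = (1/2) *\<^sub>R (a + b)"
  define d where "d = (1/2) *\<^sub>R (b - a)"
  have ab: "b = p + d" "a = p - d"
    unfolding p_def d_def by (simp_all add: vec_eq_iff field_simps)
  have "(norm b)\<^sup>2 + (norm a)\<^sup>2 = 2 * (norm p)\<^sup>2 + 2 * (norm d)\<^sup>2"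
    unfolding ab by (simp add: power2_norm_eq_inner algebra_simps inner_commute)
  moreover have "- C * (norm d)\<^sup>2 \<le> f (x + tproj b) + f (x + tproj a) - 2 * f (x + tproj p)"
    using semiconvexD[OF f, of d "x + tproj p"] unfolding ab by (simp add: tproj_add tproj_diff add_ac diff_add_eq add_diff_eq)
  ultimately have "C * ((norm b)\<^sup>2 + (norm a)\<^sup>2) / 2 = C * (norm p)\<^sup>2 + C * (norm d)\<^sup>2" by (simp add: algebra_simps)
  with \<open>- C * (norm d)\<^sup>2 \<le> _\<close>
  show "2 * (f (x + tproj ((1/2) *\<^sub>R (a + b))) + C / 2 * (norm ((1/2) *\<^sub>R (a + b)))\<^sup>2)
       \<le> f (x + tproj a) + C / 2 * (norm a)\<^sup>2 + (f (x + tproj b) + C / 2 * (norm b)\<^sup>2)"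
    unfolding p_def[symmetric] by (simp add: algebra_simps add_divide_distrib)
qed

lemma tproj_axis_int: "tproj (axis i 1 :: real^'n::finite) = 0"
  using tproj_lattice[of "axis i 1" 0] by (simp add: int_lattice_def axis_def)

text \<open>Periodicity turns a one-sided second-order bound into a first-order one. A unit axis
  vector projects to 0, so the convex function of \<open>semiconvex_convex\<close> takes the values
  f x and f x + C / 2 at the ends of the segment, and interpolation bounds the increment.\<close>

lemma semiconvex_axis_step:
  fixes f :: "'n::finite torus \<Rightarrow> real"
  assumes f: "semiconvex C f" and c: "continuous_on UNIV f" and C: "0 \<le> C" and s: "0 \<le> s" "s \<le> 1" and e: "e = 1 \<or> e = -1"
  shows "f (x + tproj ((s * e) *\<^sub>R axis i 1)) - f x \<le> C / 2 * s"
proof -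
  let ?e = "e *\<^sub>R axis i 1 :: real^'n"
  have "tproj ?e = 0" using e tproj_axis_int[of i] by (auto simp: tproj_minus)
  moreover have "norm ?e = 1" using e by auto
  ultimately have "f (x + tproj ((1 - s) *\<^sub>R 0 + s *\<^sub>R ?e)) + C / 2 * (norm ((1 - s) *\<^sub>R 0 + s *\<^sub>R ?e))\<^sup>2
     \<le> (1 - s) * f x + s * (f x + C / 2)"
    using convex_onD[OF semiconvex_convex[OF f c, of x], of s 0 ?e] s by simp
  moreover have "0 \<le> C / 2 * (norm ((1 - s) *\<^sub>R 0 + s *\<^sub>R ?e))\<^sup>2" using C by simp
  ultimately have "f (x + tproj ((1 - s) *\<^sub>R 0 + s *\<^sub>R ?e)) \<le> (1 - s) * f x + s * (f x + C / 2)" by linarith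
  then show ?thesis by (simp add: algebra_simps)
qed

lemma semiconvex_axis_abs:
  fixes f :: "'n::finite torus \<Rightarrow> real"
  assumes f: "semiconvex C f" and c: "continuous_on UNIV f" and C: "0 \<le> C" and s: "\<bar>s\<bar> \<le> 1"
  shows "\<bar>f (x + tproj (s *\<^sub>R axis i 1)) - f x\<bar> \<le> C / 2 * \<bar>s\<bar>"
proof -
  define e :: real where "e = (if s \<ge> 0 then 1 else -1)"
  have e: "e = 1 \<or> e = -1" "- e = 1 \<or> - e = -1" and se: "\<bar>s\<bar> * e = s" "\<bar>s\<bar> * - e = - s" by (auto simp: e_def)
  have "f (x + tproj (s *\<^sub>R axis i 1)) - f x \<le> C / 2 * \<bar>s\<bar>"
    using semiconvex_axis_step[OF f c C _ s e(1), of x i] by (simp add: se)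
  \<comment> \<open>The opposite inequality is the same upper bound for the step back from the end
    point.\<close>
  moreover have "f x - f (x + tproj (s *\<^sub>R axis i 1)) \<le> C / 2 * \<bar>s\<bar>"
    using semiconvex_axis_step[OF f c C _ s e(2), of "x + tproj (s *\<^sub>R axis i 1)" i]
    unfolding se(2) by (simp add: tproj_minus)
  ultimately show ?thesis by linarith
qed

lemma semiconvex_lip_step:
  fixes f :: "'n::finite torus \<Rightarrow> real"
  assumes f: "semiconvex C f" and c: "continuous_on UNIV f" and C: "0 \<le> C" and h: "\<And>i. \<bar>h $ i\<bar> \<le> 1"
  shows "\<bar>f (x + tproj (\<Sum>i\<in>I. h $ i *\<^sub>R axis i 1)) - f x\<bar> \<le> C / 2 * (\<Sum>i\<in>I. \<bar>h $ i\<bar>)"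
proof -
  have "finite I" by simp
  then show ?thesis
  proof (induction I rule: finite_induct)
    case (insert j I)
    let ?y = "x + tproj (\<Sum>i\<in>I. h $ i *\<^sub>R axis i 1)"
    have "\<bar>f (?y + tproj (h $ j *\<^sub>R axis j 1)) - f ?y\<bar> \<le> C / 2 * \<bar>h $ j\<bar>"
      by (rule semiconvex_axis_abs[OF f c C h])
    moreover have eq: "x + tproj (\<Sum>i\<in>insert j I. h $ i *\<^sub>R axis i 1) = ?y + tproj (h $ j *\<^sub>R axis j 1)"
      using insert by (simp add: tproj_add add_ac)
    ultimately have "\<bar>f (x + tproj (\<Sum>i\<in>insert j I. h $ i *\<^sub>R axis i 1)) - f x\<bar> \<le> C / 2 * \<bar>h $ j\<bar> + C / 2 * (\<Sum>i\<in>I. \<bar>h $ i\<bar>)"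
      unfolding eq using insert.IH by linarith
    then show ?case using insert by (simp add: algebra_simps)
  qed simp
qed

lemma vec_eq_sum_axis: "(\<Sum>i\<in>UNIV. h $ i *\<^sub>R axis i 1) = (h :: real^'n::finite)"
  by (simp add: vec_eq_iff axis_def if_distrib cong: if_cong)

lemma semiconvex_lip:
  fixes f :: "'n::finite torus \<Rightarrow> real"
  assumes f: "semiconvex C f" and c: "continuous_on UNIV f" and C: "0 \<le> C"
  shows "torus_lip (C * real CARD('n)) f"
  unfolding torus_lip_def
proof (intro allI)
  fix x and h :: "real^'n"
  have le: "\<bar>f (x + tproj k) - f x\<bar> \<le> C / 2 * (\<Sum>i\<in>UNIV. \<bar>k $ i\<bar>)" if "\<And>i. \<bar>k $ i\<bar> \<le> 1" for k :: "real^'n"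
    using semiconvex_lip_step[OF f c C that, of x UNIV] by (simp add: vec_eq_sum_axis)
  have C2: "C / 2 * a \<le> C * b" if "a \<le> b" "0 \<le> b" for a b
  proof -
    have "C / 2 * a \<le> C / 2 * b" using that C by (intro mult_left_mono) auto
    also have "\<dots> \<le> C * b" using that C by (intro mult_right_mono) auto
    finally show ?thesis .
  qed
  show "\<bar>f (x + tproj h) - f x\<bar> \<le> C * real CARD('n) * norm h"
  proof (cases "\<forall>i. \<bar>h $ i\<bar> \<le> 1")
    case True
    have "(\<Sum>i\<in>(UNIV::'n set). \<bar>h $ i\<bar>) \<le> real CARD('n) * norm h"
      by (intro sum_bounded_above) (auto intro: component_le_norm_cart)
    from C2[OF this] le[of h] True show ?thesis by simp
  next
    case False
    then obtain i where "\<bar>h $ i\<bar> > 1" by (auto simp: not_le)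
    then have n1: "norm h \<ge> 1" using component_le_norm_cart[of h i] by linarith
    \<comment> \<open>A displacement with a coordinate beyond 1 is reduced modulo the lattice; norm
      h \<ge> 1 then dominates every coordinate of the reduced vector.\<close>
    define k where "k = (\<chi> i. frac (h $ i))"
    have "tproj k = tproj h" using tproj_section[of "tproj h"] by (simp add: k_def section_tproj)
    moreover have k1: "\<bar>k $ i\<bar> \<le> 1" for i by (simp add: k_def frac_lt_1 less_imp_le)
    moreover have "(\<Sum>i\<in>(UNIV::'n set). \<bar>k $ i\<bar>) \<le> real CARD('n) * norm h"
      using k1 n1 by (intro sum_bounded_above) (auto intro: order_trans)
    ultimately show ?thesis using le[of k] C2[of "\<Sum>i\<in>UNIV. \<bar>k $ i\<bar>" "real CARD('n) * norm h"] by simp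
  qed
qed

lemma heat_conv_semiconvex:
  assumes t: "t > 0" and f: "semiconvex C f" and c: "continuous_on UNIV (f :: 'n::finite torus \<Rightarrow> real)"
  shows "semiconvex C (heat_conv t f)"
  unfolding semiconvex_def
proof (intro allI)
  fix x and h :: "real^'n"
  interpret prob_space "gauss_measure t :: (real^'n) measure" by (rule prob_space_gauss[OF t])
  have i: "integrable (gauss_measure t) (\<lambda>w. f (a + tproj w))" for a by (rule integrable_gauss[OF t c])
  have "- C * (norm h)\<^sup>2 = (LINT w|(gauss_measure t :: (real^'n) measure). - C * (norm h)\<^sup>2)" by (simp add: prob_space[simplified])
  also have "\<dots> \<le> (LINT w|gauss_measure t. f (x + tproj h + tproj w) + f (x - tproj h + tproj w) - 2 * f (x + tproj w))"
  proof (intro integral_mono)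
    show "- C * (norm h)\<^sup>2 \<le> f (x + tproj h + tproj w) + f (x - tproj h + tproj w) - 2 * f (x + tproj w)" for w :: "real^'n"
    proof -
      have "x + tproj h + tproj w = x + tproj w + tproj h" "x - tproj h + tproj w = x + tproj w - tproj h"
        by (simp_all add: algebra_simps)
      then show ?thesis using semiconvexD[OF f, of h "x + tproj w"] by (simp only:)
    qed
  qed (auto intro!: Bochner_Integration.integrable_diff Bochner_Integration.integrable_add integrable_mult_right i)
  also have "\<dots> = heat_conv t f (x + tproj h) + heat_conv t f (x - tproj h) - 2 * heat_conv t f x"
    unfolding heat_conv_cont[OF t c] using i by simp
  finally show "- C * (norm h)\<^sup>2 \<le> heat_conv t f (x + tproj h) + heat_conv t f (x - tproj h) - 2 * heat_conv t f x" .
qed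

subsection \<open>Discrete holonomy and transport\<close>

lemma fst_snd_measurable:
  assumes s: "sets M = sets (borel :: ('n::finite torus \<times> (real^'n)) measure)"
  shows "fst \<in> M \<rightarrow>\<^sub>M borel" "snd \<in> M \<rightarrow>\<^sub>M borel"
proof -
  have "fst \<in> (borel :: ('n torus \<times> (real^'n)) measure) \<rightarrow>\<^sub>M borel"
    by (intro borel_measurable_continuous_onI continuous_intros)
  then show "fst \<in> M \<rightarrow>\<^sub>M borel" using measurable_cong_sets[OF s refl] by blast
  have "snd \<in> (borel :: ('n torus \<times> (real^'n)) measure) \<rightarrow>\<^sub>M borel"
    by (intro borel_measurable_continuous_onI continuous_intros)
  then show "snd \<in> M \<rightarrow>\<^sub>M borel" using measurable_cong_sets[OF s refl] by blast
qed

lemma C_set_prob: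
  assumes "M \<in> C_set t"
  shows "prob_space M" "sets M = sets borel" "Pr1 M \<in> borel_prob_measures" "prob_space (Pr1 M)" "sets (Pr1 M) = sets borel"
proof -
  show p: "prob_space M" and s: "sets M = sets borel"
    using assms by (auto simp: C_set_def P_ell_def borel_prob_measures_def)
  have "fst \<in> M \<rightarrow>\<^sub>M borel"
    by (rule fst_snd_measurable(1)[OF s])
  then show "prob_space (Pr1 M)" unfolding Pr1_def by (rule prob_space.prob_space_distr[OF p])
  then show "Pr1 M \<in> borel_prob_measures" by (simp add: borel_prob_measures_def Pr1_def)
  show "sets (Pr1 M) = sets borel" by (simp add: Pr1_def)
qed

lemma integral_Pr1:
  assumes "sets M = sets borel" and [measurable]: "f \<in> borel_measurable borel"
  shows "(LINT x|Pr1 M. (f x :: real)) = (LINT p|M. f (fst p))"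
  unfolding Pr1_def using fst_snd_measurable[OF assms(1)] by (subst integral_distr) auto

text \<open>The defining identity says that \<open>Pr1 M\<close> has density q, the average of the
  kernel over M; Fubini then moves the kernel onto f. In this tested form the condition makes the
  value function u cancel in \<open>upper_energy\<close>.\<close>

lemma C_set_integral:
  fixes M :: "('n::finite torus \<times> (real^'n)) measure"
  assumes t: "t > 0" and M: "M \<in> C_set t" and f: "continuous_on UNIV f"
  shows "(LINT x|Pr1 M. f x) = (LINT p|M. heat_conv t f (fst p + tproj (t *\<^sub>R snd p)))"
proof -
  note [measurable] = heat_kernel_measurable[OF t] continuous_borel[OF f]
  note MM = C_set_prob[OF M]
  note [measurable] = fst_snd_measurable[OF MM(2)]
  interpret M: prob_space M by (rule MM)
  interpret PR: prob_space "Pr1 M" by (rule MM)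
  interpret T: prob_space "torus_lebesgue :: 'n torus measure" by (rule prob_space_torus_lebesgue)
  interpret pair_prob_space M "torus_lebesgue :: 'n torus measure" ..
  define K where "K p z = heat_kernel t (fst p + tproj (t *\<^sub>R snd p) - z)" for p :: "'n torus \<times> (real^'n)" and z :: "'n torus"
  have K0: "0 \<le> K p z" for p z by (simp add: K_def)
  have [measurable]: "case_prod K \<in> borel_measurable (M \<Otimes>\<^sub>M torus_lebesgue)"
  proof -
    have "(\<lambda>(p, z). heat_kernel t (tproj (torus_section (fst p) + t *\<^sub>R snd p - torus_section z))) \<in> borel_measurable (M \<Otimes>\<^sub>M torus_lebesgue)"
      by measurable
    then show ?thesis by (simp add: K_def[abs_def] tproj_add tproj_diff)
  qed
  have [measurable]: "(\<lambda>z. K p z) \<in> borel_measurable borel" for p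
  proof -
    have "(\<lambda>z. heat_kernel t (z - (fst p + tproj (t *\<^sub>R snd p)))) \<in> borel_measurable borel" by measurable
    moreover have "heat_kernel t (z - (fst p + tproj (t *\<^sub>R snd p))) = K p z" for z
      unfolding K_def by (metis heat_kernel_minus minus_diff_eq)
    ultimately show ?thesis by simp
  qed
  have K1: "(\<integral>\<^sup>+z. ennreal (K p z) \<partial>torus_lebesgue) = 1" for p
  proof -
    let ?y = "fst p + tproj (t *\<^sub>R snd p)"
    interpret D: prob_space "density (torus_lebesgue :: 'n torus measure) (\<lambda>x. ennreal (heat_kernel t x))"
      unfolding distr_gauss_tproj[OF t, symmetric] by (intro prob_space.prob_space_distr[OF prob_space_gauss[OF t]]) simp
    have "(\<integral>\<^sup>+z. ennreal (K p z) \<partial>torus_lebesgue) = (\<integral>\<^sup>+z. ennreal (heat_kernel t (z - ?y)) \<partial>torus_lebesgue)"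
      unfolding K_def by (intro nn_integral_cong) (metis heat_kernel_minus minus_diff_eq)
    also have "\<dots> = (\<integral>\<^sup>+z. ennreal (heat_kernel t z) \<partial>(torus_lebesgue :: 'n torus measure))"
    proof -
      have mm: "(\<lambda>z. ennreal (heat_kernel t (z - ?y))) \<in> borel_measurable borel" by measurable
      show ?thesis using nn_integral_torus_shift[OF mm, of ?y] unfolding add_diff_cancel by (rule sym)
    qed
    also have "\<dots> = 1" using D.emeasure_space_1 by (simp add: emeasure_density)
    finally show ?thesis .
  qed
  \<comment> \<open>The average may be infinite on a null set of z, where the Bochner integral in
    \<open>C_set\<close> is 0 by convention; \<open>enn2real\<close> reproduces that value.\<close>
  define q where "q z = (\<integral>\<^sup>+p. ennreal (K p z) \<partial>M)" for z
  have [measurable]: "q \<in> borel_measurable torus_lebesgue" unfolding q_def by measurable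
  have q1: "(\<integral>\<^sup>+z. q z \<partial>torus_lebesgue) = 1"
    unfolding q_def by (subst Fubini') (auto simp: K1 M.emeasure_space_1[simplified])
  then have qfin: "AE z in torus_lebesgue. q z \<noteq> \<infinity>" by (intro nn_integral_PInf_AE) auto
  have qK: "(LINT p|M. K p z) = enn2real (q z)" for z
    unfolding q_def by (intro integral_eq_nn_integral) (auto simp: K0)
  have dens: "Pr1 M = density torus_lebesgue (\<lambda>z. ennreal (enn2real (q z)))"
  proof (rule measure_eqI)
    show "sets (Pr1 M) = sets (density torus_lebesgue (\<lambda>z. ennreal (enn2real (q z))))" by (simp add: MM)
    fix A assume "A \<in> sets (Pr1 M)"
    then have A[measurable]: "A \<in> sets borel" by (simp add: MM)
    have le: "(\<integral>\<^sup>+z. ennreal (enn2real (q z)) * indicator A z \<partial>torus_lebesgue) \<le> 1"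
      unfolding q1[symmetric] by (intro nn_integral_mono) (auto simp: indicator_def ennreal_enn2real_if)
    have "measure (Pr1 M) A = (LINT z:A|torus_lebesgue. LINT (x, q)|M. heat_kernel t (x + tproj (t *\<^sub>R q) - z))"
      using M A unfolding C_set_def by blast
    also have "\<dots> = (LINT z|torus_lebesgue. enn2real (q z) * indicator A z)"
      unfolding set_lebesgue_integral_def qK[symmetric] K_def by (simp add: split_beta' mult.commute)
    also have "\<dots> = enn2real (\<integral>\<^sup>+z. ennreal (enn2real (q z)) * indicator A z \<partial>torus_lebesgue)"
      by (subst integral_eq_nn_integral) (auto simp: ennreal_mult' ennreal_indicator)
    finally have "ennreal (measure (Pr1 M) A) = (\<integral>\<^sup>+z. ennreal (enn2real (q z)) * indicator A z \<partial>torus_lebesgue)"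
      using le by (simp add: ennreal_enn2real_if top_unique) (metis ennreal_one_neq_top neq_top_trans)
    then show "emeasure (Pr1 M) A = emeasure (density torus_lebesgue (\<lambda>z. ennreal (enn2real (q z)))) A"
      by (simp add: PR.emeasure_eq_measure emeasure_density)
  qed
  obtain B where B: "0 < B" "\<And>x. \<bar>f x\<bar> \<le> B" using torus_continuous_bounded[OF f] by metis
  \<comment> \<open>Integrability on the product follows from the unit mass of the kernel in z and
    the bound B on f.\<close>
  have int: "integrable (M \<Otimes>\<^sub>M torus_lebesgue) (\<lambda>(p, z). K p z * f z)"
  proof (rule integrableI_bounded)
    show "(\<lambda>(p, z). K p z * f z) \<in> borel_measurable (M \<Otimes>\<^sub>M torus_lebesgue)" by measurable
    have "(\<integral>\<^sup>+x. ennreal (norm (case x of (p, z) \<Rightarrow> K p z * f z)) \<partial>(M \<Otimes>\<^sub>M torus_lebesgue))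
        \<le> (\<integral>\<^sup>+x. ennreal B * ennreal (case x of (p, z) \<Rightarrow> K p z) \<partial>(M \<Otimes>\<^sub>M torus_lebesgue))"
    proof (intro nn_integral_mono, clarify)
      fix p z
      have "norm (K p z * f z) \<le> B * K p z" using mult_left_mono[OF B(2)[of z] K0[of p z]] by (simp add: abs_mult K0 mult.commute)
      then show "ennreal (norm (K p z * f z)) \<le> ennreal B * ennreal (K p z)"
        using B(1) K0 by (simp add: ennreal_mult[symmetric] ennreal_leI)
    qed
    also have "\<dots> = ennreal B * (\<integral>\<^sup>+p. \<integral>\<^sup>+z. ennreal (K p z) \<partial>torus_lebesgue \<partial>M)"
      by (subst nn_integral_cmult, simp, subst T.nn_integral_fst[symmetric]) auto
    also have "\<dots> = ennreal B" by (simp add: K1 M.emeasure_space_1[simplified])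
    finally show "(\<integral>\<^sup>+x. ennreal (norm (case x of (p, z) \<Rightarrow> K p z * f z)) \<partial>(M \<Otimes>\<^sub>M torus_lebesgue)) < \<infinity>"
      by (simp add: less_top[symmetric] top_unique) (metis ennreal_neq_top neq_top_trans)
  qed
  have "(LINT x|Pr1 M. f x) = (LINT z|torus_lebesgue. enn2real (q z) * f z)"
    unfolding dens by (subst integral_density) auto
  also have "\<dots> = (LINT z|torus_lebesgue. LINT p|M. K p z * f z)"
    by (simp add: qK[symmetric])
  also have "\<dots> = (LINT p|M. LINT z|torus_lebesgue. K p z * f z)"
    by (rule Fubini_integral[OF int])
  also have "\<dots> = (LINT p|M. heat_conv t f (fst p + tproj (t *\<^sub>R snd p)))"
    by (simp add: K_def heat_conv_def)
  finally show ?thesis .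
qed

lemma sum_option_UNIV: "(\<Sum>i\<in>(UNIV :: 'n::finite option set). f i) = f None + (\<Sum>i\<in>UNIV. f (Some i))"
  by (simp add: UNIV_option_conv sum.reindex)

text \<open>Jensen's inequality for the convex function of \<open>semiconvex_convex\<close> at the
  point t v with weight 1 and the points - t sgn (v $ i) e_i with weights \<bar>v $ i\<bar>: their
  barycentre is 0. No derivative of f enters.\<close>

lemma semiconvex_jensen:
  fixes f :: "'n::finite torus \<Rightarrow> real"
  assumes f: "semiconvex C f" and c: "continuous_on UNIV f"
  shows "(1 + (\<Sum>i\<in>UNIV. \<bar>v $ i\<bar>)) * f x \<le> f (x + tproj (t *\<^sub>R v))
    + (\<Sum>i\<in>UNIV. \<bar>v $ i\<bar> * f (x - tproj ((t * sgn (v $ i)) *\<^sub>R axis i 1)))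
    + C / 2 * t\<^sup>2 * ((norm v)\<^sup>2 + (\<Sum>i\<in>UNIV. \<bar>v $ i\<bar>))"
proof -
  let ?psi = "\<lambda>h. f (x + tproj h) + C / 2 * (norm h)\<^sup>2"
  define l where "l = (\<Sum>i\<in>UNIV. \<bar>v $ i\<bar>)"
  have l0: "0 \<le> l" by (simp add: l_def sum_nonneg)
  \<comment> \<open>\<open>None\<close> indexes the point t v and \<open>Some i\<close> the axis
    step that compensates its i-th coordinate; 1 + l normalises the weights.\<close>
  define w where "w k = (case k of None \<Rightarrow> 1 / (1 + l) | Some i \<Rightarrow> \<bar>v $ i\<bar> / (1 + l))" for k
  define y where "y k = (case k of None \<Rightarrow> t *\<^sub>R v | Some i \<Rightarrow> - ((t * sgn (v $ i)) *\<^sub>R axis i 1))" for k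
  have w1: "(\<Sum>k\<in>UNIV. w k) = 1"
    using l0 unfolding sum_option_UNIV by (simp add: w_def sum_divide_distrib[symmetric] l_def[symmetric] add_divide_distrib[symmetric])
  have w0: "w k \<ge> 0" for k using l0 by (cases k) (auto simp: w_def)
  have "(\<Sum>k\<in>UNIV. w k *\<^sub>R y k) = (1 / (1 + l)) *\<^sub>R (t *\<^sub>R v - (\<Sum>i\<in>UNIV. (\<bar>v $ i\<bar> * (t * sgn (v $ i))) *\<^sub>R axis i 1))"
    unfolding sum_option_UNIV by (simp add: w_def y_def scaleR_right.sum scaleR_diff_right sum_negf)
  also have "(\<Sum>i\<in>UNIV. (\<bar>v $ i\<bar> * (t * sgn (v $ i))) *\<^sub>R axis i 1) = (\<Sum>i\<in>UNIV. (t *\<^sub>R v) $ i *\<^sub>R axis i 1)"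
    by (intro sum.cong refl) (simp add: abs_mult_sgn mult.left_commute)
  also have "\<dots> = t *\<^sub>R v" by (rule vec_eq_sum_axis)
  finally have y0: "(\<Sum>k\<in>UNIV. w k *\<^sub>R y k) = 0" by simp
  have "?psi (\<Sum>k\<in>UNIV. w k *\<^sub>R y k) \<le> (\<Sum>k\<in>UNIV. w k * ?psi (y k))"
    by (rule convex_on_sum[OF _ _ semiconvex_convex[OF f c]]) (auto simp: w1 w0)
  then have "f x \<le> (\<Sum>k\<in>UNIV. w k * ?psi (y k))" by (simp add: y0)
  also have "\<dots> = (1 / (1 + l)) * (?psi (t *\<^sub>R v) + (\<Sum>i\<in>UNIV. \<bar>v $ i\<bar> * ?psi (- ((t * sgn (v $ i)) *\<^sub>R axis i 1))))"
    unfolding sum_option_UNIV by (simp add: w_def y_def sum_divide_distrib distrib_left add_divide_distrib mult.commute[of l 2])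
  finally have "(1 + l) * f x \<le> ?psi (t *\<^sub>R v) + (\<Sum>i\<in>UNIV. \<bar>v $ i\<bar> * ?psi (- ((t * sgn (v $ i)) *\<^sub>R axis i 1)))"
    using l0 by (simp add: pos_le_divide_eq mult.commute)
  also have "(\<Sum>i\<in>UNIV. \<bar>v $ i\<bar> * ?psi (- ((t * sgn (v $ i)) *\<^sub>R axis i 1)))
    = (\<Sum>i\<in>UNIV. \<bar>v $ i\<bar> * f (x - tproj ((t * sgn (v $ i)) *\<^sub>R axis i 1)) + C / 2 * t\<^sup>2 * \<bar>v $ i\<bar>)"
    by (intro sum.cong refl) (auto simp: tproj_minus algebra_simps sgn_real_def power_mult_distrib)
  also have "?psi (t *\<^sub>R v) + \<dots> = f (x + tproj (t *\<^sub>R v))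
    + (\<Sum>i\<in>UNIV. \<bar>v $ i\<bar> * f (x - tproj ((t * sgn (v $ i)) *\<^sub>R axis i 1)))
    + C / 2 * t\<^sup>2 * ((norm v)\<^sup>2 + l)"
    by (simp add: sum.distrib l_def sum_distrib_left power_mult_distrib algebra_simps)
  finally show ?thesis unfolding l_def .
qed

section \<open>Centred differences and transport along a vector field\<close>

definition tstep :: "real \<Rightarrow> 'n::finite \<Rightarrow> 'n torus" where
  "tstep s i = tproj (s *\<^sub>R axis i 1)"

text \<open>Centred rather than one-sided, so that its adjoint for Lebesgue measure is exactly its
  negative.\<close>

definition cdiff :: "real \<Rightarrow> 'n::finite \<Rightarrow> ('n torus \<Rightarrow> real) \<Rightarrow> 'n torus \<Rightarrow> real" where
  "cdiff s i f x = (f (x + tstep s i) - f (x - tstep s i)) / (2 * s)"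

lemma continuous_cdiff: "continuous_on UNIV f \<Longrightarrow> continuous_on UNIV (cdiff s i f)"
  unfolding cdiff_def[abs_def]
  by (cases "s = 0") (auto intro!: continuous_intros continuous_torus_shift continuous_torus_shift_minus)

lemma integral_torus_shift_minus:
  fixes f :: "'n::finite torus \<Rightarrow> real"
  assumes "f \<in> borel_measurable borel"
  shows "(LINT x|torus_lebesgue. f (x - a)) = (LINT x|torus_lebesgue. f x)"
  using integral_torus_shift[OF assms, of "- a"] by simp

lemma cdiff_by_parts:
  fixes f g :: "'n::finite torus \<Rightarrow> real"
  assumes f: "continuous_on UNIV f" and g: "continuous_on UNIV g"
  shows "(LINT x|torus_lebesgue. f x * cdiff s i g x) = - (LINT x|torus_lebesgue. cdiff s i f x * g x)"
proof -
  note c = continuous_torus_shift continuous_torus_shift_minus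
  let ?e = "tstep s i"
  have s1: "(LINT x|torus_lebesgue. f x * g (x + ?e)) = (LINT x|torus_lebesgue. f (x - ?e) * g x)"
    using integral_torus_shift[of "\<lambda>x. f (x - ?e) * g x" ?e] by (simp add: continuous_borel continuous_on_mult c f g)
  have s2: "(LINT x|torus_lebesgue. f x * g (x - ?e)) = (LINT x|torus_lebesgue. f (x + ?e) * g x)"
    using integral_torus_shift_minus[of "\<lambda>x. f (x + ?e) * g x" ?e] by (simp add: continuous_borel continuous_on_mult c f g)
  have "(LINT x|torus_lebesgue. f x * cdiff s i g x)
     = (LINT x|torus_lebesgue. (f x * g (x + ?e) - f x * g (x - ?e)) / (2 * s))"
    by (simp add: cdiff_def algebra_simps)
  also have "\<dots> = ((LINT x|torus_lebesgue. f x * g (x + ?e)) - (LINT x|torus_lebesgue. f x * g (x - ?e))) / (2 * s)"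
    by (subst Bochner_Integration.integral_divide_zero, subst Bochner_Integration.integral_diff)
       (auto intro!: integrable_torus continuous_intros c f g)
  also have "\<dots> = - (((LINT x|torus_lebesgue. f (x + ?e) * g x) - (LINT x|torus_lebesgue. f (x - ?e) * g x)) / (2 * s))"
    unfolding s1 s2 by (simp add: diff_divide_distrib)
  also have "((LINT x|torus_lebesgue. f (x + ?e) * g x) - (LINT x|torus_lebesgue. f (x - ?e) * g x)) / (2 * s)
    = (LINT x|torus_lebesgue. (f (x + ?e) * g x - f (x - ?e) * g x) / (2 * s))"
    by (subst Bochner_Integration.integral_divide_zero, subst Bochner_Integration.integral_diff)
       (auto intro!: integrable_torus continuous_intros c f g)
  also have "\<dots> = (LINT x|torus_lebesgue. cdiff s i f x * g x)" by (simp add: cdiff_def algebra_simps)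
  finally show ?thesis .
qed

text \<open>The Jensen bound contains one-sided differences, each a centred one up to half a second
  difference. Semiconvexity bounds second differences only from below, but D, which is nonnegative,
  has integral C t^2 by translation invariance. The replacement thus costs O(t^2) after integration,
  and \<open>cdiff_by_parts\<close> moves the centred differences onto the flux V m.\<close>

lemma semiconvex_transport:
  fixes f m :: "'n::finite torus \<Rightarrow> real" and V :: "'n torus \<Rightarrow> real^'n"
  assumes f: "semiconvex C f" and c: "continuous_on UNIV f" and C: "0 \<le> C"
    and V: "continuous_on UNIV V" and R: "\<And>x i. \<bar>V x $ i\<bar> \<le> R"
    and m: "continuous_on UNIV m" and B: "\<And>x. 0 \<le> m x" "\<And>x. m x \<le> B" and t: "t > 0"
  shows "(LINT x|torus_lebesgue. (f (x + tproj (t *\<^sub>R V x)) - f x) * m x)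
    \<ge> - t * (LINT x|torus_lebesgue. f x * (\<Sum>i\<in>UNIV. cdiff t i (\<lambda>x. V x $ i * m x) x))
      - t\<^sup>2 * (B * C * real CARD('n) * (R\<^sup>2 + 2 * R))"
proof -
  let ?N = "real CARD('n)"
  have R0: "0 \<le> R" using R[of 0 undefined] by linarith
  have B0: "0 \<le> B" using B[of 0] by linarith
  have Vi: "continuous_on UNIV (\<lambda>x. V x $ i)" for i using V by (intro continuous_intros)
  note cs = continuous_torus_shift continuous_torus_shift_minus
  define D where "D i x = f (x + tstep t i) + f (x - tstep t i) - 2 * f x + C * t\<^sup>2" for i x
  have cD: "continuous_on UNIV (D i)" for i unfolding D_def by (intro continuous_intros cs c)
  have D0: "0 \<le> D i x" for i x using semiconvexD[OF f, of "t *\<^sub>R axis i 1" x] by (simp add: D_def tstep_def)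
  have Dint: "(LINT x|torus_lebesgue. D i x) = C * t\<^sup>2" for i
  proof -
    interpret prob_space "torus_lebesgue :: 'n torus measure" by (rule prob_space_torus_lebesgue)
    have i: "integrable torus_lebesgue (\<lambda>x. f (x + tstep t i))" "integrable torus_lebesgue (\<lambda>x. f (x - tstep t i))" "integrable torus_lebesgue f"
      by (intro integrable_torus cs c)+
    then show ?thesis unfolding D_def
      by (simp add: integral_torus_shift[OF continuous_borel[OF c]] integral_torus_shift_minus[OF continuous_borel[OF c]] prob_space[simplified])
  qed
  have pt: "(f (x + tproj (t *\<^sub>R V x)) - f x) * m x \<ge>
      (\<Sum>i\<in>UNIV. (V x $ i * m x) * (t * cdiff t i f x)) - (\<Sum>i\<in>UNIV. B * R / 2 * D i x) - B * C / 2 * t\<^sup>2 * (?N * R\<^sup>2 + ?N * R)" for x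
  proof -
    have "f x - f (x - tproj ((t * sgn (V x $ i)) *\<^sub>R axis i 1)) = sgn (V x $ i) * (t * cdiff t i f x) - (D i x - C * t\<^sup>2) / 2"
      if "V x $ i \<noteq> 0" for i
      using that t by (auto simp: sgn_real_def cdiff_def D_def tstep_def tproj_minus field_simps)
    then have e: "\<bar>V x $ i\<bar> * (f x - f (x - tproj ((t * sgn (V x $ i)) *\<^sub>R axis i 1)))
       = V x $ i * (t * cdiff t i f x) - \<bar>V x $ i\<bar> * (D i x - C * t\<^sup>2) / 2" for i
      by (cases "V x $ i = 0") (auto simp: right_diff_distrib abs_mult_sgn mult.assoc[symmetric])
    have "f (x + tproj (t *\<^sub>R V x)) - f x \<ge> (\<Sum>i\<in>UNIV. \<bar>V x $ i\<bar> * (f x - f (x - tproj ((t * sgn (V x $ i)) *\<^sub>R axis i 1))))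
       - C / 2 * t\<^sup>2 * ((norm (V x))\<^sup>2 + (\<Sum>i\<in>UNIV. \<bar>V x $ i\<bar>))"
      using semiconvex_jensen[OF f c, of "V x" x t] by (simp add: sum_subtractf right_diff_distrib sum_distrib_left algebra_simps)
    also have "(\<Sum>i\<in>UNIV. \<bar>V x $ i\<bar> * (f x - f (x - tproj ((t * sgn (V x $ i)) *\<^sub>R axis i 1))))
       - C / 2 * t\<^sup>2 * ((norm (V x))\<^sup>2 + (\<Sum>i\<in>UNIV. \<bar>V x $ i\<bar>))
       = (\<Sum>i\<in>UNIV. V x $ i * (t * cdiff t i f x)) - (\<Sum>i\<in>UNIV. \<bar>V x $ i\<bar> * D i x / 2) - C / 2 * t\<^sup>2 * (norm (V x))\<^sup>2"
      unfolding e by (simp add: sum_subtractf right_diff_distrib diff_divide_distrib algebra_simps sum_distrib_left sum.distrib sum_divide_distrib)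
    finally have g: "f (x + tproj (t *\<^sub>R V x)) - f x \<ge> (\<Sum>i\<in>UNIV. V x $ i * (t * cdiff t i f x)) - (\<Sum>i\<in>UNIV. \<bar>V x $ i\<bar> * D i x / 2) - C / 2 * t\<^sup>2 * (norm (V x))\<^sup>2" .
    have V2: "(norm (V x))\<^sup>2 \<le> ?N * R\<^sup>2"
      unfolding norm_sq_vec by (intro sum_bounded_above) (metis R abs_le_square_iff abs_of_nonneg R0)
    have "(\<Sum>i\<in>UNIV. V x $ i * (t * cdiff t i f x)) * m x - (\<Sum>i\<in>UNIV. \<bar>V x $ i\<bar> * D i x / 2) * m x - C / 2 * t\<^sup>2 * (norm (V x))\<^sup>2 * m x
       \<le> (f (x + tproj (t *\<^sub>R V x)) - f x) * m x"
      using mult_right_mono[OF g B(1)[of x]] by (simp add: left_diff_distrib)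
    moreover have "(\<Sum>i\<in>UNIV. \<bar>V x $ i\<bar> * D i x / 2) * m x \<le> (\<Sum>i\<in>UNIV. B * R / 2 * D i x)"
    proof -
      have "\<bar>V x $ i\<bar> * D i x / 2 * m x \<le> B * R / 2 * D i x" for i
      proof -
        have "\<bar>V x $ i\<bar> * m x \<le> R * B" by (intro mult_mono R B R0)
        from mult_right_mono[OF this D0[of i x]] show ?thesis by (simp add: mult_ac)
      qed
      then show ?thesis unfolding sum_distrib_right by (intro sum_mono)
    qed
    moreover have "C / 2 * t\<^sup>2 * (norm (V x))\<^sup>2 * m x \<le> B * C / 2 * t\<^sup>2 * (?N * R\<^sup>2 + ?N * R)"
    proof -
      have "(norm (V x))\<^sup>2 * m x \<le> (?N * R\<^sup>2 + ?N * R) * B"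
        using V2 R0 by (intro mult_mono B) (auto intro: order_trans)
      from mult_left_mono[OF this, of "C / 2 * t\<^sup>2"] C show ?thesis by (simp add: mult_ac)
    qed
    moreover have "(\<Sum>i\<in>UNIV. V x $ i * (t * cdiff t i f x)) * m x = (\<Sum>i\<in>UNIV. (V x $ i * m x) * (t * cdiff t i f x))"
      unfolding sum_distrib_right by (intro sum.cong refl) (simp add: mult_ac)
    ultimately show ?thesis by linarith
  qed
  interpret prob_space "torus_lebesgue :: 'n torus measure" by (rule prob_space_torus_lebesgue)
  have i1: "integrable torus_lebesgue (\<lambda>x. V x $ i * m x * (t * cdiff t i f x))" for i
    by (intro integrable_torus continuous_intros continuous_cdiff c m Vi)
  have "(LINT x|torus_lebesgue. (\<Sum>i\<in>UNIV. (V x $ i * m x) * (t * cdiff t i f x)) - (\<Sum>i\<in>UNIV. B * R / 2 * D i x) - B * C / 2 * t\<^sup>2 * (?N * R\<^sup>2 + ?N * R))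
      \<le> (LINT x|torus_lebesgue. (f (x + tproj (t *\<^sub>R V x)) - f x) * m x)"
  proof (rule integral_mono[OF _ _ pt])
    show "integrable torus_lebesgue (\<lambda>x. (f (x + tproj (t *\<^sub>R V x)) - f x) * m x)"
      by (intro integrable_torus continuous_intros continuous_torus_displace c m V)
    show "integrable torus_lebesgue (\<lambda>x. (\<Sum>i\<in>UNIV. (V x $ i * m x) * (t * cdiff t i f x)) - (\<Sum>i\<in>UNIV. B * R / 2 * D i x) - B * C / 2 * t\<^sup>2 * (?N * R\<^sup>2 + ?N * R))"
      by (intro integrable_torus continuous_intros continuous_cdiff c m Vi cD)
  qed
  also have "(LINT x|torus_lebesgue. (\<Sum>i\<in>UNIV. (V x $ i * m x) * (t * cdiff t i f x)) - (\<Sum>i\<in>UNIV. B * R / 2 * D i x) - B * C / 2 * t\<^sup>2 * (?N * R\<^sup>2 + ?N * R))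
    = (\<Sum>i\<in>UNIV. (LINT x|torus_lebesgue. (V x $ i * m x) * (t * cdiff t i f x))) - (\<Sum>i\<in>(UNIV::'n set). B * R / 2 * (LINT x|torus_lebesgue. D i x)) - B * C / 2 * t\<^sup>2 * (?N * R\<^sup>2 + ?N * R)"
    using i1 integrable_torus[OF cD] by (simp add: prob_space[simplified])
  also have "(\<Sum>i\<in>UNIV. (LINT x|torus_lebesgue. (V x $ i * m x) * (t * cdiff t i f x)))
     = - t * (LINT x|torus_lebesgue. f x * (\<Sum>i\<in>UNIV. cdiff t i (\<lambda>x. V x $ i * m x) x))"
  proof -
    have "(LINT x|torus_lebesgue. (V x $ i * m x) * (t * cdiff t i f x)) = - t * (LINT x|torus_lebesgue. f x * cdiff t i (\<lambda>x. V x $ i * m x) x)" for i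
    proof -
      have "(LINT x|torus_lebesgue. (V x $ i * m x) * (t * cdiff t i f x)) = t * (LINT x|torus_lebesgue. (V x $ i * m x) * cdiff t i f x)"
        by (subst integral_mult_right_zero[symmetric]) (simp add: mult_ac)
      also have "(LINT x|torus_lebesgue. (V x $ i * m x) * cdiff t i f x) = - (LINT x|torus_lebesgue. f x * cdiff t i (\<lambda>x. V x $ i * m x) x)"
        by (subst cdiff_by_parts) (auto intro!: continuous_intros c m Vi simp: mult.commute)
      finally show ?thesis by simp
    qed
    moreover have "(LINT x|torus_lebesgue. f x * (\<Sum>i\<in>UNIV. cdiff t i (\<lambda>x. V x $ i * m x) x))
       = (\<Sum>i\<in>UNIV. (LINT x|torus_lebesgue. f x * cdiff t i (\<lambda>x. V x $ i * m x) x))"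
      unfolding sum_distrib_left
      by (intro Bochner_Integration.integral_sum integrable_torus continuous_intros continuous_cdiff c m Vi)
    ultimately show ?thesis by (simp add: sum_distrib_left)
  qed
  finally have "- t * (LINT x|torus_lebesgue. f x * (\<Sum>i\<in>UNIV. cdiff t i (\<lambda>x. V x $ i * m x) x))
      - (\<Sum>i\<in>(UNIV::'n set). B * R / 2 * (C * t\<^sup>2)) - B * C / 2 * t\<^sup>2 * (?N * R\<^sup>2 + ?N * R)
      \<le> (LINT x|torus_lebesgue. (f (x + tproj (t *\<^sub>R V x)) - f x) * m x)"
    unfolding Dint .
  moreover have "(\<Sum>i\<in>(UNIV::'n set). B * R / 2 * (C * t\<^sup>2)) + B * C / 2 * t\<^sup>2 * (?N * R\<^sup>2 + ?N * R)
      = t\<^sup>2 * (B * C * ?N * (R\<^sup>2 + 2 * R)) / 2"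
    by (simp add: field_simps)
  moreover have "0 \<le> t\<^sup>2 * (B * C * ?N * (R\<^sup>2 + 2 * R))"
    by (intro mult_nonneg_nonneg add_nonneg_nonneg) (use B0 C R0 in auto)
  ultimately show ?thesis by linarith
qed

text \<open>The discrete substitute for integrating \<open>V \<bullet> Du\<close> by parts when \<open>u\<close> is not differentiable: semiconvexity
  bounds the value of \<open>u\<close> at \<open>x + t V x\<close> from below by its values at steps of length \<open>t\<close> along the axes, and
  translation invariance moves these steps onto \<open>V m\<close>.\<close>

lemma heat_transport_lower:
  fixes u m D :: "'n::finite torus \<Rightarrow> real" and V :: "'n torus \<Rightarrow> real^'n"
  assumes u: "semiconvex C u" and c: "continuous_on UNIV u" and C: "0 \<le> C" and A: "\<And>x. \<bar>u x\<bar> \<le> A"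
    and V: "continuous_on UNIV V" and R: "\<And>x i. \<bar>V x $ i\<bar> \<le> R"
    and m: "continuous_on UNIV m" and B: "\<And>x. 0 \<le> m x" "\<And>x. m x \<le> B" and t: "t > 0"
    and D: "continuous_on UNIV D" and Dm: "\<And>x. \<bar>heat_conv t m x - m x - t * D x\<bar> \<le> t * e"
    and S: "\<And>x. \<bar>\<Sum>i\<in>UNIV. cdiff t i (\<lambda>x. V x $ i * m x) x\<bar> \<le> S"
    and hm: "continuous_on UNIV (heat_conv t m)"
  shows "(LINT x|torus_lebesgue. (heat_conv t u (x + tproj (t *\<^sub>R V x)) - u x) * m x)
    \<ge> t * (LINT x|torus_lebesgue. u x * (D x - (\<Sum>i\<in>UNIV. cdiff t i (\<lambda>x. V x $ i * m x) x)))
      - t * (e * A + S * (C * real CARD('n)) * (real CARD('n) + 1) * sqrt t + t * (B * C * real CARD('n) * (R\<^sup>2 + 2 * R)))"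
proof -
  let ?N = "real CARD('n)"
  let ?W = "\<lambda>x. \<Sum>i\<in>UNIV. cdiff t i (\<lambda>x. V x $ i * m x) x"
  define f where "f = heat_conv t u"
  have ul: "torus_lip (C * ?N) u" by (rule semiconvex_lip[OF u c C])
  have f: "semiconvex C f" "continuous_on UNIV f" unfolding f_def
    using heat_conv_semiconvex[OF t u c] torus_lip_continuous[OF heat_conv_lip[OF t ul]] by auto
  have W: "continuous_on UNIV ?W" using V m by (intro continuous_intros continuous_cdiff)
  interpret prob_space "torus_lebesgue :: 'n torus measure" by (rule prob_space_torus_lebesgue)
  have const: "(LINT x|(torus_lebesgue :: 'n torus measure). k) = k" for k :: real by (simp add: prob_space[simplified])
  \<comment> \<open>The increment splits into the transport of the smoothed function f and the heat
    flow of u at a fixed point; duality carries the latter over to m.\<close>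
  have "(LINT x|torus_lebesgue. (f (x + tproj (t *\<^sub>R V x)) - u x) * m x)
      = (LINT x|torus_lebesgue. (f (x + tproj (t *\<^sub>R V x)) - f x) * m x + (f x * m x - u x * m x))"
    by (simp add: algebra_simps)
  also have "\<dots> = (LINT x|torus_lebesgue. (f (x + tproj (t *\<^sub>R V x)) - f x) * m x)
      + ((LINT x|torus_lebesgue. f x * m x) - (LINT x|torus_lebesgue. u x * m x))"
    by (subst Bochner_Integration.integral_add, (intro integrable_torus continuous_intros continuous_torus_displace f m V c)+,
        subst Bochner_Integration.integral_diff, (intro integrable_torus continuous_intros f m c)+) simp
  also have "(LINT x|torus_lebesgue. f x * m x) = (LINT x|torus_lebesgue. u x * heat_conv t m x)"
    unfolding f_def by (rule heat_conv_duality[OF t c m])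
  finally have split: "(LINT x|torus_lebesgue. (f (x + tproj (t *\<^sub>R V x)) - u x) * m x)
    = (LINT x|torus_lebesgue. (f (x + tproj (t *\<^sub>R V x)) - f x) * m x)
      + ((LINT x|torus_lebesgue. u x * heat_conv t m x) - (LINT x|torus_lebesgue. u x * m x))" .
  have "(LINT x|torus_lebesgue. u x * heat_conv t m x) - (LINT x|torus_lebesgue. u x * m x) - t * (LINT x|torus_lebesgue. u x * D x)
     = (LINT x|torus_lebesgue. u x * heat_conv t m x - u x * m x - t * (u x * D x))"
    using integrable_torus[OF continuous_on_mult[OF c hm]] integrable_torus[OF continuous_on_mult[OF c m]] integrable_torus[OF continuous_on_mult[OF c D]]
    by simp
  also have "\<dots> \<ge> (LINT x|(torus_lebesgue :: 'n torus measure). - (t * e * A))"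
  proof (rule integral_mono)
    fix x
    have "\<bar>u x * (heat_conv t m x - m x - t * D x)\<bar> \<le> A * (t * e)"
      unfolding abs_mult using A[of x] by (intro mult_mono A Dm) auto
    then show "- (t * e * A) \<le> u x * heat_conv t m x - u x * m x - t * (u x * D x)"
      by (simp add: algebra_simps abs_le_iff)
  qed (auto intro!: integrable_torus continuous_intros c m D hm)
  finally have 1: "(LINT x|torus_lebesgue. u x * heat_conv t m x) - (LINT x|torus_lebesgue. u x * m x)
      \<ge> t * (LINT x|torus_lebesgue. u x * D x) - t * e * A" unfolding const by linarith
  \<comment> \<open>The transport estimate is written with the smoothed f; returning to u costs the
    sqrt t of \<open>heat_conv_close\<close> times the bound S on the differenced flux.\<close>
  have "(LINT x|torus_lebesgue. f x * ?W x) - (LINT x|torus_lebesgue. u x * ?W x) = (LINT x|torus_lebesgue. f x * ?W x - u x * ?W x)"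
    using integrable_torus[OF continuous_on_mult[OF f(2) W]] integrable_torus[OF continuous_on_mult[OF c W]] by simp
  also have "\<dots> \<le> (LINT x|(torus_lebesgue :: 'n torus measure). (C * ?N * (?N + 1) * sqrt t) * S)"
  proof (rule integral_mono)
    fix x
    have "\<bar>(f x - u x) * ?W x\<bar> \<le> (C * ?N * (?N + 1) * sqrt t) * S"
      unfolding abs_mult f_def using heat_conv_close[OF t ul, of x] by (intro mult_mono S) auto
    then show "f x * ?W x - u x * ?W x \<le> (C * ?N * (?N + 1) * sqrt t) * S"
      by (simp add: left_diff_distrib abs_le_iff)
  qed (auto intro!: integrable_torus continuous_intros continuous_cdiff c m f V)
  finally have 2: "(LINT x|torus_lebesgue. f x * ?W x) \<le> (LINT x|torus_lebesgue. u x * ?W x) + (C * ?N * (?N + 1) * sqrt t) * S"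
    unfolding const by linarith
  have 3: "(LINT x|torus_lebesgue. (f (x + tproj (t *\<^sub>R V x)) - f x) * m x)
     \<ge> - t * (LINT x|torus_lebesgue. f x * ?W x) - t\<^sup>2 * (B * C * ?N * (R\<^sup>2 + 2 * R))"
    by (rule semiconvex_transport[OF f C V R m B t])
  have 4: "t * (LINT x|torus_lebesgue. f x * ?W x) \<le> t * ((LINT x|torus_lebesgue. u x * ?W x) + (C * ?N * (?N + 1) * sqrt t) * S)"
    using 2 t by (intro mult_left_mono) auto
  have 5: "(LINT x|torus_lebesgue. u x * (D x - ?W x)) = (LINT x|torus_lebesgue. u x * D x) - (LINT x|torus_lebesgue. u x * ?W x)"
    unfolding right_diff_distrib by (intro Bochner_Integration.integral_diff integrable_torus continuous_on_mult c D W)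
  have "t * ((LINT x|torus_lebesgue. u x * D x) - (LINT x|torus_lebesgue. u x * ?W x))
      - t * (e * A + S * (C * ?N) * (?N + 1) * sqrt t + t * (B * C * ?N * (R\<^sup>2 + 2 * R)))
    = - (t * ((LINT x|torus_lebesgue. u x * ?W x) + (C * ?N * (?N + 1) * sqrt t) * S)) - t\<^sup>2 * (B * C * ?N * (R\<^sup>2 + 2 * R))
      + (t * (LINT x|torus_lebesgue. u x * D x) - t * e * A)"
    by (simp add: algebra_simps power2_eq_square)
  then show ?thesis using 1 3 4 unfolding split[unfolded f_def] 5 f_def by linarith
qed

subsection \<open>The Lax operator\<close>

lemma lax_bdd_above:
  fixes u :: "'n::finite torus \<Rightarrow> real"
  assumes t: "t > 0" and u: "continuous_on UNIV u" and L: "\<And>q. b \<le> L x q"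
  shows "bdd_above (range (\<lambda>q. heat_conv t u (x + tproj (t *\<^sub>R q)) - t * L x q))"
proof -
  obtain B where B: "\<And>x. \<bar>u x\<bar> \<le> B" using torus_continuous_bounded[OF u] by metis
  show ?thesis
  proof (rule bdd_aboveI2)
    fix q
    have "t * b \<le> t * L x q" using L t by (intro mult_left_mono) auto
    then show "heat_conv t u (x + tproj (t *\<^sub>R q)) - t * L x q \<le> B - t * b"
      using heat_conv_bound[OF t u B, of "x + tproj (t *\<^sub>R q)"] by linarith
  qed
qed

lemma discrete_mfg_upper:
  fixes u :: "'n::finite torus \<Rightarrow> real"
  assumes s: "discrete_mfg_solution L F t r u M" and t: "t > 0" and L: "\<And>q. b \<le> L x q"
  shows "heat_conv t u (x + tproj (t *\<^sub>R q)) - t * L x q \<le> u x + t * r + t * F x (Pr1 M)"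
proof -
  have u: "continuous_on UNIV u" and e: "t * r = lax_operator L t u x - u x - t * F x (Pr1 M)"
    using s by (auto simp: discrete_mfg_solution_def)
  have "heat_conv t u (x + tproj (t *\<^sub>R q)) - t * L x q \<le> lax_operator L t u x"
    unfolding lax_operator_def using lax_bdd_above[where L=L and x=x, OF t u L] by (intro cSUP_upper) auto
  then show ?thesis using e by simp
qed

lemma discrete_mfg_least:
  fixes u :: "'n::finite torus \<Rightarrow> real"
  assumes s: "discrete_mfg_solution L F t r u M"
    and le: "\<And>q. heat_conv t u (x + tproj (t *\<^sub>R q)) - t * L x q \<le> a"
  shows "u x + t * r + t * F x (Pr1 M) \<le> a"
proof -
  have e: "t * r = lax_operator L t u x - u x - t * F x (Pr1 M)"
    using s by (auto simp: discrete_mfg_solution_def)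
  have "lax_operator L t u x \<le> a" unfolding lax_operator_def by (intro cSUP_least le) auto
  then show ?thesis using e by simp
qed

text \<open>From x + h and x - h the competitors use the velocities q - a h and q + a h, arriving at
  x + t q displaced by (1 - t a) h and its opposite. The parameter a trades a shorter second
  difference of the heat flow against the cost t k2 a^2 |h|^2.\<close>

lemma discrete_mfg_second_diff:
  fixes u :: "'n::finite torus \<Rightarrow> real"
  assumes s: "discrete_mfg_solution L F t r u M" and t: "t > 0"
    and Lb: "\<And>x. \<exists>b. \<forall>q. b \<le> L x q"
    and L: "\<And>x h q v. L (tproj (x + h)) (q + v) - 2 * L (tproj x) q + L (tproj (x - h)) (q - v)
           \<le> k1 * (norm h)\<^sup>2 + k2 * (norm v)\<^sup>2"
    and F: "\<And>x h. F (tproj (x + h)) (Pr1 M) - 2 * F (tproj x) (Pr1 M) + F (tproj (x - h)) (Pr1 M) \<le> k0 * (norm h)\<^sup>2"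
    and E: "\<And>y. - E \<le> heat_conv t u (y + tproj ((1 - t * a) *\<^sub>R h)) + heat_conv t u (y - tproj ((1 - t * a) *\<^sub>R h)) - 2 * heat_conv t u y"
  shows "u (x + tproj h) + u (x - tproj h) - 2 * u x \<ge> - E - t * (k0 + k1 + k2 * a\<^sup>2) * (norm h)\<^sup>2"
proof -
  obtain y where y: "x = tproj y" by (rule tproj_cases)
  let ?G = "u (x + tproj h) + u (x - tproj h) + 2 * t * r + t * (F (x + tproj h) (Pr1 M) + F (x - tproj h) (Pr1 M))"
  have "heat_conv t u (x + tproj (t *\<^sub>R q)) - t * L x q \<le> (?G + E + t * (k1 + k2 * a\<^sup>2) * (norm h)\<^sup>2) / 2" for q
  proof -
    have up: "heat_conv t u (z + tproj (t *\<^sub>R p)) - t * L z p \<le> u z + t * r + t * F z (Pr1 M)" for z p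
      using Lb[of z] discrete_mfg_upper[OF s t] by blast
    have sh: "x + tproj h + tproj (t *\<^sub>R (q - a *\<^sub>R h)) = x + tproj (t *\<^sub>R q) + tproj ((1 - t * a) *\<^sub>R h)"
       "x - tproj h + tproj (t *\<^sub>R (q + a *\<^sub>R h)) = x + tproj (t *\<^sub>R q) - tproj ((1 - t * a) *\<^sub>R h)"
      unfolding y tproj_add[symmetric] tproj_diff[symmetric] by (rule arg_cong[where f=tproj], simp add: algebra_simps)+
    have "L (x + tproj h) (q - a *\<^sub>R h) - 2 * L x q + L (x - tproj h) (q + a *\<^sub>R h) \<le> k1 * (norm h)\<^sup>2 + k2 * (a\<^sup>2 * (norm h)\<^sup>2)"
      using L[of y h q "- (a *\<^sub>R h)"] by (simp add: y tproj_add tproj_diff power_mult_distrib)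
    then have "t * (L (x + tproj h) (q - a *\<^sub>R h) - 2 * L x q + L (x - tproj h) (q + a *\<^sub>R h)) \<le> t * (k1 * (norm h)\<^sup>2 + k2 * (a\<^sup>2 * (norm h)\<^sup>2))"
      using t by (intro mult_left_mono) auto
    then show ?thesis
      using up[of "x + tproj h" "q - a *\<^sub>R h"] up[of "x - tproj h" "q + a *\<^sub>R h"] E[of "x + tproj (t *\<^sub>R q)"]
      unfolding sh by (simp add: algebra_simps)
  qed
  from discrete_mfg_least[OF s this]
  have "2 * u x + 2 * t * r + 2 * t * F x (Pr1 M) \<le> ?G + E + t * (k1 + k2 * a\<^sup>2) * (norm h)\<^sup>2" by simp
  moreover have "t * (F (x + tproj h) (Pr1 M) - 2 * F x (Pr1 M) + F (x - tproj h) (Pr1 M)) \<le> t * (k0 * (norm h)\<^sup>2)"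
    using F[of y h] t by (intro mult_left_mono) (auto simp: y tproj_add tproj_diff)
  ultimately show ?thesis by (simp add: algebra_simps)
qed

text \<open>With a = 1 / t the two arrival points coincide, which gives some finite constant C0,
  though one that may blow up as t tends to 0. With a = 1 an admissible C improves to C (1 - t)^2 +
  t K. The infimum c of the admissible constants is itself admissible, so c \<le> c (1 - t)^2 + t K,
  that is c (2 - t) \<le> K; hence c \<le> K independently of t. Absolute values make the constant
  nonnegative whatever the signs of k0, k1, k2.\<close>

lemma discrete_mfg_semiconvex:
  fixes u :: "'n::finite torus \<Rightarrow> real"
  assumes s: "discrete_mfg_solution L F t r u M" and t: "t > 0" "t \<le> 1"
    and Lb: "\<And>x. \<exists>b. \<forall>q. b \<le> L x q"
    and L: "\<And>x h q v. L (tproj (x + h)) (q + v) - 2 * L (tproj x) q + L (tproj (x - h)) (q - v)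
           \<le> k1 * (norm h)\<^sup>2 + k2 * (norm v)\<^sup>2"
    and F: "\<And>x h. F (tproj (x + h)) (Pr1 M) - 2 * F (tproj x) (Pr1 M) + F (tproj (x - h)) (Pr1 M) \<le> k0 * (norm h)\<^sup>2"
  shows "semiconvex (\<bar>k0\<bar> + \<bar>k1\<bar> + \<bar>k2\<bar>) u"
proof -
  let ?K = "\<bar>k0\<bar> + \<bar>k1\<bar> + \<bar>k2\<bar>"
  have u: "continuous_on UNIV u" using s by (auto simp: discrete_mfg_solution_def)
  note sd = discrete_mfg_second_diff[where ?k0.0=k0 and ?k1.0=k1 and ?k2.0=k2, OF s t(1) Lb L F]
  have step: "semiconvex (C * (1 - t)\<^sup>2 + t * ?K) u" if C: "semiconvex C u" for C
    unfolding semiconvex_def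
  proof (intro allI)
    fix x and h :: "real^'n"
    have "- (C * (1 - t)\<^sup>2 * (norm h)\<^sup>2) - t * (k0 + k1 + k2 * 1\<^sup>2) * (norm h)\<^sup>2 \<le> u (x + tproj h) + u (x - tproj h) - 2 * u x"
    proof (rule sd)
      show "- (C * (1 - t)\<^sup>2 * (norm h)\<^sup>2) \<le> heat_conv t u (y + tproj ((1 - t * 1) *\<^sub>R h)) + heat_conv t u (y - tproj ((1 - t * 1) *\<^sub>R h)) - 2 * heat_conv t u y" for y
        using semiconvexD[OF heat_conv_semiconvex[OF t(1) C u], of "(1 - t) *\<^sub>R h" y] by (simp add: power_mult_distrib mult_ac)
    qed
    moreover have "t * (k0 + k1 + k2 * 1\<^sup>2) * (norm h)\<^sup>2 \<le> t * ?K * (norm h)\<^sup>2"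
      using t by (intro mult_right_mono mult_left_mono) auto
    ultimately show "- (C * (1 - t)\<^sup>2 + t * ?K) * (norm h)\<^sup>2 \<le> u (x + tproj h) + u (x - tproj h) - 2 * u x"
      by (simp add: algebra_simps)
  qed
  define C0 where "C0 = t * (\<bar>k0\<bar> + \<bar>k1\<bar> + \<bar>k2\<bar> * (1/t)\<^sup>2)"
  have C0: "0 \<le> C0" "semiconvex C0 u"
  proof -
    show "0 \<le> C0" using t by (simp add: C0_def)
    show "semiconvex C0 u" unfolding semiconvex_def
    proof (intro allI)
      fix x and h :: "real^'n"
      have "- 0 - t * (k0 + k1 + k2 * (1/t)\<^sup>2) * (norm h)\<^sup>2 \<le> u (x + tproj h) + u (x - tproj h) - 2 * u x"
        by (rule sd) (use t in simp)
      moreover have "t * (k0 + k1 + k2 * (1/t)\<^sup>2) * (norm h)\<^sup>2 \<le> C0 * (norm h)\<^sup>2"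
        unfolding C0_def using t by (intro mult_right_mono mult_left_mono add_mono) auto
      ultimately show "- C0 * (norm h)\<^sup>2 \<le> u (x + tproj h) + u (x - tproj h) - 2 * u x" by simp
    qed
  qed
  define S where "S = {C. 0 \<le> C \<and> semiconvex C u}"
  have S: "S \<noteq> {}" "bdd_below S" using C0 by (auto simp: S_def intro: bdd_belowI[of _ 0])
  define c where "c = Inf S"
  have c0: "0 \<le> c" unfolding c_def using S by (intro cInf_greatest) (auto simp: S_def)
  have cc: "semiconvex c u" unfolding semiconvex_def
  proof (intro allI)
    fix x and h :: "real^'n"
    let ?d = "u (x + tproj h) + u (x - tproj h) - 2 * u x"
    show "- c * (norm h)\<^sup>2 \<le> ?d"
    proof (cases "h = 0")
      case False
      then have p: "(norm h)\<^sup>2 > 0" by simp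
      have "- ?d / (norm h)\<^sup>2 \<le> C" if "C \<in> S" for C
        using semiconvexD[of C u h x] that p by (simp add: S_def pos_divide_le_eq)
      then have "- ?d / (norm h)\<^sup>2 \<le> c" unfolding c_def using S by (intro cInf_greatest) auto
      then show ?thesis using p by (simp add: pos_divide_le_eq)
    qed simp
  qed
  have "c * (1 - t)\<^sup>2 + t * ?K \<in> S" using step[OF cc] c0 t by (auto simp: S_def)
  then have "c \<le> c * (1 - t)\<^sup>2 + t * ?K" unfolding c_def using S by (intro cInf_lower)
  then have "t * (c * (2 - t)) \<le> t * ?K" by (simp add: power2_eq_square algebra_simps)
  then have "c * (2 - t) \<le> ?K" using t by simp
  moreover have "c * 1 \<le> c * (2 - t)" using c0 t by (intro mult_left_mono) auto
  ultimately have "c \<le> ?K" by simp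
  then have "- ?K * (norm h)\<^sup>2 \<le> - c * (norm h)\<^sup>2" for h :: "real^'n" by (intro mult_right_mono) auto
  then show ?thesis using cc unfolding semiconvex_def by (meson order_trans)
qed

subsection \<open>Twice differentiable functions\<close>

definition dirder :: "('a::euclidean_space \<Rightarrow> real) \<Rightarrow> 'a \<Rightarrow> 'a \<Rightarrow> real" where
  "dirder f b x = frechet_derivative f (at x) b"

lemma Ck_continuous: "Ck k f \<Longrightarrow> continuous_on UNIV f"
  by (cases k) (auto intro!: continuous_at_imp_continuous_on differentiable_imp_continuous_within)

lemma Ck_SucD:
  assumes "Ck (Suc k) f"
  shows "f differentiable (at x)" "b \<in> Basis \<Longrightarrow> Ck k (dirder f b)"
  using assms by (auto simp: dirder_def[abs_def])

lemma has_derivative_dirder: "f differentiable (at x) \<Longrightarrow> (f has_derivative (\<lambda>v. dirder f v x)) (at x)"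
  unfolding dirder_def frechet_derivative_works by simp

lemma dirder_sum:
  assumes "f differentiable (at x)"
  shows "dirder f v x = (\<Sum>b\<in>Basis. (v \<bullet> b) * dirder f b x)"
proof -
  interpret linear "\<lambda>v. dirder f v x" using has_derivative_dirder[OF assms] has_derivative_linear by blast
  have "dirder f v x = dirder f (\<Sum>b\<in>Basis. (v \<bullet> b) *\<^sub>R b) x" by (simp add: euclidean_representation)
  then show ?thesis by (simp add: sum scale)
qed

lemma dirder_line:
  assumes "f differentiable (at (x + t *\<^sub>R y))"
  shows "((\<lambda>t. f (x + t *\<^sub>R y)) has_real_derivative dirder f y (x + t *\<^sub>R y)) (at t)"
proof -
  have "((\<lambda>t. x + t *\<^sub>R y) has_derivative (\<lambda>h. h *\<^sub>R y)) (at t)" by (auto intro!: derivative_eq_intros)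
  from has_derivative_compose[OF this has_derivative_dirder[OF assms]]
  have "((\<lambda>t. f (x + t *\<^sub>R y)) has_derivative (\<lambda>h. dirder f (h *\<^sub>R y) (x + t *\<^sub>R y))) (at t)" .
  moreover have "dirder f (h *\<^sub>R y) (x + t *\<^sub>R y) = dirder f y (x + t *\<^sub>R y) * h" for h
    using linear_cmul[OF has_derivative_linear[OF has_derivative_dirder[OF assms]], of h y] by simp
  ultimately show ?thesis unfolding has_field_derivative_def by simp
qed

definition dirder2 :: "('a::euclidean_space \<Rightarrow> real) \<Rightarrow> 'a \<Rightarrow> 'a \<Rightarrow> real" where
  "dirder2 f y x = (\<Sum>b\<in>Basis. \<Sum>c\<in>Basis. (y \<bullet> b) * (y \<bullet> c) * dirder (dirder f b) c x)"

lemma dirder2_line: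
  assumes f: "Ck (Suc (Suc k)) f"
  shows "((\<lambda>t. dirder f y (x + t *\<^sub>R y)) has_real_derivative dirder2 f y (x + t *\<^sub>R y)) (at t)"
proof -
  have "((\<lambda>t. \<Sum>b\<in>Basis. (y \<bullet> b) * dirder f b (x + t *\<^sub>R y)) has_real_derivative
      (\<Sum>b\<in>Basis. (y \<bullet> b) * dirder (dirder f b) y (x + t *\<^sub>R y))) (at t)"
    by (intro DERIV_sum DERIV_cmult dirder_line Ck_SucD(1)[OF Ck_SucD(2)[OF f]])
  moreover have "(\<Sum>b\<in>Basis. (y \<bullet> b) * dirder (dirder f b) y z) = dirder2 f y z" for z
    unfolding dirder2_def
    by (intro sum.cong refl, subst dirder_sum[OF Ck_SucD(1)[OF Ck_SucD(2)[OF f]]]) (auto simp: sum_distrib_left mult.assoc)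
  ultimately show ?thesis by (simp add: dirder_sum[OF Ck_SucD(1)[OF f], of y])
qed

lemma taylor2:
  assumes f: "Ck (Suc (Suc k)) f"
  obtains \<xi> where "0 < \<xi>" "\<xi> < 1" "f (x + y) = f x + dirder f y x + dirder2 f y (x + \<xi> *\<^sub>R y) / 2"
proof -
  define d where "d m = (if m = 0 then (\<lambda>t. f (x + t *\<^sub>R y)) else if m = Suc 0 then (\<lambda>t. dirder f y (x + t *\<^sub>R y))
     else (\<lambda>t. dirder2 f y (x + t *\<^sub>R y)))" for m
  have "\<exists>t>0. t < 1 \<and> d 0 1 = (\<Sum>m<2. d m 0 / fact m * 1 ^ m) + d 2 t / fact 2 * 1 ^ 2"
  proof (rule Maclaurin)
    show "\<forall>m t. m < 2 \<and> 0 \<le> t \<and> t \<le> 1 \<longrightarrow> DERIV (d m) t :> d (Suc m) t"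
      using dirder_line[OF Ck_SucD(1)[OF f]] dirder2_line[OF f] by (auto simp: d_def less_2_cases_iff)
  qed auto
  then show ?thesis using that by (auto simp: d_def numeral_2_eq_2)
qed

lemma dirder_vec:
  assumes "f differentiable (at (x::real^'n::finite))"
  shows "dirder f v x = gradient f x \<bullet> v"
  by (subst dirder_sum[OF assms], subst sum_Basis_vec)
     (simp add: gradient_def dirder_def inner_axis, simp add: inner_vec_def mult.commute)

definition pd2 :: "(real^'n::finite \<Rightarrow> real) \<Rightarrow> 'n \<Rightarrow> 'n \<Rightarrow> real^'n \<Rightarrow> real" where
  "pd2 f i j x = dirder (dirder f (axis i 1)) (axis j 1) x"

lemma dirder2_vec: "dirder2 f y x = (\<Sum>i\<in>UNIV. \<Sum>j\<in>UNIV. y $ i * y $ j * pd2 f i j x)"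
  unfolding dirder2_def sum_Basis_vec by (simp add: pd2_def inner_axis)

lemma laplacian_pd2: "laplacian f x = (\<Sum>i\<in>UNIV. pd2 f i i x)"
  by (simp add: laplacian_def divergence_def gradient_def pd2_def dirder_def[abs_def])

lemma pd2_continuous:
  assumes "Ck 2 f" shows "continuous_on UNIV (pd2 f i j)"
proof -
  have "Ck 0 (dirder (dirder f (axis i 1)) (axis j 1))"
    using assms by (intro Ck_SucD(2)[OF Ck_SucD(2)]) (auto simp: numeral_2_eq_2 axis_in_Basis_iff)
  then show ?thesis by (simp add: pd2_def[abs_def])
qed

lemma gradient_continuous:
  assumes "Ck 2 f" shows "continuous_on UNIV (gradient f)"
proof -
  have "continuous_on UNIV (\<lambda>x. dirder f (axis i 1) x)" for i
    using assms Ck_continuous[OF Ck_SucD(2)[of "Suc 0" f "axis i 1"]] by (auto simp: numeral_2_eq_2 axis_in_Basis_iff)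
  then show ?thesis unfolding gradient_def[abs_def] dirder_def by (intro continuous_on_vec_lambda)
qed

subsection \<open>Periodic functions\<close>

definition periodic :: "(real^'n::finite \<Rightarrow> 'b) \<Rightarrow> bool" where
  "periodic f \<longleftrightarrow> (\<forall>x. \<forall>k\<in>int_lattice. f (x + k) = f x)"

lemma periodic_section:
  assumes "periodic f" shows "f (torus_section (tproj y)) = f y"
proof -
  have "torus_section (tproj y) - y \<in> int_lattice" using tproj_section[of "tproj y"] by (simp only: tproj_eq_iff)
  then have "f (y + (torus_section (tproj y) - y)) = f y" using assms unfolding periodic_def by blast
  then show ?thesis by simp
qed

text \<open>The section jumps across the faces of the cube, but only by lattice vectors, which a
  periodic function does not see.\<close>

lemma periodic_descend_continuous:
  assumes "periodic f" "continuous_on UNIV f"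
  shows "continuous_on UNIV (\<lambda>x. f (torus_section x))"
  by (subst continuous_torus_iff) (simp add: periodic_section[OF assms(1)] assms(2))

text \<open>\<open>frechet_derivative\<close> is a choice from the relation
  \<open>has_derivative\<close>. That relation is invariant under lattice shifts, so the same
  derivative is chosen, even at points of non-differentiability.\<close>

lemma periodic_dirder:
  assumes "periodic f" shows "periodic (dirder f b)"
proof -
  have "(f has_derivative D) (at (x + k)) \<longleftrightarrow> (f has_derivative D) (at x)" if k: "k \<in> int_lattice" for k x D
  proof -
    have shift: "(f has_derivative D) (at z)" if "(f has_derivative D) (at (z + l))" "l \<in> int_lattice" for z l
    proof -
      have "((\<lambda>y. y + l) has_derivative (\<lambda>h. h)) (at z)" by (auto intro!: derivative_eq_intros)
      from has_derivative_compose[OF this that(1)] have "((\<lambda>y. f (y + l)) has_derivative D) (at z)" .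
      moreover have "(\<lambda>y. f (y + l)) = f" using assms that(2) by (auto simp: periodic_def)
      ultimately show ?thesis by simp
    qed
    show ?thesis using shift[of x k] shift[of "x + k" "- k"] k by (auto simp: int_lattice_closed)
  qed
  then show ?thesis unfolding periodic_def dirder_def frechet_derivative_def by simp
qed

lemma periodic_bounded:
  fixes f :: "real^'n::finite \<Rightarrow> 'b::real_normed_vector"
  assumes "periodic f" "continuous_on UNIV f"
  obtains B where "0 < B" "\<And>x. norm (f x) \<le> B"
proof -
  have "continuous_on UNIV (\<lambda>x. norm (f (torus_section x)))"
    by (intro continuous_intros periodic_descend_continuous assms)
  then obtain B where B: "0 < B" "\<And>x. \<bar>norm (f (torus_section x))\<bar> \<le> B" using torus_continuous_bounded by metis
  have "norm (f x) \<le> B" for x using B(2)[of "tproj x"] by (simp add: periodic_section[OF assms(1)])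
  then show ?thesis using that B(1) by blast
qed

lemma periodic_uniformly_continuous:
  fixes f :: "real^'n::finite \<Rightarrow> 'b::real_normed_vector"
  assumes p: "periodic f" and c: "continuous_on UNIV f" and e: "0 < e"
  obtains d where "0 < d" "\<And>x h. norm h < d \<Longrightarrow> norm (f (x + h) - f x) < e"
proof -
  \<comment> \<open>This ball contains every representative in the cube together with its
    displacements of length below 1.\<close>
  let ?K = "cball (0::real^'n) (real CARD('n) + 1)"
  have "uniformly_continuous_on ?K f"
    using c by (intro compact_uniformly_continuous) (auto intro: continuous_on_subset)
  then obtain d where d: "0 < d" "\<And>x y. x \<in> ?K \<Longrightarrow> y \<in> ?K \<Longrightarrow> dist y x < d \<Longrightarrow> dist (f y) (f x) < e"
    unfolding uniformly_continuous_on_def using e by metis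
  show ?thesis
  proof (rule that[of "min d 1"])
    fix x h :: "real^'n" assume h: "norm h < min d 1"
    define s where "s = torus_section (tproj x)"
    have s: "norm s \<le> real CARD('n)" unfolding s_def by (intro norm_cube_le section_in_cube)
    have "s \<in> ?K" using s by (simp)
    moreover have "s + h \<in> ?K" using s h norm_triangle_ineq[of s h] by simp
    ultimately have "dist (f (s + h)) (f s) < e" using h by (intro d(2)) (auto simp: dist_norm)
    moreover have "f s = f x" unfolding s_def by (rule periodic_section[OF p])
    moreover have "f (s + h) = f (x + h)"
    proof -
      have "s - x \<in> int_lattice" unfolding s_def using tproj_section[of "tproj x"] by (simp only: tproj_eq_iff)
      then have "f (x + h + (s - x)) = f (x + h)" using p unfolding periodic_def by blast
      then show ?thesis by (simp add: algebra_simps)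
    qed
    ultimately show "norm (f (x + h) - f x) < e" by (simp add: dist_norm)
  qed (use d in auto)
qed

text \<open>A modulus of continuity that Gaussian second moments can integrate: uniform continuity
  for short h, and the crude bound 2 B \<le> 2 B (|h| / d)^2 for long h.\<close>

lemma periodic_modulus:
  fixes f :: "real^'n::finite \<Rightarrow> real"
  assumes p: "periodic f" and c: "continuous_on UNIV f" and e: "0 < e"
  obtains C where "0 \<le> C" "\<And>x h. \<bar>f (x + h) - f x\<bar> \<le> e + C * (norm h)\<^sup>2"
proof -
  obtain B where B: "0 < B" "\<And>x. norm (f x) \<le> B" using periodic_bounded[OF p c] by metis
  obtain d where d: "0 < d" "\<And>x h. norm h < d \<Longrightarrow> norm (f (x + h) - f x) < e"
    using periodic_uniformly_continuous[OF p c e] by metis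
  show ?thesis
  proof (rule that[of "2 * B / d\<^sup>2"])
    fix x h :: "real^'n"
    show "\<bar>f (x + h) - f x\<bar> \<le> e + 2 * B / d\<^sup>2 * (norm h)\<^sup>2"
    proof (cases "norm h < d")
      case True
      then show ?thesis using d(2)[of h x] B d by (simp add: add_increasing2 less_imp_le)
    next
      case False
      then have "1 \<le> (norm h / d)\<^sup>2" using d(1) by (simp add: pos_le_divide_eq)
      then have "2 * B * 1 \<le> 2 * B * (norm h / d)\<^sup>2" using B by (intro mult_left_mono) auto
      moreover have "\<bar>f (x + h) - f x\<bar> \<le> 2 * B" using B(2)[of "x + h"] B(2)[of x] by simp
      ultimately show ?thesis using e by (simp add: power_divide)
    qed
  qed (use B in simp)
qed

lemma pd2_periodic: "periodic f \<Longrightarrow> periodic (pd2 f i j)"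
  unfolding pd2_def[abs_def] by (intro periodic_dirder)

lemma quadratic_form_bound:
  fixes y :: "real^'n::finite"
  assumes "\<And>i j. \<bar>a i j\<bar> \<le> e"
  shows "\<bar>\<Sum>i\<in>UNIV. \<Sum>j\<in>UNIV. y $ i * y $ j * a i j\<bar> \<le> (real CARD('n))\<^sup>2 * e * (norm y)\<^sup>2"
proof -
  have "\<bar>\<Sum>i\<in>UNIV. \<Sum>j\<in>UNIV. y $ i * y $ j * a i j\<bar> \<le> (\<Sum>i\<in>UNIV. \<Sum>j\<in>UNIV. \<bar>y $ i * y $ j * a i j\<bar>)"
    by (intro order_trans[OF sum_abs] sum_mono sum_abs)
  also have "\<dots> \<le> (\<Sum>i\<in>(UNIV::'n set). \<Sum>j\<in>(UNIV::'n set). norm y * norm y * e)"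
    unfolding abs_mult by (intro sum_mono mult_mono component_le_norm_cart assms) auto
  finally show ?thesis by (simp add: power2_eq_square mult_ac)
qed

locale C2_torus =
  fixes u :: "'n::finite torus \<Rightarrow> real" and U :: "real^'n \<Rightarrow> real"
  assumes Ck2: "Ck 2 U" and U_def: "\<And>y. U y = u (tproj y)"
begin

lemma Ck2': "Ck (Suc (Suc 0)) U" using Ck2 by (simp add: numeral_2_eq_2)

lemma U_periodic: "periodic U" by (simp add: periodic_def U_def tproj_lattice)

lemma U_diff: "U differentiable (at x)" by (rule Ck_SucD(1)[OF Ck2'])

lemma pd_diff: "(\<lambda>y. gradient U y $ i) differentiable (at x)"
  using Ck_SucD(1)[OF Ck_SucD(2)[OF Ck2', of "axis i 1"]] by (simp add: axis_in_Basis_iff gradient_def dirder_def[abs_def])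

lemma gradient_periodic: "periodic (gradient U)"
  using periodic_dirder[OF U_periodic] by (simp add: periodic_def gradient_def dirder_def[symmetric])

lemma u_cont: "continuous_on UNIV u"
  using Ck_continuous[OF Ck2] by (subst continuous_torus_iff) (simp add: U_def[abs_def])

lemma gradient_bound: obtains K where "0 < K" "\<And>y. norm (gradient U y) \<le> K"
  using periodic_bounded[OF gradient_periodic gradient_continuous[OF Ck2]] by metis

lemma pd2_bound: obtains K where "0 < K" "\<And>i j y. \<bar>pd2 U i j y\<bar> \<le> K"
proof -
  have "\<exists>B>0. \<forall>y. \<bar>pd2 U i j y\<bar> \<le> B" for i j
    using periodic_bounded[OF pd2_periodic[OF U_periodic] pd2_continuous[OF Ck2], of i j] unfolding real_norm_def by metis
  then obtain B where B: "\<And>i j. B i j > 0" "\<And>i j y. \<bar>pd2 U i j y\<bar> \<le> B i j" by metis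
  define K where "K = (\<Sum>i\<in>UNIV. \<Sum>j\<in>UNIV. B i j)"
  have BK: "B i j \<le> K" for i j
  proof -
    have "B i j \<le> (\<Sum>j\<in>UNIV. B i j)" using B(1) by (intro member_le_sum) (auto intro: less_imp_le)
    also have "\<dots> \<le> K" unfolding K_def by (intro member_le_sum[where f="\<lambda>i. \<Sum>j\<in>UNIV. B i j"]) (simp_all add: sum_nonneg less_imp_le[OF B(1)])
    finally show ?thesis .
  qed
  show ?thesis
    by (rule that[of K]) (rule less_le_trans[OF B(1)[of undefined undefined] BK], rule order_trans[OF B(2) BK])
qed

lemma taylor:
  obtains \<xi> where "0 < \<xi>" "\<xi> < 1"
    "U (x + y) = U x + gradient U x \<bullet> y + (\<Sum>i\<in>UNIV. \<Sum>j\<in>UNIV. y $ i * y $ j * pd2 U i j (x + \<xi> *\<^sub>R y)) / 2"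
  by (rule taylor2[OF Ck2', of x y]) (auto simp: dirder_vec[OF U_diff] dirder2_vec)

lemma taylor_quadratic:
  obtains C where "0 \<le> C" "\<And>x y. \<bar>U (x + y) - U x - gradient U x \<bullet> y\<bar> \<le> C * (norm y)\<^sup>2"
proof -
  obtain K where K: "0 < K" "\<And>i j y. \<bar>pd2 U i j y\<bar> \<le> K" using pd2_bound by metis
  have "\<bar>U (x + y) - U x - gradient U x \<bullet> y\<bar> \<le> (real CARD('n))\<^sup>2 * K / 2 * (norm y)\<^sup>2" for x y
  proof -
    obtain \<xi> where "0 < \<xi>" "\<xi> < 1" "U (x + y) = U x + gradient U x \<bullet> y + (\<Sum>i\<in>UNIV. \<Sum>j\<in>UNIV. y $ i * y $ j * pd2 U i j (x + \<xi> *\<^sub>R y)) / 2"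
      by (rule taylor[of x y])
    then show ?thesis using quadratic_form_bound[of "\<lambda>i j. pd2 U i j (x + \<xi> *\<^sub>R y)" K y] K(2) by simp
  qed
  then show ?thesis using K by (intro that[of "(real CARD('n))\<^sup>2 * K / 2"]) auto
qed

text \<open>Second derivatives are merely continuous, so the remainder is small but only quadratic
  near 0. The quartic term pays for large y; averaged over the Gaussian law the two terms are of
  order e t and t^2.\<close>

lemma taylor_precise:
  assumes e: "0 < e"
  obtains C where "0 \<le> C" "\<And>x y. \<bar>U (x + y) - U x - gradient U x \<bullet> y - (\<Sum>i\<in>UNIV. \<Sum>j\<in>UNIV. y $ i * y $ j * pd2 U i j x) / 2\<bar>
      \<le> e * (norm y)\<^sup>2 + C * norm y ^ 4"
proof -
  define N where "N = (real CARD('n))\<^sup>2"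
  have N: "N > 0" by (simp add: N_def)
  have e': "0 < e / N" using e N by simp
  have "\<exists>C\<ge>0. \<forall>x h. \<bar>pd2 U i j (x + h) - pd2 U i j x\<bar> \<le> e / N + C * (norm h)\<^sup>2" for i j
    using periodic_modulus[OF pd2_periodic[OF U_periodic] pd2_continuous[OF Ck2] e', of i j] by metis
  then obtain C where C: "\<And>i j. C i j \<ge> 0" "\<And>i j x h. \<bar>pd2 U i j (x + h) - pd2 U i j x\<bar> \<le> e / N + C i j * (norm h)\<^sup>2" by metis
  define K where "K = (\<Sum>i\<in>UNIV. \<Sum>j\<in>UNIV. C i j)"
  have CK: "C i j \<le> K" for i j
  proof -
    have "C i j \<le> (\<Sum>j\<in>UNIV. C i j)" using C(1) by (intro member_le_sum) auto
    also have "\<dots> \<le> K" unfolding K_def using C(1) by (intro member_le_sum[where f="\<lambda>i. \<Sum>j\<in>UNIV. C i j"]) (auto intro!: sum_nonneg)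
    finally show ?thesis .
  qed
  have K0: "0 \<le> K" using CK[of undefined undefined] C(1)[of undefined undefined] by linarith
  have "\<bar>U (x + y) - U x - gradient U x \<bullet> y - (\<Sum>i\<in>UNIV. \<Sum>j\<in>UNIV. y $ i * y $ j * pd2 U i j x) / 2\<bar>
      \<le> e * (norm y)\<^sup>2 + N * K * norm y ^ 4" for x y
  proof -
    obtain \<xi> where xi: "0 < \<xi>" "\<xi> < 1" "U (x + y) = U x + gradient U x \<bullet> y + (\<Sum>i\<in>UNIV. \<Sum>j\<in>UNIV. y $ i * y $ j * pd2 U i j (x + \<xi> *\<^sub>R y)) / 2"
      by (rule taylor[of x y])
    let ?b = "e / N + K * (norm y)\<^sup>2"
    have b: "\<bar>pd2 U i j (x + \<xi> *\<^sub>R y) - pd2 U i j x\<bar> \<le> ?b" for i j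
    proof -
      have "norm (\<xi> *\<^sub>R y) \<le> norm y" using xi by (simp add: mult_left_le_one_le)
      then have "C i j * (norm (\<xi> *\<^sub>R y))\<^sup>2 \<le> K * (norm y)\<^sup>2"
        by (intro mult_mono CK power_mono K0) auto
      then show ?thesis using C(2)[of i j x "\<xi> *\<^sub>R y"] by linarith
    qed
    have "\<bar>\<Sum>i\<in>UNIV. \<Sum>j\<in>UNIV. y $ i * y $ j * (pd2 U i j (x + \<xi> *\<^sub>R y) - pd2 U i j x)\<bar> \<le> N * ?b * (norm y)\<^sup>2"
      unfolding N_def by (rule quadratic_form_bound) (use b in \<open>simp add: N_def\<close>)
    also have "\<dots> = e * (norm y)\<^sup>2 + N * K * norm y ^ 4" using N by (simp add: field_simps power2_eq_square power4_eq_xxxx)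
    also have "(\<Sum>i\<in>UNIV. \<Sum>j\<in>UNIV. y $ i * y $ j * (pd2 U i j (x + \<xi> *\<^sub>R y) - pd2 U i j x))
      = (\<Sum>i\<in>UNIV. \<Sum>j\<in>UNIV. y $ i * y $ j * pd2 U i j (x + \<xi> *\<^sub>R y)) - (\<Sum>i\<in>UNIV. \<Sum>j\<in>UNIV. y $ i * y $ j * pd2 U i j x)"
      by (simp add: right_diff_distrib sum_subtractf)
    finally show ?thesis unfolding xi(3) by linarith
  qed
  then show ?thesis using N K0 by (intro that[of "N * K"]) auto
qed

lemma u_lip: obtains K where "torus_lip K u"
proof -
  obtain K where K: "0 < K" "\<And>y. norm (gradient U y) \<le> K" using gradient_bound by metis
  have "\<bar>U (y + h) - U y\<bar> \<le> K * norm h" for y h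
  proof -
    have "((\<lambda>t. U (y + t *\<^sub>R h)) has_real_derivative gradient U (y + t *\<^sub>R h) \<bullet> h) (at t)" for t
      using dirder_line[OF U_diff] by (simp add: dirder_vec[OF U_diff])
    then have "\<exists>z. 0 < z \<and> z < 1 \<and> U (y + 1 *\<^sub>R h) - U (y + 0 *\<^sub>R h) = (1 - 0) * (gradient U (y + z *\<^sub>R h) \<bullet> h)"
      by (intro MVT2) auto
    then obtain z where "U (y + h) - U y = gradient U (y + z *\<^sub>R h) \<bullet> h" by auto
    then have "\<bar>U (y + h) - U y\<bar> \<le> norm (gradient U (y + z *\<^sub>R h)) * norm h" by (simp add: Cauchy_Schwarz_ineq2)
    also have "\<dots> \<le> K * norm h" by (intro mult_right_mono K) auto
    finally show ?thesis .
  qed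
  then have *: "\<bar>u (tproj y + tproj h) - u (tproj y)\<bar> \<le> K * norm h" for y h
    by (simp add: U_def tproj_add)
  have "torus_lip K u" unfolding torus_lip_def
    using *[of "torus_section x" for x] by simp
  then show ?thesis by (rule that)
qed

lemma laplacian_continuous: "continuous_on UNIV (laplacian U)"
  unfolding laplacian_pd2[abs_def] by (intro continuous_intros pd2_continuous[OF Ck2])

lemma laplacian_periodic: "periodic (laplacian U)"
  using pd2_periodic[OF U_periodic] by (simp add: periodic_def laplacian_pd2)

text \<open>The Laplacian generates the semigroup: the linear Taylor term averages to 0, and the
  covariance 2 t on the diagonal turns half the quadratic term into t times the trace of second
  derivatives. Periodicity makes the rate uniform in y.\<close>

lemma heat_conv_expansion:
  assumes e: "0 < e"
  obtains t0 where "0 < t0" "\<And>t y. 0 < t \<Longrightarrow> t < t0 \<Longrightarrow> \<bar>heat_conv t u (tproj y) - u (tproj y) - t * laplacian U y\<bar> \<le> t * e"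
proof -
  let ?N = "real CARD('n)"
  \<comment> \<open>The second moment 2 N t gives the quadratic remainder the share t e / 2;
    \<open>t0\<close> leaves the other half to the fourth moment.\<close>
  define e1 where "e1 = e / (4 * ?N)"
  have e1: "0 < e1" using e by (simp add: e1_def)
  obtain C where C: "0 \<le> C" "\<And>x y. \<bar>U (x + y) - U x - gradient U x \<bullet> y - (\<Sum>i\<in>UNIV. \<Sum>j\<in>UNIV. y $ i * y $ j * pd2 U i j x) / 2\<bar>
      \<le> e1 * (norm y)\<^sup>2 + C * norm y ^ 4" by (fact taylor_precise[OF e1])
  define t0 where "t0 = e / (2 * (C * 12 * ?N\<^sup>2 + 1))"
  have c1: "0 < C * 12 * ?N\<^sup>2 + 1" using C by (simp add: add_nonneg_pos)
  have t0: "0 < t0" using e c1 by (simp add: t0_def)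
  have "\<bar>heat_conv t u (tproj y) - u (tproj y) - t * laplacian U y\<bar> \<le> t * e" if t: "0 < t" "t < t0" for t y
  proof -
    interpret prob_space "gauss_measure t :: (real^'n) measure" by (rule prob_space_gauss[OF t(1)])
    let ?G = "gauss_measure t :: (real^'n) measure"
    let ?lin = "\<lambda>w. gradient U y \<bullet> w"
    let ?quad = "\<lambda>w. (\<Sum>i\<in>UNIV. \<Sum>j\<in>UNIV. w $ i * w $ j * pd2 U i j y) / 2"
    have iu: "integrable ?G (\<lambda>w. U (y + w))"
      using integrable_gauss(1)[OF t(1) u_cont, of "tproj y"] by (simp add: U_def tproj_add)
    have il: "integrable ?G ?lin" and El: "(LINT w|?G. ?lin w) = 0"
      using gauss_mean[OF t(1), where 'n='n] by (simp_all add: inner_vec_def)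
    have iq: "integrable ?G ?quad" using gauss_covariance(1)[OF t(1), where 'n='n] by auto
    have Eq: "(LINT w|?G. ?quad w) = t * laplacian U y"
    proof -
      have "(LINT w|?G. ?quad w) = (\<Sum>i\<in>UNIV. \<Sum>j\<in>UNIV. (if i = j then 2 * t else 0) * pd2 U i j y) / 2"
        using gauss_covariance[OF t(1), where 'n='n] by simp
      also have "\<dots> = (\<Sum>i\<in>UNIV. \<Sum>j\<in>UNIV. (if i = j then 2 * t * pd2 U i j y else 0)) / 2"
        by (intro arg_cong2[where f="(/)"] sum.cong refl) simp
      also have "\<dots> = (\<Sum>i\<in>UNIV. 2 * t * pd2 U i i y) / 2" by simp
      also have "\<dots> = t * laplacian U y" unfolding laplacian_pd2 sum_distrib_left by (simp add: sum_divide_distrib)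
      finally show ?thesis .
    qed
    let ?r = "\<lambda>w. U (y + w) - U y - ?lin w - ?quad w"
    have ir: "integrable ?G ?r" by (intro Bochner_Integration.integrable_diff iu il iq) simp
    have hE: "heat_conv t u (tproj y) = (LINT w|?G. U (y + w))"
      unfolding heat_conv_cont[OF t(1) u_cont] by (simp add: U_def tproj_add)
    have rE: "(LINT w|?G. ?r w) = (LINT w|?G. U (y + w)) - (LINT w|?G. U y) - (LINT w|?G. ?lin w) - (LINT w|?G. ?quad w)"
      by (simp only: Bochner_Integration.integral_diff Bochner_Integration.integrable_diff iu il iq integrable_const)
    have "(LINT w|?G. U y) = u (tproj y)" by (simp add: U_def prob_space[simplified])
    with rE have "heat_conv t u (tproj y) - u (tproj y) - t * laplacian U y = (LINT w|?G. ?r w)"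
      unfolding hE El Eq by linarith
    also have "\<bar>\<dots>\<bar> \<le> (LINT w|?G. e1 * (norm w)\<^sup>2 + C * norm w ^ 4)"
    proof -
      define r where "r = ?r"
      define b where "b w = e1 * (norm w)\<^sup>2 + C * norm w ^ 4" for w :: "real^'n"
      have "integrable ?G b" unfolding b_def
        by (intro Bochner_Integration.integrable_add integrable_mult_right impI gauss_norm_sq(1) gauss_norm4(1) t)
      moreover have "integrable ?G r" unfolding r_def by (rule ir)
      moreover have "\<bar>r w\<bar> \<le> b w" for w unfolding r_def b_def by (rule C(2))
      ultimately have "(LINT w|?G. \<bar>r w\<bar>) \<le> (LINT w|?G. b w)" by (intro integral_mono integrable_abs)
      then have "\<bar>LINT w|?G. r w\<bar> \<le> (LINT w|?G. b w)" using integral_abs_bound[of ?G r] by (rule order_trans[rotated])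
      then show ?thesis unfolding r_def b_def .
    qed
    also have "\<dots> = e1 * (2 * ?N * t) + C * (LINT w|?G. norm w ^ 4)"
      using gauss_norm_sq(1)[OF t(1), where 'n='n] gauss_norm4(1)[OF t(1), where 'n='n]
      by (simp add: gauss_norm_sq(2)[OF t(1)])
    also have "\<dots> \<le> e1 * (2 * ?N * t) + C * (12 * ?N\<^sup>2 * t\<^sup>2)"
      using C gauss_norm4(2)[OF t(1), where 'n='n] by (intro add_left_mono mult_left_mono) auto
    also have "\<dots> = t * (e / 2) + t * ((C * 12 * ?N\<^sup>2) * t)"
      by (simp add: e1_def power2_eq_square)
    also have "\<dots> \<le> t * (e / 2) + t * (e / 2)"
    proof (intro add_left_mono mult_left_mono)
      have "(C * 12 * ?N\<^sup>2) * t \<le> (C * 12 * ?N\<^sup>2 + 1) * t0" using t C c1 by (intro mult_mono) auto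
      also have "\<dots> = e / 2"
      proof -
        have "a * (e / (2 * a)) = e / 2" if "0 < a" for a using that by simp
        from this[OF c1] show ?thesis by (simp only: t0_def)
      qed
      finally show "(C * 12 * ?N\<^sup>2) * t \<le> e / 2" .
    qed (use t in auto)
    finally show ?thesis by (simp add: algebra_simps)
  qed
  then show ?thesis using that t0 by blast
qed

end

subsection \<open>Integration by parts\<close>

lemma central_difference_limit:
  fixes g :: "real \<Rightarrow> real"
  assumes "(g has_real_derivative d) (at 0)"
  shows "((\<lambda>t. (g t - g (- t)) / (2 * t)) \<longlongrightarrow> d) (at_right 0)"
proof -
  have a: "((\<lambda>t. (g (0 + t) - g 0) / t) \<longlongrightarrow> d) (at 0)" using assms by (simp add: DERIV_def)
  have m: "((\<lambda>t::real. - t) \<longlongrightarrow> 0) (at 0)" by (auto intro!: tendsto_eq_intros)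
  have "filterlim (\<lambda>t::real. - t) (at 0) (at 0)"
    using m by (auto simp: filterlim_at eventually_at_filter)
  from filterlim_compose[OF a this] have "((\<lambda>t. (g (- t) - g 0) / (- t)) \<longlongrightarrow> d) (at 0)" by simp
  with a have "((\<lambda>t. ((g (0 + t) - g 0) / t + (g (- t) - g 0) / (- t)) / 2) \<longlongrightarrow> (d + d) / 2) (at 0)"
    by (intro tendsto_intros) auto
  moreover have "(\<lambda>t. ((g (0 + t) - g 0) / t + (g (- t) - g 0) / (- t)) / 2) = (\<lambda>t. (g t - g (- t)) / (2 * t))"
  proof
    fix t show "((g (0 + t) - g 0) / t + (g (- t) - g 0) / (- t)) / 2 = (g t - g (- t)) / (2 * t)"
      by (cases "t = 0") (auto simp: field_simps)
  qed
  ultimately have "((\<lambda>t. (g t - g (- t)) / (2 * t)) \<longlongrightarrow> (d + d) / 2) (at 0)" by (simp only:)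
  then have "((\<lambda>t. (g t - g (- t)) / (2 * t)) \<longlongrightarrow> d) (at 0)" by simp
  then show ?thesis by (rule tendsto_mono[rotated]) (simp add: at_le)
qed

lemma cdiff_tproj:
  "cdiff t i f (tproj y) = (f (tproj (y + t *\<^sub>R axis i 1)) - f (tproj (y - t *\<^sub>R axis i 1))) / (2 * t)"
  by (simp add: cdiff_def tstep_def tproj_add tproj_diff)

text \<open>Tailored to the flux m Q: Lipschitz with differentiable components, while continuity is
  asked of the divergence alone and not of the individual derivatives.\<close>

locale torus_field =
  fixes Z :: "real^'n::finite \<Rightarrow> real^'n" and D :: "'n torus \<Rightarrow> real" and K :: real
  assumes Zp: "periodic Z" and Zl: "\<And>x y i. \<bar>Z x $ i - Z y $ i\<bar> \<le> K * norm (x - y)"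
    and Zd: "\<And>i y. (\<lambda>y. Z y $ i) differentiable (at y)"
    and Dc: "continuous_on UNIV D" and Deq: "\<And>y. D (tproj y) = divergence Z y"
begin

definition Zi :: "'n \<Rightarrow> 'n torus \<Rightarrow> real" where "Zi i x = Z (torus_section x) $ i"

definition dZ :: "real \<Rightarrow> 'n torus \<Rightarrow> real" where "dZ t x = (\<Sum>i\<in>UNIV. cdiff t i (Zi i) x)"

lemma Zi_tproj: "Zi i (tproj y) = Z y $ i"
  by (simp add: Zi_def periodic_section[OF Zp])

lemma Zi_continuous: "continuous_on UNIV (Zi i)"
proof -
  have "continuous_on UNIV (\<lambda>y. Z y $ i)"
    using Zd by (intro continuous_at_imp_continuous_on) (auto intro: differentiable_imp_continuous_within)
  then show ?thesis by (subst continuous_torus_iff) (simp add: Zi_tproj)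
qed

lemma dZ_continuous: "continuous_on UNIV (dZ t)"
  unfolding dZ_def[abs_def] by (intro continuous_intros continuous_cdiff Zi_continuous)

lemma dZ_bound: assumes t: "0 < t" shows "\<bar>dZ t x\<bar> \<le> real CARD('n) * K"
proof -
  have "\<bar>cdiff t i (Zi i) x\<bar> \<le> K" for i
  proof -
    obtain y where y: "x = tproj y" by (rule tproj_cases)
    have "y + t *\<^sub>R axis i 1 - (y - t *\<^sub>R axis i 1) = (2 * t) *\<^sub>R (axis i 1 :: real^'n)"
      by (simp add: vec_eq_iff)
    then have "\<bar>Z (y + t *\<^sub>R axis i 1) $ i - Z (y - t *\<^sub>R axis i 1) $ i\<bar> \<le> K * (2 * t)"
      using Zl[of "y + t *\<^sub>R axis i 1" i "y - t *\<^sub>R axis i 1"] t by simp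
    then show ?thesis using t by (simp add: y cdiff_tproj Zi_tproj pos_divide_le_eq)
  qed
  then have "(\<Sum>i\<in>(UNIV::'n set). \<bar>cdiff t i (Zi i) x\<bar>) \<le> real CARD('n) * K" by (intro sum_bounded_above) auto
  then show ?thesis unfolding dZ_def by (rule order_trans[OF sum_abs])
qed

lemma dZ_limit: "((\<lambda>t. dZ t x) \<longlongrightarrow> D x) (at_right 0)"
proof -
  obtain y where y: "x = tproj y" by (rule tproj_cases)
  have "((\<lambda>t. cdiff t i (Zi i) x) \<longlongrightarrow> dirder (\<lambda>y. Z y $ i) (axis i 1) y) (at_right 0)" for i
  proof -
    have "((\<lambda>t. Z (y + t *\<^sub>R axis i 1) $ i) has_real_derivative dirder (\<lambda>y. Z y $ i) (axis i 1) (y + 0 *\<^sub>R axis i 1)) (at 0)"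
      by (rule dirder_line[OF Zd])
    from central_difference_limit[OF this] show ?thesis by (simp add: y cdiff_tproj Zi_tproj)
  qed
  then have "((\<lambda>t. dZ t x) \<longlongrightarrow> (\<Sum>i\<in>UNIV. dirder (\<lambda>y. Z y $ i) (axis i 1) y)) (at_right 0)"
    unfolding dZ_def by (intro tendsto_sum)
  then show ?thesis by (simp add: y Deq divergence_def dirder_def)
qed

text \<open>Difference quotients converge pointwise and the Lipschitz constant dominates them.
  Convergence in mean is enough, because it is tested against uniformly bounded functions.\<close>

lemma dZ_L1: "((\<lambda>t. LINT x|torus_lebesgue. \<bar>dZ t x - D x\<bar>) \<longlongrightarrow> 0) (at_right 0)"
  unfolding tendsto_at_iff_sequentially
proof (intro allI impI)
  fix X :: "nat \<Rightarrow> real" assume X: "\<forall>i. X i \<in> {0<..} - {0}" "X \<longlonglongrightarrow> 0"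
  have FX: "filterlim X (at_right 0) sequentially" unfolding filterlim_at
  proof (intro conjI always_eventually allI)
    show "X n \<in> {0<..}" "X n \<noteq> 0" for n using X(1)[rule_format, of n] by auto
  qed (rule X(2))
  interpret prob_space "torus_lebesgue :: 'n torus measure" by (rule prob_space_torus_lebesgue)
  obtain B where B: "0 < B" "\<And>x. \<bar>D x\<bar> \<le> B" using torus_continuous_bounded[OF Dc] by metis
  have "(\<lambda>n. LINT x|torus_lebesgue. \<bar>dZ (X n) x - D x\<bar>) \<longlonglongrightarrow> (LINT x|(torus_lebesgue :: 'n torus measure). 0)"
  proof (rule integral_dominated_convergence)
    show "(\<lambda>x. \<bar>dZ (X n) x - D x\<bar>) \<in> borel_measurable torus_lebesgue" for n
      by (intro borel_measurable_integrable integrable_torus continuous_intros dZ_continuous Dc)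
    show "AE x in torus_lebesgue. (\<lambda>n. \<bar>dZ (X n) x - D x\<bar>) \<longlonglongrightarrow> 0"
    proof (intro AE_I2)
      fix x
      have "(\<lambda>n. dZ (X n) x - D x) \<longlonglongrightarrow> D x - D x"
        by (intro tendsto_diff filterlim_compose[OF dZ_limit FX]) auto
      then show "(\<lambda>n. \<bar>dZ (X n) x - D x\<bar>) \<longlonglongrightarrow> 0" by (simp add: tendsto_rabs_zero)
    qed
    show "AE x in torus_lebesgue. norm \<bar>dZ (X n) x - D x\<bar> \<le> real CARD('n) * K + B" for n
    proof (intro AE_I2)
      fix x
      have "X n > 0" using X by auto
      then show "norm \<bar>dZ (X n) x - D x\<bar> \<le> real CARD('n) * K + B"
        using dZ_bound[of "X n" x] B(2)[of x] by simp
    qed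
  qed auto
  then show "((\<lambda>t. LINT x|torus_lebesgue. \<bar>dZ t x - D x\<bar>) \<circ> X) \<longlonglongrightarrow> 0" by (simp add: o_def)
qed

end

subsection \<open>Uniformly convex Lagrangians\<close>

lemma dirder_shift:
  assumes "\<And>z. f (z + k) = f z" shows "dirder f b (z + k) = dirder f b z"
proof -
  have shift: "(g has_derivative D) (at z)" if "(g has_derivative D) (at (z + l))" "\<And>y. g (y + l) = g y" for g :: "'a \<Rightarrow> real" and D z l
  proof -
    have "((\<lambda>y. y + l) has_derivative (\<lambda>h. h)) (at z)" by (auto intro!: derivative_eq_intros)
    from has_derivative_compose[OF this that(1)] show ?thesis by (simp add: that(2))
  qed
  have "f (y + - k) = f y" for y using assms[of "y - k"] by simp
  then have "(f has_derivative D) (at (z + k)) \<longleftrightarrow> (f has_derivative D) (at z)" for D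
    using shift[of f D z k] shift[of f D "z + k" "- k"] assms by auto
  then show ?thesis unfolding dirder_def frechet_derivative_def by simp
qed

lemma has_derivative_quadratic_remainder:
  fixes f :: "'a::real_normed_vector \<Rightarrow> real"
  assumes "bounded_linear D" and "\<And>h. \<bar>f (x + h) - f x - D h\<bar> \<le> C * (norm h)\<^sup>2"
  shows "(f has_derivative D) (at x)"
  unfolding has_derivative_at
proof
  show "(\<lambda>h. norm (f (x + h) - f x - D h) / norm h) \<midarrow>0\<rightarrow> 0"
  proof (rule Lim_null_comparison)
    show "\<forall>\<^sub>F h in at 0. norm (norm (f (x + h) - f x - D h) / norm h) \<le> C * norm h"
    proof (intro always_eventually allI)
      fix h show "norm (norm (f (x + h) - f x - D h) / norm h) \<le> C * norm h"
        using assms(2)[of h] by (cases "h = 0") (auto simp: pos_divide_le_eq power2_eq_square mult.assoc)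
    qed
    show "((\<lambda>h. C * norm h) \<longlongrightarrow> 0) (at 0)" by (auto intro!: tendsto_eq_intros)
  qed
qed (rule assms)

lemma sum_Basis_prod:
  "(\<Sum>b\<in>(Basis :: ('a::euclidean_space \<times> 'b::euclidean_space) set). f b) = (\<Sum>b\<in>Basis. f (b, 0)) + (\<Sum>b\<in>Basis. f (0, b))"
proof -
  have "(\<Sum>b\<in>(Basis :: ('a \<times> 'b) set). f b) = (\<Sum>b\<in>(\<lambda>u. (u, 0)) ` Basis. f b) + (\<Sum>b\<in>(\<lambda>v. (0, v)) ` Basis. f b)"
    unfolding Basis_prod_def by (rule sum.union_disjoint) auto
  then show ?thesis by (simp add: sum.reindex inj_on_def)
qed

locale convex_lagrangian =
  fixes L :: "'n::finite torus \<Rightarrow> real^'n \<Rightarrow> real" and c0 :: real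
  assumes smooth: "smooth (\<lambda>(x, q). L (tproj x) q)" and c0: "c0 > 0"
    and hess: "\<And>x q v. v \<bullet> (hessian (L x) q *v v) \<ge> c0 * (norm v)\<^sup>2"
begin

definition Lf :: "(real^'n) \<times> (real^'n) \<Rightarrow> real" where "Lf = (\<lambda>(x, q). L (tproj x) q)"

lemma Lf_Ck: "Ck k Lf" using smooth by (simp add: smooth_def Lf_def)

lemma Lf_diff: "Lf differentiable (at z)" by (rule Ck_SucD(1)[OF Lf_Ck])

lemma Basis_snd: "b \<in> Basis \<Longrightarrow> (0, b) \<in> Basis" and Basis_fst: "b \<in> Basis \<Longrightarrow> (b, 0) \<in> Basis"
  by (auto simp: Basis_prod_def)

lemma dLf_Ck: "b \<in> Basis \<Longrightarrow> Ck k (dirder Lf b)" by (rule Ck_SucD(2)[OF Lf_Ck])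

lemma dLf_diff: "b \<in> Basis \<Longrightarrow> dirder Lf b differentiable (at z)" by (rule Ck_SucD(1)[OF dLf_Ck])

lemma Lf_eq: "Lf (x, q) = L (tproj x) q" by (simp add: Lf_def)

lemma partial_snd:
  fixes f :: "(real^'n) \<times> (real^'n) \<Rightarrow> real"
  assumes "f differentiable (at (x, q))"
  shows "((\<lambda>q. f (x, q)) has_derivative (\<lambda>v. dirder f (0, v) (x, q))) (at q)"
proof -
  have "((\<lambda>q. (x, q)) has_derivative (\<lambda>v. (0, v))) (at q)" by (auto intro!: derivative_eq_intros)
  from has_derivative_compose[OF this, of f] has_derivative_dirder[OF assms] show ?thesis by blast
qed

lemma L_deriv: "(L (tproj x) has_derivative (\<lambda>v. dirder Lf (0, v) (x, q))) (at q)"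
  using partial_snd[OF Lf_diff, of x q] by (simp add: Lf_eq)

definition Lq :: "real^'n \<Rightarrow> real^'n \<Rightarrow> real^'n" where "Lq x q = gradient (L (tproj x)) q"

lemma Lq_nth: "Lq x q $ i = dirder Lf (0, axis i 1) (x, q)"
  using frechet_derivative_at[OF L_deriv[of x q]] by (simp add: Lq_def gradient_def) (metis)

lemma dLf_Lq: "dirder Lf (0, v) (x, q) = Lq x q \<bullet> v"
proof -
  have d: "L (tproj x) differentiable (at q)" using L_deriv differentiableI by blast
  have "dirder Lf (0, v) (x, q) = dirder (L (tproj x)) v q"
    using frechet_derivative_at[OF L_deriv[of x q]] by (simp add: dirder_def) metis
  then show ?thesis unfolding Lq_def dirder_vec[OF d] .
qed

lemma hessian_eq: "hessian (L (tproj x)) q $ i $ j = dirder (dirder Lf (0, axis j 1)) (0, axis i 1) (x, q)"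
proof -
  have "(\<lambda>y. gradient (L (tproj x)) y $ j) = (\<lambda>q. dirder Lf (0, axis j 1) (x, q))"
    using Lq_nth by (auto simp: Lq_def)
  moreover have "frechet_derivative (\<lambda>q. dirder Lf (0, axis j 1) (x, q)) (at q) = (\<lambda>v. dirder (dirder Lf (0, axis j 1)) (0, v) (x, q))"
    by (rule frechet_derivative_at[symmetric], rule partial_snd[OF dLf_diff]) (simp add: Basis_snd axis_in_Basis_iff)
  ultimately show ?thesis by (simp add: hessian_def)
qed

lemma dirder2_Lf: "dirder2 Lf (0, v) (x, q) = v \<bullet> (hessian (L (tproj x)) q *v v)"
proof -
  have "dirder2 Lf (0, v) (x, q) = (\<Sum>i\<in>UNIV. \<Sum>j\<in>UNIV. v $ i * v $ j * dirder (dirder Lf (0, axis i 1)) (0, axis j 1) (x, q))"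
    unfolding dirder2_def sum_Basis_prod sum_Basis_vec by (simp add: inner_axis)
  \<comment> \<open>\<open>hessian\<close> takes its two partial derivatives in the order opposite
    to \<open>dirder2\<close>; exchanging the summation indices matches the two forms.\<close>
  also have "\<dots> = (\<Sum>j\<in>UNIV. \<Sum>i\<in>UNIV. v $ i * v $ j * dirder (dirder Lf (0, axis i 1)) (0, axis j 1) (x, q))"
    by (rule sum.swap)
  also have "\<dots> = v \<bullet> (hessian (L (tproj x)) q *v v)"
    by (simp add: inner_vec_def matrix_vector_mult_def hessian_eq sum_distrib_left mult_ac)
  finally show ?thesis .
qed

lemma L_lower: "L (tproj x) (q + v) \<ge> L (tproj x) q + Lq x q \<bullet> v + c0 / 2 * (norm v)\<^sup>2"
proof -
  obtain \<xi> where "0 < \<xi>" "\<xi> < 1" "Lf ((x, q) + (0, v)) = Lf (x, q) + dirder Lf (0, v) (x, q) + dirder2 Lf (0, v) ((x, q) + \<xi> *\<^sub>R (0, v)) / 2"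
    by (rule taylor2[OF Lf_Ck])
  then have "L (tproj x) (q + v) = L (tproj x) q + Lq x q \<bullet> v + dirder2 Lf (0, v) (x, q + \<xi> *\<^sub>R v) / 2"
    by (simp add: Lf_eq dLf_Lq)
  moreover have "dirder2 Lf (0, v) (x, q + \<xi> *\<^sub>R v) \<ge> c0 * (norm v)\<^sup>2" unfolding dirder2_Lf by (rule hess)
  ultimately show ?thesis by simp
qed

text \<open>The second-difference bound says that g is midpoint convex along the line q + t v. The
  tangent to g at 0, evaluated at 1, is the claim.\<close>

lemma L_upper:
  assumes k2: "\<And>x q v. L x (q + v) - 2 * L x q + L x (q - v) \<le> k2 * (norm v)\<^sup>2"
  shows "L (tproj x) (q + v) \<le> L (tproj x) q + Lq x q \<bullet> v + k2 / 2 * (norm v)\<^sup>2"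
proof -
  define g where "g t = k2 / 2 * (norm v)\<^sup>2 * t\<^sup>2 - Lf ((x, q) + t *\<^sub>R (0, v))" for t :: real
  have der: "(g has_real_derivative k2 * (norm v)\<^sup>2 * t - dirder Lf (0, v) ((x, q) + t *\<^sub>R (0, v))) (at t)" for t
    unfolding g_def by (rule derivative_eq_intros dirder_line[OF Lf_diff] refl | simp)+
  have "convex_on UNIV g"
  proof (rule midpoint_convex_imp_convex)
    show "continuous_on UNIV g" using der by (intro continuous_at_imp_continuous_on) (auto intro: DERIV_isCont)
    fix a b :: real
    define p where "p = (1/2) *\<^sub>R (a + b)"
    define d where "d = (1/2) *\<^sub>R (b - a)"
    have ab: "b = p + d" "a = p - d" unfolding p_def d_def by (simp_all add: field_simps)
    have "L (tproj x) (q + b *\<^sub>R v) - 2 * L (tproj x) (q + p *\<^sub>R v) + L (tproj x) (q + a *\<^sub>R v) \<le> k2 * (d\<^sup>2 * (norm v)\<^sup>2)"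
      using k2[of "tproj x" "q + p *\<^sub>R v" "d *\<^sub>R v"] unfolding ab by (simp add: power_mult_distrib algebra_simps)
    moreover define M where "M = k2 / 2 * (norm v)\<^sup>2"
    moreover have "M * a\<^sup>2 + M * b\<^sup>2 = 2 * (M * p\<^sup>2) + 2 * M * d\<^sup>2"
      unfolding ab by (simp add: power2_eq_square algebra_simps)
    moreover have "k2 * (d\<^sup>2 * (norm v)\<^sup>2) = 2 * M * d\<^sup>2" by (simp add: M_def)
    ultimately have "2 * g p \<le> g a + g b" unfolding g_def M_def[symmetric] by (simp add: Lf_eq)
    then show "2 * g ((1/2) *\<^sub>R (a + b)) \<le> g a + g b" unfolding p_def .
  qed
  then have "g 1 - g 0 \<ge> (k2 * (norm v)\<^sup>2 * 0 - dirder Lf (0, v) ((x, q) + 0 *\<^sub>R (0, v))) * (1 - 0)"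
    by (rule convex_on_imp_above_tangent) (use der[of 0] in auto)
  then show ?thesis by (simp add: g_def Lf_eq dLf_Lq)
qed

section \<open>The Legendre transform and the optimal velocity\<close>

lemma Lq_monotone: "c0 * (norm (q' - q))\<^sup>2 \<le> (Lq x q' - Lq x q) \<bullet> (q' - q)"
  using L_lower[of x q "q' - q"] L_lower[of x q' "q - q'"]
  by (simp add: inner_diff_left inner_diff_right norm_minus_commute algebra_simps)

lemma Lq_dist: "c0 * norm (q' - q) \<le> norm (Lq x q' - Lq x q)"
proof (cases "q' = q")
  case False
  have "c0 * (norm (q' - q))\<^sup>2 \<le> norm (Lq x q' - Lq x q) * norm (q' - q)"
    using Lq_monotone[of q' q x] Cauchy_Schwarz_ineq2[of "Lq x q' - Lq x q" "q' - q"] by linarith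
  then have "(c0 * norm (q' - q)) * norm (q' - q) \<le> norm (Lq x q' - Lq x q) * norm (q' - q)"
    by (simp add: power2_eq_square mult.assoc)
  then show ?thesis using False by simp
qed simp

lemma Lq_surj: "\<exists>q. Lq x q = p"
proof -
  define h where "h q = L (tproj x) q - p \<bullet> q" for q
  have hd: "(h has_derivative (\<lambda>v. Lq x q \<bullet> v - p \<bullet> v)) (at q)" for q
    unfolding h_def using L_deriv[of x q] by (auto intro!: derivative_eq_intros simp: dLf_Lq)
  have hc: "continuous_on S h" for S
    using hd by (intro continuous_at_imp_continuous_on) (auto intro: has_derivative_continuous)
  define a where "a = norm (Lq x 0 - p)"
  \<comment> \<open>Beyond radius R the term c0 / 2 |y|^2 of \<open>L_lower\<close> outweighs the
    slope a |y| at 0, so a minimiser on the ball is a global one.\<close>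
  define R where "R = 2 * a / c0 + 1"
  have R: "0 < R" using c0 by (simp add: R_def a_def add_nonneg_pos)
  have "\<exists>q\<in>cball 0 R. \<forall>y\<in>cball 0 R. h q \<le> h y"
    using R by (intro continuous_attains_inf hc) (auto simp: less_imp_le)
  then obtain q where q: "q \<in> cball 0 R" "\<And>y. y \<in> cball 0 R \<Longrightarrow> h q \<le> h y" by blast
  have "h q \<le> h y" for y
  proof (cases "y \<in> cball 0 R")
    case False
    then have yR: "norm y > R" by simp
    have "h y \<ge> h 0 + (Lq x 0 - p) \<bullet> y + c0 / 2 * (norm y)\<^sup>2"
      using L_lower[of x 0 y] by (simp add: h_def inner_diff_left)
    moreover have "(Lq x 0 - p) \<bullet> y \<ge> - (a * norm y)"
      using Cauchy_Schwarz_ineq2[of "Lq x 0 - p" y] by (simp add: a_def)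
    moreover have "a * norm y \<le> c0 / 2 * (norm y)\<^sup>2"
    proof -
      have "a \<le> c0 / 2 * R" using c0 by (simp add: R_def field_simps)
      also have "\<dots> \<le> c0 / 2 * norm y" using yR c0 by (intro mult_left_mono) auto
      finally have "a * norm y \<le> c0 / 2 * norm y * norm y" by (intro mult_right_mono) auto
      then show ?thesis by (simp add: power2_eq_square)
    qed
    ultimately have "h 0 \<le> h y" by linarith
    then show ?thesis using q(2)[of 0] R by simp
  qed (use q in auto)
  then have "(\<lambda>v. Lq x q \<bullet> v - p \<bullet> v) = (\<lambda>v. 0)"
    by (intro differential_zero_maxmin[OF _ open_UNIV hd]) auto
  then have "(Lq x q - p) \<bullet> (Lq x q - p) = 0" by (metis inner_diff_left)
  then show ?thesis by auto
qed

text \<open>The inverse of the velocity derivative of L at fixed x, unique by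
  \<open>Lq_dist\<close>; by \<open>legendre_bound\<close> it is the velocity that attains the
  Hamiltonian.\<close>

definition qs :: "real^'n \<Rightarrow> real^'n \<Rightarrow> real^'n" where "qs x p = (SOME q. Lq x q = p)"

lemma Lq_qs [simp]: "Lq x (qs x p) = p"
  unfolding qs_def using Lq_surj by (rule someI_ex)

lemma qs_tproj: "tproj x = tproj y \<Longrightarrow> qs x p = qs y p"
  by (simp add: qs_def Lq_def)

text \<open>The quadratic gap is kept because velocities in the support of a discrete solution are
  not assumed bounded: it later absorbs errors growing like |q|^2.\<close>

lemma legendre_bound: "p \<bullet> q - L (tproj x) q \<le> p \<bullet> qs x p - L (tproj x) (qs x p) - c0 / 2 * (norm (q - qs x p))\<^sup>2"
  using L_lower[of x "qs x p" "q - qs x p"] by (simp add: inner_diff_right)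

lemma legendre_bound': "p \<bullet> q - L (tproj x) q \<le> p \<bullet> qs x p - L (tproj x) (qs x p)"
proof -
  have "0 \<le> c0 / 2 * (norm (q - qs x p))\<^sup>2" using c0 by simp
  then show ?thesis using legendre_bound[of p q x] by linarith
qed

lemma hamiltonian_eq: "hamiltonian L (tproj x) p = p \<bullet> qs x p - L (tproj x) (qs x p)"
  unfolding hamiltonian_def by (intro cSup_eq_maximum) (auto intro: legendre_bound')

text \<open>Envelope theorem. The competitor \<open>qs x p\<close> bounds the Hamiltonian at p + h
  from below; the quadratic gap and Young's inequality bound it from above, with remainder |h|^2 /
  (2 c0).\<close>

lemma hamiltonian_gradient: "gradient (hamiltonian L (tproj x)) p = qs x p"
proof -
  let ?H = "hamiltonian L (tproj x)"
  have "\<bar>?H (p + h) - ?H p - qs x p \<bullet> h\<bar> \<le> 1 / (2 * c0) * (norm h)\<^sup>2" for h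
  proof -
    have lo: "?H (p + h) \<ge> ?H p + qs x p \<bullet> h"
      using legendre_bound'[of "p + h" "qs x p" x] by (simp add: hamiltonian_eq inner_add_left inner_commute)
    let ?q = "qs x (p + h)"
    have "?H (p + h) = p \<bullet> ?q - L (tproj x) ?q + h \<bullet> ?q" by (simp add: hamiltonian_eq inner_add_left)
    also have "\<dots> \<le> ?H p - c0 / 2 * (norm (?q - qs x p))\<^sup>2 + h \<bullet> ?q"
      using legendre_bound[of p ?q x] by (simp add: hamiltonian_eq)
    also have "h \<bullet> ?q = qs x p \<bullet> h + h \<bullet> (?q - qs x p)" by (simp add: inner_diff_right inner_commute)
    also have "h \<bullet> (?q - qs x p) \<le> norm h * norm (?q - qs x p)" by (rule norm_cauchy_schwarz)
    finally have "?H (p + h) \<le> ?H p + qs x p \<bullet> h + (norm h * norm (?q - qs x p) - c0 / 2 * (norm (?q - qs x p))\<^sup>2)" by simp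
    also have "norm h * d - c0 / 2 * d\<^sup>2 \<le> 1 / (2 * c0) * (norm h)\<^sup>2" for d
    proof -
      have "0 \<le> (norm h - c0 * d)\<^sup>2 / (2 * c0)" using c0 by simp
      also have "\<dots> = 1 / (2 * c0) * (norm h)\<^sup>2 - norm h * d + c0 / 2 * d\<^sup>2"
        using c0 by (simp add: power2_eq_square field_simps)
      finally show ?thesis by simp
    qed
    then have "norm h * norm (?q - qs x p) - c0 / 2 * (norm (?q - qs x p))\<^sup>2 \<le> 1 / (2 * c0) * (norm h)\<^sup>2" by blast
    finally show ?thesis using lo by simp
  qed
  then have "(?H has_derivative (\<lambda>h. qs x p \<bullet> h)) (at p)"
    by (intro has_derivative_quadratic_remainder bounded_linear_inner_right)
  from frechet_derivative_at[OF this] have "frechet_derivative ?H (at p) (axis i 1) = qs x p \<bullet> axis i 1" for i by metis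
  then show ?thesis by (simp add: gradient_def vec_eq_iff inner_axis)
qed

lemma L_bounded_below: "\<exists>b. \<forall>q. b \<le> L x q"
proof -
  obtain y where y: "x = tproj y" by (rule tproj_cases)
  have "- (0 \<bullet> qs y 0 - L x (qs y 0)) \<le> L x q" for q
    using legendre_bound'[of 0 q y] by (simp add: y)
  then show ?thesis by blast
qed

lemma Lq_as_sum: "Lq x q = (\<Sum>i\<in>UNIV. dirder Lf (0, axis i 1) (x, q) *\<^sub>R axis i 1)"
  unfolding Lq_nth[symmetric] by (simp add: vec_eq_sum_axis)

lemma Lq_continuous: "continuous_on UNIV (\<lambda>z. Lq (fst z) (snd z))"
proof -
  have "continuous_on UNIV (dirder Lf (0, axis i 1))" for i
    by (rule Ck_continuous[OF dLf_Ck]) (simp add: Basis_snd axis_in_Basis_iff)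
  then show ?thesis unfolding Lq_as_sum prod.collapse
    by (intro continuous_on_sum continuous_on_scaleR continuous_on_const)
qed

text \<open>Strong monotonicity bounds the distance from q to the optimal velocity at w by g w, the
  residual of q in the equation at w divided by c0, and g is continuous and vanishes at z.\<close>

lemma qs_continuous: "isCont (\<lambda>z. qs (fst z) (snd z)) z"
proof -
  define q where "q = qs (fst z) (snd z)"
  define g where "g w = norm (snd w - Lq (fst w) q) / c0" for w
  have "continuous_on UNIV (\<lambda>w :: (real^'n) \<times> (real^'n). (fst w, q))"
    by (intro continuous_intros)
  from continuous_on_compose2[OF Lq_continuous this]
  have "continuous_on UNIV (\<lambda>w :: (real^'n) \<times> (real^'n). Lq (fst w) q)" by simp
  then have "continuous_on UNIV g" unfolding g_def
    using c0 by (intro continuous_on_divide continuous_on_norm continuous_on_diff continuous_on_snd continuous_on_id continuous_on_const) auto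
  then have "isCont g z" by (rule continuous_on_interior) simp
  then have "(g \<longlongrightarrow> g z) (at z)" by (rule isContD)
  moreover have "g z = 0" by (simp add: g_def q_def)
  ultimately have g0: "(g \<longlongrightarrow> 0) (at z)" by simp
  have le: "norm (qs (fst w) (snd w) - q) \<le> g w" for w
    using Lq_dist[of "qs (fst w) (snd w)" q "fst w"] c0
    by (simp add: g_def pos_le_divide_eq mult.commute)
  have "((\<lambda>w. qs (fst w) (snd w) - q) \<longlongrightarrow> 0) (at z)"
    by (rule Lim_null_comparison[OF always_eventually g0]) (simp add: le)
  then have "((\<lambda>w. qs (fst w) (snd w)) \<longlongrightarrow> q) (at z)" by (rule LIM_zero_cancel)
  then show ?thesis unfolding isCont_def q_def .
qed

text \<open>Invert the map (x, q) to (x, Lq x q). Its global inverse exists and is continuous, so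
  injectivity of the derivative suffices: a kernel vector has first component 0, and the Hessian
  form vanishes on its second component, which is therefore 0.\<close>

lemma qs_differentiable: "(\<lambda>z. qs (fst z) (snd z)) differentiable (at z)"
proof -
  let ?f = "\<lambda>z. (fst z, Lq (fst z) (snd z))"
  let ?g = "\<lambda>z. (fst z, qs (fst z) (snd z))"
  let ?w = "?g z"
  let ?D = "\<lambda>h. \<Sum>i\<in>UNIV. dirder (dirder Lf (0, axis i 1)) h ?w *\<^sub>R (axis i 1 :: real^'n)"
  let ?f' = "\<lambda>h. (fst h, ?D h)"
  have Bi: "(0, axis i 1) \<in> (Basis :: ((real^'n) \<times> (real^'n)) set)" for i by (simp add: Basis_snd axis_in_Basis_iff)
  have fd: "(?f has_derivative ?f') (at ?w)"
    unfolding Lq_as_sum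
    by (intro has_derivative_Pair has_derivative_fst has_derivative_ident has_derivative_sum has_derivative_scaleR_left)
       (simp add: has_derivative_dirder[OF dLf_diff[OF Bi]])
  then have lin: "linear ?f'" by (rule has_derivative_linear)
  have "inj ?f'"
    unfolding linear_injective_0[OF lin]
  proof (intro allI impI)
    fix h assume h: "?f' h = 0"
    then have h1: "fst h = 0" and h2: "?D h = 0" by (auto simp: zero_prod_def)
    obtain v where v: "h = (0, v)" using h1 by (cases h) auto
    have "dirder2 Lf h ?w = (\<Sum>b\<in>Basis. (h \<bullet> b) * dirder (dirder Lf b) h ?w)"
      unfolding dirder2_def
    proof (intro sum.cong refl)
      fix b :: "(real^'n) \<times> (real^'n)" assume b: "b \<in> Basis"
      show "(\<Sum>c\<in>Basis. (h \<bullet> b) * (h \<bullet> c) * dirder (dirder Lf b) c ?w) = (h \<bullet> b) * dirder (dirder Lf b) h ?w"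
        using dirder_sum[OF dLf_diff[OF b], of h ?w] by (simp add: sum_distrib_left mult.assoc)
    qed
    also have "\<dots> = (\<Sum>i\<in>UNIV. v $ i * dirder (dirder Lf (0, axis i 1)) h ?w)"
      unfolding sum_Basis_prod sum_Basis_vec by (simp add: v inner_axis)
    also have "\<dots> = v \<bullet> ?D h" by (simp add: inner_sum_right inner_axis mult.commute)
    finally have "dirder2 Lf h ?w = 0" by (simp only: h2 inner_zero_right)
    moreover have "dirder2 Lf h ?w \<ge> c0 * (norm v)\<^sup>2" unfolding v dirder2_Lf by (rule hess)
    ultimately have "v = 0" using c0 by (simp add: mult_le_0_iff)
    then show "h = 0" by (simp add: v zero_prod_def)
  qed
  then obtain g' where g': "linear g'" "g' \<circ> ?f' = id" using linear_injective_left_inverse[OF lin] by blast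
  have "(?g has_derivative g') (at z)"
  proof (rule has_derivative_inverse_basic[where f="?f" and f'="?f'" and T=UNIV])
    show "(?f has_derivative ?f') (at (?g z))" by (rule fd)
    show "g' \<circ> ?f' = id" by (rule g'(2))
    show "bounded_linear g'" using g'(1) by (simp add: linear_conv_bounded_linear)
    show "continuous (at z) ?g" by (intro continuous_Pair qs_continuous continuous_fst continuous_ident)
  qed auto
  then have "((\<lambda>z. snd (?g z)) has_derivative (\<lambda>h. snd (g' h))) (at z)" by (rule has_derivative_snd)
  then have "(\<lambda>z. snd (?g z)) differentiable (at z)" by (rule differentiableI)
  then show ?thesis by (simp only: snd_conv)
qed

text \<open>The second derivatives are periodic in x only, so they are bounded over all x and |q|
  \<le> R by compactness of the closed cube times the ball; the mean value theorem in x then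
  applies.\<close>

lemma Lq_lipschitz:
  obtains K where "0 < K" "\<And>x y q. norm q \<le> R \<Longrightarrow> norm (Lq x q - Lq y q) \<le> K * norm (x - y)"
proof -
  have per: "dirder Lf b (z + (k, 0)) = dirder Lf b z" if "k \<in> int_lattice" for b z k
    by (rule dirder_shift) (use that in \<open>auto simp: Lf_def tproj_lattice split: prod.splits\<close>)
  have per2: "dirder (dirder Lf b) c (z + (k, 0)) = dirder (dirder Lf b) c z" if "k \<in> int_lattice" for b c z k
    by (rule dirder_shift) (rule per[OF that])
  have "\<exists>B>0. \<forall>x q. norm q \<le> R \<longrightarrow> \<bar>dirder (dirder Lf b) c (x, q)\<bar> \<le> B" if b: "b \<in> Basis" "c \<in> Basis" for b c
  proof -
    have "Ck 0 (dirder (dirder Lf b) c)" by (intro Ck_SucD(2)[OF dLf_Ck] b)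
    then have "continuous_on UNIV (dirder (dirder Lf b) c)" by simp
    then have "compact (dirder (dirder Lf b) c ` (cbox 0 1 \<times> cball 0 R))"
      by (intro compact_continuous_image compact_Times) (auto intro: continuous_on_subset)
    then have "bounded (dirder (dirder Lf b) c ` (cbox 0 1 \<times> cball 0 R))" by (rule compact_imp_bounded)
    then obtain B where "\<forall>y \<in> dirder (dirder Lf b) c ` (cbox 0 1 \<times> cball 0 R). norm y \<le> B"
      unfolding bounded_iff by (rule exE)
    then have B: "\<bar>dirder (dirder Lf b) c z\<bar> \<le> B" if "z \<in> cbox 0 1 \<times> cball 0 R" for z
      using that by auto
    have "\<bar>dirder (dirder Lf b) c (x, q)\<bar> \<le> \<bar>B\<bar> + 1" if q: "norm q \<le> R" for x q
    proof -
      let ?s = "torus_section (tproj x)"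
      have "?s - x \<in> int_lattice" using tproj_section[of "tproj x"] by (simp only: tproj_eq_iff)
      from per2[OF this, of b c "(x, q)"] have "dirder (dirder Lf b) c (?s, q) = dirder (dirder Lf b) c (x, q)" by simp
      moreover have "?s \<in> cbox 0 1" using section_in_cube[of "tproj x"] by (auto simp: unit_cube_def mem_box_cart less_imp_le)
      ultimately show ?thesis using B[of "(?s, q)"] q by auto
    qed
    then show ?thesis by (intro exI[of _ "\<bar>B\<bar> + 1"]) auto
  qed
  note ex = this
  define B where "B b c = (SOME B. B > 0 \<and> (\<forall>x q. norm q \<le> R \<longrightarrow> \<bar>dirder (dirder Lf b) c (x, q)\<bar> \<le> B))" for b c
  have "B b c > 0 \<and> (\<forall>x q. norm q \<le> R \<longrightarrow> \<bar>dirder (dirder Lf b) c (x, q)\<bar> \<le> B b c)" if "b \<in> Basis" "c \<in> Basis" for b c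
    unfolding B_def using ex[OF that] by (rule someI_ex)
  then have B: "\<And>b c. b \<in> Basis \<Longrightarrow> c \<in> Basis \<Longrightarrow> 0 < B b c"
    "\<And>b c x q. b \<in> Basis \<Longrightarrow> c \<in> Basis \<Longrightarrow> norm q \<le> R \<Longrightarrow> \<bar>dirder (dirder Lf b) c (x, q)\<bar> \<le> B b c" by blast+
  define K where "K = (\<Sum>b\<in>Basis. \<Sum>c\<in>Basis. B b c)"
  have BK: "(\<Sum>c\<in>Basis. B b c) \<le> K" if "b \<in> Basis" for b
    unfolding K_def
  proof (rule member_le_sum[where f="\<lambda>b. \<Sum>c\<in>Basis. B b c", OF that])
    show "0 \<le> (\<Sum>c\<in>Basis. B x c)" if "x \<in> Basis - {b}" for x
      using that by (intro sum_nonneg less_imp_le B(1)) auto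
  qed simp
  have K0: "0 < K" unfolding K_def using B(1) by (intro sum_pos) auto
  have "\<bar>dirder Lf b (x, q) - dirder Lf b (y, q)\<bar> \<le> K * norm (x - y)" if b: "b \<in> Basis" and q: "norm q \<le> R" for b x y q
  proof -
    let ?d = "(x - y, 0 :: real^'n)"
    let ?h = "\<lambda>t. dirder Lf b ((y, q) + t *\<^sub>R ?d)"
    have "\<exists>z. 0 < z \<and> z < 1 \<and> ?h 1 - ?h 0 = (1 - 0) * dirder (dirder Lf b) ?d ((y, q) + z *\<^sub>R ?d)"
      by (rule MVT2[OF zero_less_one dirder_line[OF dLf_diff[OF b]]])
    then obtain z where "dirder Lf b (x, q) - dirder Lf b (y, q) = dirder (dirder Lf b) ?d (y + z *\<^sub>R (x - y), q)" by auto
    also have "\<dots> = (\<Sum>c\<in>Basis. (?d \<bullet> c) * dirder (dirder Lf b) c (y + z *\<^sub>R (x - y), q))"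
      by (rule dirder_sum[OF dLf_diff[OF b]])
    also have "\<bar>\<dots>\<bar> \<le> (\<Sum>c\<in>Basis. norm (x - y) * B b c)"
    proof (rule order_trans[OF sum_abs], intro sum_mono)
      fix c :: "(real^'n) \<times> (real^'n)" assume c: "c \<in> Basis"
      have "\<bar>?d \<bullet> c\<bar> \<le> norm (x - y)" using Basis_le_norm[OF c, of ?d] by (simp add: norm_prod_def)
      then show "\<bar>(?d \<bullet> c) * dirder (dirder Lf b) c (y + z *\<^sub>R (x - y), q)\<bar> \<le> norm (x - y) * B b c"
        unfolding abs_mult using B[OF b c] q by (intro mult_mono) auto
    qed
    also have "\<dots> \<le> norm (x - y) * K" unfolding sum_distrib_left[symmetric] by (intro mult_left_mono BK b) auto
    finally show ?thesis by (simp add: mult.commute)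
  qed
  then have comp: "\<bar>(Lq x q - Lq y q) $ i\<bar> \<le> K * norm (x - y)" if "norm q \<le> R" for x y q i
    using that by (simp add: Lq_nth Basis_snd axis_in_Basis_iff)
  have "norm (Lq x q - Lq y q) \<le> (real CARD('n) * K) * norm (x - y)" if "norm q \<le> R" for x y q
  proof -
    have "norm (Lq x q - Lq y q) \<le> (\<Sum>i\<in>UNIV. \<bar>(Lq x q - Lq y q) $ i\<bar>)" by (rule norm_le_l1_cart)
    also have "\<dots> \<le> real CARD('n) * (K * norm (x - y))" using comp[OF that] by (intro sum_bounded_above) auto
    finally show ?thesis by simp
  qed
  then show ?thesis using K0 by (intro that[of "real CARD('n) * K"]) auto
qed

end

subsection \<open>Sequential compactness of the probability measures on the torus\<close>

text \<open>Used with r = 1/3, where it embeds bit sequences into the line as a Cantor set, and with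
  r = 1/2, where it reads the bits at the positions s as a binary expansion.\<close>

definition digit_sum :: "real \<Rightarrow> (nat \<Rightarrow> nat) \<Rightarrow> (nat \<Rightarrow> bool) \<Rightarrow> real" where
  "digit_sum r s a = (\<Sum>k. of_bool (a (s k)) * r ^ Suc k)"

lemma digit_sum_summable: "0 < (r::real) \<Longrightarrow> r < 1 \<Longrightarrow> summable (\<lambda>k. of_bool (a (s k)) * r ^ Suc k)"
  by (rule summable_comparison_test'[of "\<lambda>k. r ^ Suc k" 0]) (auto simp: summable_mult)

lemma digit_sum_continuous:
  assumes "0 < r" "r < 1" shows "continuous_on UNIV (digit_sum r s)"
proof (rule uniform_limit_theorem)
  show "uniform_limit UNIV (\<lambda>n a. \<Sum>k<n. of_bool (a (s k)) * r ^ Suc k) (digit_sum r s) sequentially"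
    unfolding digit_sum_def
    by (rule Weierstrass_m_test[where M="\<lambda>k. r ^ Suc k"]) (use assms in \<open>auto simp: summable_mult\<close>)
  show "\<forall>\<^sub>F n in sequentially. continuous_on UNIV (\<lambda>a. \<Sum>k<n. of_bool (a (s k)) * r ^ Suc k)"
  proof (intro always_eventually allI continuous_on_sum continuous_on_mult continuous_on_const)
    fix k
    show "continuous_on UNIV (\<lambda>a. of_bool (a (s k)) :: real)"
      by (rule continuous_on_compose2[where g=of_bool and t=UNIV and f="\<lambda>a. a (s k)"]) auto
  qed
qed auto

lemma digit_sum_recursion:
  assumes "0 < r" "r < 1" shows "digit_sum r (\<lambda>k. k) a = r * (of_bool (a 0) + digit_sum r (\<lambda>k. k) (\<lambda>k. a (Suc k)))"
proof -
  have "digit_sum r (\<lambda>k. k) a = (\<Sum>k. of_bool (a (Suc k)) * r ^ Suc (Suc k)) + of_bool (a 0) * r ^ Suc 0"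
    unfolding digit_sum_def using suminf_split_head[OF digit_sum_summable[OF assms, of a "\<lambda>k. k"]] by simp
  also have "(\<Sum>k. of_bool (a (Suc k)) * r ^ Suc (Suc k)) = (\<Sum>k. r * (of_bool (a (Suc k)) * r ^ Suc k))"
    by (simp add: mult_ac)
  also have "\<dots> = r * digit_sum r (\<lambda>k. k) (\<lambda>k. a (Suc k))"
    unfolding digit_sum_def using suminf_mult[OF digit_sum_summable[OF assms, of "\<lambda>k. a (Suc k)" "\<lambda>k. k"], of r] by simp
  finally show ?thesis by (simp add: algebra_simps)
qed

lemma digit_sum_bounds:
  assumes "0 < r" "r < 1" shows "0 \<le> digit_sum r s a" "digit_sum r s a \<le> r / (1 - r)"
proof -
  show "0 \<le> digit_sum r s a" unfolding digit_sum_def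
    by (rule suminf_nonneg[OF digit_sum_summable[OF assms]]) (use assms in auto)
  have g: "(\<lambda>k. r * r ^ k) sums (r * (1 / (1 - r)))" using assms by (intro sums_mult geometric_sums) auto
  have "digit_sum r s a \<le> (\<Sum>k. r * r ^ k)" unfolding digit_sum_def
    by (rule suminf_le[OF _ digit_sum_summable[OF assms]]) (use assms g in \<open>auto simp: sums_iff\<close>)
  then show "digit_sum r s a \<le> r / (1 - r)" using g by (simp add: sums_iff)
qed

text \<open>For r = 1/3 the tail after the leading bit is at most 1/2 before scaling, less than the
  contribution 1 of that bit. The leading bits of equal sums therefore agree, and the recursion
  peels them off.\<close>

lemma digit_sum_inj: "inj (digit_sum (1/3) (\<lambda>k. k))"
proof (rule injI)
  have *: "digit_sum (1/3) (\<lambda>k. k) a = digit_sum (1/3) (\<lambda>k. k) b \<Longrightarrow> a k = b k" for k and a b :: "nat \<Rightarrow> bool"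
  proof (induction k arbitrary: a b)
    case 0
    show ?case
      using 0 digit_sum_recursion[of "1/3" a] digit_sum_recursion[of "1/3" b]
        digit_sum_bounds[of "1/3" "\<lambda>k. k" "\<lambda>k. a (Suc k)"] digit_sum_bounds[of "1/3" "\<lambda>k. k" "\<lambda>k. b (Suc k)"]
      by (cases "a 0"; cases "b 0") auto
  next
    case (Suc k)
    have "a 0 = b 0"
      using Suc.prems digit_sum_recursion[of "1/3" a] digit_sum_recursion[of "1/3" b]
        digit_sum_bounds[of "1/3" "\<lambda>k. k" "\<lambda>k. a (Suc k)"] digit_sum_bounds[of "1/3" "\<lambda>k. k" "\<lambda>k. b (Suc k)"]
      by (cases "a 0"; cases "b 0") auto
    then have "digit_sum (1/3) (\<lambda>k. k) (\<lambda>k. a (Suc k)) = digit_sum (1/3) (\<lambda>k. k) (\<lambda>k. b (Suc k))"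
      using Suc.prems digit_sum_recursion[of "1/3" a] digit_sum_recursion[of "1/3" b] by simp
    from Suc.IH[OF this] show ?case .
  qed
  fix a b :: "nat \<Rightarrow> bool" assume "digit_sum (1/3) (\<lambda>k. k) a = digit_sum (1/3) (\<lambda>k. k) b"
  then show "a = b" using * by blast
qed

text \<open>The digit sequence serves every a and s that reproduce it, because the digits of several
  coordinates are later stored at interleaved positions of one sequence.\<close>

lemma binary_expansion:
  assumes x: "0 \<le> x" "x < 1"
  obtains d where "\<And>s a. (\<And>k. a (s k) = d k) \<Longrightarrow> digit_sum (1/2) s a = x"
proof -
  define d where "d k \<longleftrightarrow> odd \<lfloor>2 ^ Suc k * x\<rfloor>" for k
  have step: "\<lfloor>2 ^ Suc k * x\<rfloor> = 2 * \<lfloor>2 ^ k * x\<rfloor> + of_bool (d k)" for k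
  proof -
    let ?y = "2 ^ k * x"
    have e: "2 ^ Suc k * x = 2 * ?y" by simp
    have "\<lfloor>2 * ?y\<rfloor> = 2 * \<lfloor>?y\<rfloor> \<or> \<lfloor>2 * ?y\<rfloor> = 2 * \<lfloor>?y\<rfloor> + 1" by linarith
    then show ?thesis unfolding d_def e by auto
  qed
  have part: "(\<Sum>k<n. of_bool (d k) * (1/2) ^ Suc k) = real_of_int \<lfloor>2 ^ n * x\<rfloor> / 2 ^ n" for n
  proof (induction n)
    case 0
    have "\<lfloor>x\<rfloor> = 0" using x by (simp add: floor_eq_iff)
    then show ?case by simp
  next
    case (Suc n)
    then show ?case unfolding step[of n] by (simp add: field_simps power_divide)
  qed
  have lim: "(\<lambda>n. real_of_int \<lfloor>2 ^ n * x\<rfloor> / 2 ^ n) \<longlonglongrightarrow> x"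
  proof (rule real_tendsto_sandwich[of "\<lambda>n. x - (1/2) ^ n" _ _ "\<lambda>n. x"])
    show "\<forall>\<^sub>F n in sequentially. x - (1/2) ^ n \<le> real_of_int \<lfloor>2 ^ n * x\<rfloor> / 2 ^ n"
    proof (intro always_eventually allI)
      fix n
      have "2 ^ n * x - 1 \<le> real_of_int \<lfloor>2 ^ n * x\<rfloor>" by linarith
      then have "(2 ^ n * x - 1) / 2 ^ n \<le> real_of_int \<lfloor>2 ^ n * x\<rfloor> / 2 ^ n" by (intro divide_right_mono) auto
      then show "x - (1/2) ^ n \<le> real_of_int \<lfloor>2 ^ n * x\<rfloor> / 2 ^ n" by (simp add: diff_divide_distrib power_divide)
    qed
    show "\<forall>\<^sub>F n in sequentially. real_of_int \<lfloor>2 ^ n * x\<rfloor> / 2 ^ n \<le> x"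
      by (intro always_eventually allI) (simp add: pos_divide_le_eq mult.commute)
    have "(\<lambda>n. x - (1/2::real) ^ n) \<longlonglongrightarrow> x - 0" by (intro tendsto_intros LIMSEQ_power_zero) auto
    then show "(\<lambda>n. x - (1/2::real) ^ n) \<longlonglongrightarrow> x" by simp
  qed auto
  have "digit_sum (1/2) s a = x" if "\<And>k. a (s k) = d k" for s a
  proof -
    have "(\<lambda>k. of_bool (a (s k)) * (1/2) ^ Suc k) sums x" unfolding sums_def that part by (rule lim)
    then show ?thesis unfolding digit_sum_def by (rule sums_unique[symmetric])
  qed
  then show ?thesis by (rule that)
qed

lemma compact_bool_sequences: "compact (UNIV :: (nat \<Rightarrow> bool) set)"
proof -
  have "compact_space (euclidean :: bool topology)" by (simp add: compact_space_def finite_imp_compact)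
  then have "compact_space (product_topology (\<lambda>i::nat. (euclidean :: bool topology)) UNIV)"
    by (simp add: compact_space_product_topology)
  then show ?thesis by (simp add: euclidean_product_topology compact_space_def)
qed

text \<open>A space-filling curve: the Cantor set maps onto the torus by interleaved binary digits, and the
  map extends to the line by Tietze's theorem. Taking the least preimage in the Cantor set gives a
  Borel section, through which Helly's theorem is transported from the line to the torus.\<close>

lemma torus_curve:
  obtains f :: "real \<Rightarrow> 'n::finite torus" and g :: "'n torus \<Rightarrow> real"
  where "continuous_on UNIV f" "g \<in> borel_measurable borel" "\<And>x. f (g x) = x" "\<And>x. g x \<in> {0..1}"
proof -
  obtain h :: "'n \<Rightarrow> nat" where h: "bij_betw h UNIV {0..<CARD('n)}"
    using ex_bij_betw_finite_nat[of "UNIV :: 'n set"] by auto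
  have hlt: "h i < CARD('n)" for i using bij_betwE[OF h] by auto
  have hinj: "h i = h j \<Longrightarrow> i = j" for i j using bij_betw_imp_inj_on[OF h] by (auto dest: injD)
  let ?E = "digit_sum (1/3) (\<lambda>k. k)"
  \<comment> \<open>Bit k of coordinate i is stored at position h i + N k, with N the dimension;
    division with remainder recovers i and k in the definition of \<open>a\<close> below.\<close>
  define \<sigma> where "\<sigma> i k = h i + CARD('n) * k" for i k
  define P where "P a = (\<chi> i. digit_sum (1/2) (\<sigma> i) a)" for a
  define K where "K = range ?E"
  have cE: "continuous_on UNIV ?E" by (rule digit_sum_continuous) auto
  have cP: "continuous_on UNIV P" unfolding P_def by (intro continuous_on_vec_lambda digit_sum_continuous) auto
  have cK: "compact K" unfolding K_def by (rule compact_continuous_image[OF cE compact_bool_sequences])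
  have cinv: "continuous_on K (inv ?E)"
    unfolding K_def by (rule continuous_on_inv[OF cE compact_bool_sequences]) (auto simp: inv_f_f[OF digit_sum_inj])
  have "0 \<le> ?E a" "?E a \<le> 1" for a using digit_sum_bounds[of "1/3" "\<lambda>k. k" a] by simp_all
  then have K01: "K \<subseteq> {0..1}" unfolding K_def by auto
  have "continuous_on K (\<lambda>t. P (inv ?E t))" by (rule continuous_on_compose2[OF cP cinv]) auto
  then obtain F where F: "continuous_on UNIV F" "\<And>t. t \<in> K \<Longrightarrow> F t = P (inv ?E t)"
    using Tietze_unbounded[of K "\<lambda>t. P (inv ?E t)" UNIV] compact_imp_closed[OF cK] by auto
  define f where "f t = tproj (F t)" for t
  have cf: "continuous_on UNIV f" unfolding f_def
    by (rule continuous_on_compose2[OF continuous_tproj F(1)]) auto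
  have surj: "\<exists>t\<in>K. f t = x" for x
  proof -
    let ?y = "torus_section x"
    have "\<exists>d. \<forall>s a. (\<forall>k. a (s k) = d k) \<longrightarrow> digit_sum (1/2) s a = ?y $ i" for i
    proof -
      have "0 \<le> ?y $ i" "?y $ i < 1" using section_in_cube[of x] by (auto simp: unit_cube_def)
      from binary_expansion[OF this] show ?thesis by metis
    qed
    then obtain d where d: "\<And>i s a. (\<forall>k. a (s k) = d i k) \<Longrightarrow> digit_sum (1/2) s a = ?y $ i" by metis
    define a where "a m = d (the_inv h (m mod CARD('n))) (m div CARD('n))" for m
    have "the_inv h (h i) = i" for i by (rule the_inv_f_f) (auto intro: injI hinj)
    then have "a (\<sigma> i k) = d i k" for i k unfolding a_def \<sigma>_def using hlt[of i] by simp
    then have "P a = ?y" unfolding P_def by (simp add: vec_eq_iff d)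
    moreover have "F (?E a) = P a" using F(2)[of "?E a"] inv_f_f[OF digit_sum_inj] by (simp add: K_def)
    ultimately have "f (?E a) = x" by (simp add: f_def)
    then show ?thesis by (auto simp: K_def)
  qed
  have closed_img: "closed (f ` (K \<inter> {..c}))" for c
  proof -
    have "compact (F ` (K \<inter> {..c}))"
      by (intro compact_continuous_image continuous_on_subset[OF F(1)] compact_Int_closed cK) auto
    from closed_tproj_image[OF this] show ?thesis by (simp add: f_def[abs_def] image_image)
  qed
  define S where "S x = {t\<in>K. f t = x}" for x
  have S: "S x \<noteq> {}" "S x \<subseteq> {0..1}" "closed (S x)" for x
  proof -
    show "S x \<noteq> {}" "S x \<subseteq> {0..1}" using surj[of x] K01 by (auto simp: S_def)
    have "S x = K \<inter> F -` (tproj -` {x})" by (auto simp: S_def f_def)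
    moreover have "closed (tproj -` {x})"
    proof -
      have "closed (tproj ` {torus_section x})" by (rule closed_tproj_image) auto
      then have "closed {x}" by simp
      then show ?thesis using continuous_closed_vimage[of "{x}" tproj] continuous_tproj[of UNIV]
        by (auto simp: continuous_on_closed_vimage)
    qed
    ultimately show "closed (S x)"
      using F(1) compact_imp_closed[OF cK] by (auto intro!: closed_Int continuous_closed_vimage simp: continuous_on_eq_continuous_at)
  qed
  define g where "g x = Inf (S x)" for x
  have bb: "bdd_below (S x)" for x by (rule bdd_below_mono[OF bdd_below_Icc S(2)])
  have gS: "g x \<in> S x" for x unfolding g_def by (rule closed_contains_Inf[OF S(1) bb S(3)])
  \<comment> \<open>A point has a preimage in K at most c exactly when its least preimage is;
    sublevel sets of g are thus projections of compact sets.\<close>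
  have "{x. g x \<le> c} = f ` (K \<inter> {..c})" for c
  proof
    show "{x. g x \<le> c} \<subseteq> f ` (K \<inter> {..c})" using gS by (force simp: S_def)
    show "f ` (K \<inter> {..c}) \<subseteq> {x. g x \<le> c}"
    proof clarsimp
      fix t assume t: "t \<in> K" "t \<le> c"
      then have "g (f t) \<le> t" unfolding g_def by (intro cInf_lower bb) (simp add: S_def)
      then show "g (f t) \<le> c" using t by simp
    qed
  qed
  then have "g \<in> borel_measurable borel" unfolding borel_measurable_iff_le by (simp add: closed_img borel_closed)
  moreover have "f (g x) = x" "g x \<in> {0..1}" for x using gS[of x] K01 by (auto simp: S_def)
  ultimately show ?thesis by (rule that[OF cf])
qed

text \<open>Pushed forward by g the measures live on [0, 1], so they are tight. The limit on the
  line need not be carried by the range of g: test functions are pulled back by the continuous f,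
  and f (g x) = x restores the original integrals.\<close>

lemma torus_prob_compact:
  fixes M :: "nat \<Rightarrow> 'n::finite torus measure"
  assumes M: "\<And>k. M k \<in> borel_prob_measures"
  obtains r N where "strict_mono r" "N \<in> borel_prob_measures"
    "\<And>\<phi> :: 'n torus \<Rightarrow> real. continuous_on UNIV \<phi> \<Longrightarrow> (\<lambda>k. LINT x|M (r k). \<phi> x) \<longlonglongrightarrow> (LINT x|N. \<phi> x)"
proof -
  obtain f :: "real \<Rightarrow> 'n torus" and g :: "'n torus \<Rightarrow> real" where
    f: "continuous_on UNIV f" and [measurable]: "g \<in> borel_measurable borel" and fg: "\<And>x. f (g x) = x" and g01: "\<And>x. g x \<in> {0..1}"
    using torus_curve by metis
  have [measurable]: "f \<in> borel_measurable borel" by (rule borel_measurable_continuous_onI[OF f])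
  have sM: "sets (M k) = sets borel" and pM: "prob_space (M k)" for k using M by (auto simp: borel_prob_measures_def)
  have gm: "g \<in> M k \<rightarrow>\<^sub>M borel" for k by (simp add: measurable_cong_sets[OF sM refl])
  define \<nu> where "\<nu> k = distr (M k) borel g" for k
  have rd: "real_distribution (\<nu> k)" for k
    unfolding \<nu>_def real_distribution_def real_distribution_axioms_def using prob_space.prob_space_distr[OF pM gm] by simp
  have "tight \<nu>" unfolding tight_def
  proof (intro conjI allI impI rd)
    fix e :: real assume "0 < e"
    \<comment> \<open>Tightness is phrased with intervals open on the left, so the left end has to
      lie strictly below 0.\<close>
    have "measure (\<nu> k) {-1<..1} = 1" for k
    proof -
      interpret prob_space "M k" by (rule pM)
      have "measure (\<nu> k) {-1<..1} = measure (M k) (g -` {-1<..1} \<inter> space (M k))"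
        unfolding \<nu>_def by (rule measure_distr[OF gm]) simp
      also have "g -` {-1<..1} \<inter> space (M k) = space (M k)"
      proof -
        have "g x \<in> {-1<..1}" for x using g01[of x] by simp
        then show ?thesis by auto
      qed
      finally show ?thesis by (simp add: prob_space)
    qed
    then show "\<exists>a b. a < b \<and> (\<forall>n. 1 - e < measure (\<nu> n) {a<..b})" using \<open>0 < e\<close> by (intro exI[of _ "-1"] exI[of _ 1]) auto
  qed
  from tight_imp_convergent_subsubsequence[OF this strict_mono_id]
  obtain r N where r: "strict_mono r" and N: "real_distribution N" and w: "weak_conv_m (\<nu> \<circ> id \<circ> r) N" by blast
  interpret N: real_distribution N by (rule N)
  define N' where "N' = distr N borel f"
  have fN: "f \<in> N \<rightarrow>\<^sub>M borel" by simp
  have "N' \<in> borel_prob_measures" unfolding N'_def borel_prob_measures_def using N.prob_space_distr[OF fN] by simp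
  moreover have "(\<lambda>k. LINT x|M (r k). \<phi> x) \<longlonglongrightarrow> (LINT x|N'. \<phi> x)" if c: "continuous_on UNIV \<phi>" for \<phi> :: "'n torus \<Rightarrow> real"
  proof -
    have [measurable]: "\<phi> \<in> borel_measurable borel" by (rule borel_measurable_continuous_onI[OF c])
    obtain B where B: "\<And>x. \<bar>\<phi> x\<bar> \<le> B" using torus_continuous_bounded[OF c] by metis
    have cc: "continuous_on UNIV (\<lambda>t. \<phi> (f t))" by (rule continuous_on_compose2[OF c f]) auto
    have "(\<lambda>k. LINT t|(\<nu> \<circ> id \<circ> r) k. \<phi> (f t)) \<longlonglongrightarrow> (LINT t|N. \<phi> (f t))"
    proof (rule weak_conv_imp_integral_bdd_continuous_conv[OF _ N w])
      show "real_distribution ((\<nu> \<circ> id \<circ> r) n)" for n by (simp add: rd)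
      show "isCont (\<lambda>t. \<phi> (f t)) x" for x using cc by (rule continuous_on_interior) simp
      show "norm (\<phi> (f x)) \<le> B" for x using B by simp
    qed
    moreover have "(LINT t|(\<nu> \<circ> id \<circ> r) k. \<phi> (f t)) = (LINT x|M (r k). \<phi> x)" for k
      unfolding \<nu>_def comp_def id_def using integral_distr[OF gm, of "\<lambda>t. \<phi> (f t)" "r k"] by (simp add: fg)
    moreover have "(LINT t|N. \<phi> (f t)) = (LINT x|N'. \<phi> x)"
      unfolding N'_def by (rule integral_distr[symmetric, OF fN]) simp
    ultimately show ?thesis by simp
  qed
  ultimately show ?thesis using that[OF r] by blast
qed

subsection \<open>Weak convergence\<close>

lemma weak_topology_topspace: "topspace weak_topology = (borel_prob_measures :: 'a::topological_space measure set)"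
proof
  show "(borel_prob_measures :: 'a measure set) \<subseteq> topspace weak_topology"
  proof
    fix M :: "'a measure" assume M: "M \<in> borel_prob_measures"
    have "{M \<in> borel_prob_measures. (LINT x|M. (\<lambda>_::'a. 0::real) x) \<in> UNIV} \<in> {{M \<in> borel_prob_measures. (LINT x|M. f x) \<in> U} | (f :: 'a \<Rightarrow> real) U.
        continuous_on UNIV f \<and> bounded (range f) \<and> open U}"
      by (intro CollectI exI[of _ "\<lambda>_. 0"] exI[of _ UNIV]) auto
    then show "M \<in> topspace weak_topology" unfolding weak_topology_def topology_generated_by_topspace using M by blast
  qed
qed (auto simp: weak_topology_def)

lemma limitin_weak_topologyI:
  assumes N: "N \<in> borel_prob_measures" and M: "\<forall>\<^sub>F k in G. M k \<in> borel_prob_measures"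
    and lim: "\<And>\<phi> :: 'a::topological_space \<Rightarrow> real. continuous_on UNIV \<phi> \<Longrightarrow> ((\<lambda>k. LINT x|M k. \<phi> x) \<longlongrightarrow> (LINT x|N. \<phi> x)) G"
  shows "limitin weak_topology M N G"
  unfolding limitin_def weak_topology_topspace
proof (intro conjI N allI impI)
  fix W assume "openin weak_topology W \<and> N \<in> W"
  then have "generate_topology_on {{M \<in> borel_prob_measures. (LINT x|M. f x) \<in> U} | (f :: 'a \<Rightarrow> real) U.
        continuous_on UNIV f \<and> bounded (range f) \<and> open U} W" and "N \<in> W"
    unfolding weak_topology_def openin_topology_generated_by_iff by auto
  then show "\<forall>\<^sub>F k in G. M k \<in> W"
  proof (induction rule: generate_topology_on.induct)
    case (Int a b)
    then show ?case by (auto intro: eventually_conj)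
  next
    case (UN K)
    then obtain k where k: "k \<in> K" "N \<in> k" by blast
    from UN.IH[OF this] show ?case by (rule eventually_mono) (use k in blast)
  next
    case (Basis s)
    then obtain f U where f: "continuous_on UNIV (f :: 'a \<Rightarrow> real)" "open U" and s: "s = {M \<in> borel_prob_measures. (LINT x|M. f x) \<in> U}" by blast
    have "\<forall>\<^sub>F k in G. (LINT x|M k. f x) \<in> U"
      using topological_tendstoD[OF lim[OF f(1)] f(2)] Basis.prems by (simp add: s)
    with M show ?case by eventually_elim (simp add: s)
  qed simp
qed

text \<open>Tube argument: joint continuity at (x, N) gives a product neighbourhood, and compactness
  of the torus leaves finitely many of them. The tolerance e / 2 is spent once at \<open>M k\<close>
  and once at N.\<close>

lemma weak_limit_uniform:
  fixes F :: "'n::finite torus \<Rightarrow> 'n torus measure \<Rightarrow> real"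
  assumes F: "continuous_map (prod_topology euclidean weak_topology) euclidean (\<lambda>(x, M). F x M)"
    and lim: "limitin weak_topology M N G" and e: "0 < e"
  shows "\<forall>\<^sub>F k in G. \<forall>x. \<bar>F x (M k) - F x N\<bar> < e"
proof -
  have N: "N \<in> borel_prob_measures" using lim by (simp add: limitin_def weak_topology_topspace)
  define Q where "Q x U V \<longleftrightarrow> open U \<and> openin weak_topology V \<and> x \<in> U \<and> N \<in> V \<and> (\<forall>y\<in>U. \<forall>P\<in>V. \<bar>F y P - F x N\<bar> < e / 2)" for x U V
  have "\<exists>U V. Q x U V" for x
  proof -
    define W where "W = {z \<in> topspace (prod_topology euclidean weak_topology). (\<lambda>(x, M). F x M) z \<in> {F x N - e/2<..<F x N + e/2}}"
    have "openin euclidean {F x N - e/2<..<F x N + e/2}" by simp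
    then have W: "openin (prod_topology euclidean weak_topology) W"
      unfolding W_def by (rule openin_continuous_map_preimage[OF F])
    have "(x, N) \<in> W" using N e by (simp add: W_def weak_topology_topspace)
    then have "\<exists>U V. openin euclidean U \<and> openin weak_topology V \<and> x \<in> U \<and> N \<in> V \<and> U \<times> V \<subseteq> W"
      using W[unfolded openin_prod_topology_alt] by (elim allE impE)
    then obtain U V where U: "openin euclidean U" and UV: "openin weak_topology V" "x \<in> U" "N \<in> V" "U \<times> V \<subseteq> W"
      by (elim exE conjE)
    from U have "open U" by (rule open_openin[THEN iffD2])
    have "\<bar>F y P - F x N\<bar> < e / 2" if "y \<in> U" "P \<in> V" for y P
    proof -
      have "(y, P) \<in> W" using UV(4) that by blast
      then have "F y P < F x N + e/2" "F x N - e/2 < F y P" by (simp_all add: W_def)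
      then show ?thesis by linarith
    qed
    then show ?thesis unfolding Q_def using \<open>open U\<close> UV(1-3) by blast
  qed
  then obtain U V where "\<And>x. Q x (U x) (V x)" by metis
  then have UV: "\<And>x. open (U x)" "\<And>x. openin weak_topology (V x)" "\<And>x. x \<in> U x" "\<And>x. N \<in> V x"
    and close: "\<And>x y P. y \<in> U x \<Longrightarrow> P \<in> V x \<Longrightarrow> \<bar>F y P - F x N\<bar> < e / 2" unfolding Q_def by blast+
  have cover: "UNIV \<subseteq> (\<Union>x\<in>UNIV. U x)" using UV(3) by auto
  obtain D where D: "finite D" "UNIV \<subseteq> (\<Union>x\<in>D. U x)"
  proof (rule compactE_image[OF compact_torus _ cover])
    show "open (U x)" for x by (rule UV(1))
  next
    fix D assume "finite D" "UNIV \<subseteq> (\<Union>x\<in>D. U x)"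
    then show thesis by (rule that)
  qed
  have "\<forall>\<^sub>F k in G. \<forall>x\<in>D. M k \<in> V x"
    by (intro eventually_ball_finite D(1) ballI limitinD[OF lim] UV(2,4))
  then show ?thesis
  proof (rule eventually_mono, intro allI)
    fix k y assume k: "\<forall>x\<in>D. M k \<in> V x"
    obtain x where x: "x \<in> D" "y \<in> U x" using D(2) by blast
    have "\<bar>F y (M k) - F x N\<bar> < e / 2" "\<bar>F y N - F x N\<bar> < e / 2"
      by (rule close[OF x(2)], use k x(1) UV(4) in blast)+
    then show "\<bar>F y (M k) - F y N\<bar> < e" by linarith
  qed
qed

lemma section_continuous_F:
  fixes F :: "'n::finite torus \<Rightarrow> 'n torus measure \<Rightarrow> real"
  assumes F: "continuous_map (prod_topology euclidean weak_topology) euclidean (\<lambda>(x, M). F x M)"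
    and N: "N \<in> borel_prob_measures"
  shows "continuous_on UNIV (\<lambda>x. F x N)"
proof -
  have "continuous_map euclidean (prod_topology euclidean weak_topology) (\<lambda>x. (x, N))"
    using N by (intro continuous_map_pairedI) (auto simp: weak_topology_topspace)
  from continuous_map_compose[OF this F] show ?thesis by (simp add: o_def)
qed

subsection \<open>From mean-square to uniform smallness\<close>

lemma measure_section_box:
  assumes r: "0 < r" "r \<le> 1"
  shows "measure (torus_lebesgue :: 'n::finite torus measure) {x. \<forall>i. torus_section x $ i < r} = r ^ CARD('n)"
proof -
  let ?A = "{x :: 'n torus. \<forall>i. torus_section x $ i < r}"
  have [measurable]: "(\<lambda>y :: real^'n. y $ i) \<in> borel_measurable borel" for i
    by (intro borel_measurable_continuous_onI continuous_intros)
  have "{y :: real^'n. \<forall>i. y $ i < r} \<in> sets borel" by measurable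
  from measurable_sets[OF section_measurable this] have A[measurable]: "?A \<in> sets borel" by (simp add: vimage_def)
  have "emeasure (torus_lebesgue :: 'n torus measure) ?A = (\<integral>\<^sup>+x. indicator ?A x \<partial>torus_lebesgue)" by simp
  also have "\<dots> = (\<integral>\<^sup>+y. indicator ?A (tproj y) * indicator unit_cube y \<partial>lborel)"
    by (rule nn_integral_torus) measurable
  also have "\<dots> = (\<integral>\<^sup>+y. (\<Prod>i\<in>UNIV. indicator {0..<r} ((y::real^'n) $ i)) \<partial>lborel)"
  proof (intro nn_integral_cong)
    fix y :: "real^'n"
    show "(indicator ?A (tproj y) * indicator unit_cube y :: ennreal) = (\<Prod>i\<in>UNIV. indicator {0..<r} (y $ i))"
    proof (cases "\<forall>i. y $ i \<in> {0..<r}")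
      case True
      then have "y \<in> unit_cube" using r by (auto simp: unit_cube_def) (metis less_le_trans)
      then show ?thesis using True by (simp add: section_tproj_cube)
    next
      case False
      then obtain j where j: "y $ j \<notin> {0..<r}" by blast
      have "(\<Prod>i\<in>UNIV. indicator {0..<r} (y $ i) :: ennreal) = 0"
        by (rule prod_zero) (use j in \<open>auto simp: indicator_def intro!: exI[of _ j]\<close>)
      moreover have "(indicator ?A (tproj y) * indicator unit_cube y :: ennreal) = 0"
        using j by (cases "y \<in> unit_cube") (auto simp: section_tproj_cube unit_cube_def indicator_def)
      ultimately show ?thesis by (simp only:)
    qed
  qed
  also have "\<dots> = ennreal (r ^ CARD('n))"
    by (subst nn_integral_lborel_prod_vec) (use r in \<open>auto simp: ennreal_power\<close>)
  finally show ?thesis using r by (simp add: measure_def)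
qed

text \<open>A value above a at x forces |G| \<ge> a / 2 on a box of side r based at x, hence a mean
  square of at least (a / 2)^2 r^N in dimension N. Since r depends only on a and K, half of this
  serves as d.\<close>

lemma torus_lip_sup_small:
  assumes a: "0 < a" and K: "0 \<le> K"
  obtains d where "0 < d" "\<And>G x. torus_lip K (G :: 'n::finite torus \<Rightarrow> real) \<Longrightarrow>
     (LINT x|torus_lebesgue. (G x)\<^sup>2) \<le> d \<Longrightarrow> \<bar>G x\<bar> \<le> a"
proof -
  let ?N = "real CARD('n)"
  \<comment> \<open>Vectors in the box have norm at most N r, so this r keeps the Lipschitz
    variation below a / 2; K + 1 avoids division by 0.\<close>
  define r where "r = min 1 (a / (2 * (K + 1) * ?N))"
  have N: "?N > 0" by simp
  have r: "0 < r" "r \<le> 1" using a K N by (auto simp: r_def)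
  have "(K + 1) * ?N * r \<le> (K + 1) * ?N * (a / (2 * (K + 1) * ?N))"
    using K by (intro mult_left_mono) (auto simp: r_def)
  also have "\<dots> = a / 2"
  proof -
    have half: "c * (a / (2 * c)) = a / 2" if "0 < c" for c :: real using that by simp
    have "0 < (K + 1) * ?N" using K by simp
    from half[OF this] show ?thesis by (simp only: mult.assoc)
  qed
  finally have Kr: "(K + 1) * ?N * r \<le> a / 2" .
  show ?thesis
  proof (rule that[of "(a / 2)\<^sup>2 * r ^ CARD('n) / 2"])
    show "0 < (a / 2)\<^sup>2 * r ^ CARD('n) / 2" using a r by simp
    fix G :: "'n torus \<Rightarrow> real" and x
    assume G: "torus_lip K G" and I: "(LINT x|torus_lebesgue. (G x)\<^sup>2) \<le> (a / 2)\<^sup>2 * r ^ CARD('n) / 2"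
    show "\<bar>G x\<bar> \<le> a"
    proof (rule ccontr)
      assume "\<not> \<bar>G x\<bar> \<le> a"
      then have big: "a < \<bar>G x\<bar>" by simp
      note c = torus_lip_continuous[OF G]
      interpret prob_space "torus_lebesgue :: 'n torus measure" by (rule prob_space_torus_lebesgue)
      let ?A = "{x :: 'n torus. \<forall>i. torus_section x $ i < r}"
      have [measurable]: "(\<lambda>y :: real^'n. y $ i) \<in> borel_measurable borel" for i
        by (intro borel_measurable_continuous_onI continuous_intros)
      have "{y :: real^'n. \<forall>i. y $ i < r} \<in> sets borel" by measurable
      from measurable_sets[OF section_measurable this] have A[measurable]: "?A \<in> sets borel" by (simp add: vimage_def)
      have cs: "continuous_on UNIV (\<lambda>z. (G (z + x))\<^sup>2)" by (intro continuous_intros continuous_torus_shift c)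
      have "(a / 2)\<^sup>2 * r ^ CARD('n) = (LINT z|torus_lebesgue. (a / 2)\<^sup>2 * indicator ?A z)"
        using measure_section_box[OF r, where 'n='n] by simp
      also have "\<dots> \<le> (LINT z|torus_lebesgue. (G (z + x))\<^sup>2)"
      proof (rule integral_mono)
        show "integrable torus_lebesgue (\<lambda>z. (a / 2)\<^sup>2 * indicator ?A z :: real)" by (simp add: less_top[symmetric])
        show "integrable torus_lebesgue (\<lambda>z. (G (z + x))\<^sup>2)" by (rule integrable_torus[OF cs])
        fix z :: "'n torus"
        show "(a / 2)\<^sup>2 * indicator ?A z \<le> (G (z + x))\<^sup>2"
        proof (cases "z \<in> ?A")
          case True
          let ?h = "torus_section z"
          have hi: "\<bar>?h $ i\<bar> \<le> r" for i using True section_in_cube[of z] by (auto simp: unit_cube_def intro: less_imp_le)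
          have "norm ?h \<le> (\<Sum>i\<in>UNIV. \<bar>?h $ i\<bar>)" by (rule norm_le_l1_cart)
          also have "\<dots> \<le> ?N * r" using hi by (intro sum_bounded_above) auto
          finally have "K * norm ?h \<le> K * (?N * r)" using K by (rule mult_left_mono)
          also have "\<dots> \<le> (K + 1) * (?N * r)" using r by (intro mult_right_mono) auto
          also have "\<dots> \<le> a / 2" using Kr by (simp only: mult.assoc)
          finally have "\<bar>G (x + tproj ?h) - G x\<bar> \<le> a / 2" using torus_lipD[OF G, of x ?h] by linarith
          then have "\<bar>G (z + x) - G x\<bar> \<le> a / 2" by (simp add: add.commute)
          then have "a / 2 \<le> \<bar>G (z + x)\<bar>" using big by linarith
          then have "(a / 2)\<^sup>2 \<le> \<bar>G (z + x)\<bar>\<^sup>2" using a by (intro power_mono) auto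
          then show ?thesis using True by simp
        qed simp
      qed
      also have "\<dots> = (LINT x|torus_lebesgue. (G x)\<^sup>2)"
        using integral_torus_shift[of "\<lambda>z. (G z)\<^sup>2" x] by (simp add: continuous_borel c continuous_on_power)
      also have "\<dots> \<le> (a / 2)\<^sup>2 * r ^ CARD('n) / 2" by (rule I)
      finally show False using a r by simp
    qed
  qed
qed

subsection \<open>Discrete antiderivatives\<close>

text \<open>A midpoint sum for the integral of f over the segment from x to x + 2 n s e_i. Sampling
  at odd multiples of s makes its centred difference with step s telescope.\<close>

definition discrete_primitive :: "real \<Rightarrow> 'n::finite \<Rightarrow> nat \<Rightarrow> ('n torus \<Rightarrow> real) \<Rightarrow> 'n torus \<Rightarrow> real" where
  "discrete_primitive s i n f x = 2 * s * (\<Sum>j<n. f (x + tstep (real (2 * j + 1) * s) i))"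

lemma tstep_add: "tstep (a + b) i = tstep a i + tstep b i"
  by (simp add: tstep_def scaleR_add_left tproj_add)

lemma tstep_diff: "tstep (a - b) i = tstep a i - tstep b i"
  by (simp add: tstep_def scaleR_diff_left tproj_diff)

lemma continuous_discrete_primitive: "continuous_on UNIV f \<Longrightarrow> continuous_on UNIV (discrete_primitive s i n f)"
  unfolding discrete_primitive_def by (intro continuous_intros continuous_torus_shift)

lemma cdiff_discrete_primitive:
  assumes s: "s \<noteq> 0"
  shows "cdiff s i (discrete_primitive s i n f) x = f (x + tstep (real (2 * n) * s) i) - f x"
proof -
  have e: "x + tstep s i + tstep (real (2 * j + 1) * s) i = x + tstep (real (2 * Suc j) * s) i"
    "x - tstep s i + tstep (real (2 * j + 1) * s) i = x + tstep (real (2 * j) * s) i" for j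
  proof -
    have "real (2 * Suc j) * s = s + real (2 * j + 1) * s" "real (2 * j) * s = real (2 * j + 1) * s - s"
      by (simp_all add: algebra_simps)
    then show "x + tstep s i + tstep (real (2 * j + 1) * s) i = x + tstep (real (2 * Suc j) * s) i"
      "x - tstep s i + tstep (real (2 * j + 1) * s) i = x + tstep (real (2 * j) * s) i"
      by (simp_all only: tstep_add tstep_diff) (simp_all add: algebra_simps)
  qed
  have "discrete_primitive s i n f (x + tstep s i) - discrete_primitive s i n f (x - tstep s i)
    = 2 * s * (\<Sum>j<n. f (x + tstep (real (2 * Suc j) * s) i) - f (x + tstep (real (2 * j) * s) i))"
    unfolding discrete_primitive_def e by (simp add: sum_subtractf algebra_simps)
  also have "(\<Sum>j<n. f (x + tstep (real (2 * Suc j) * s) i) - f (x + tstep (real (2 * j) * s) i)) = f (x + tstep (real (2 * n) * s) i) - f (x + tstep (real (2 * 0) * s) i)"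
    by (rule sum_lessThan_telescope)
  also have "tstep (real (2 * 0) * s) i = 0" by (simp add: tstep_def)
  finally show ?thesis using s by (simp add: cdiff_def)
qed

lemma discrete_primitive_bound:
  assumes "\<And>x. \<bar>f x\<bar> \<le> A" "0 \<le> s" "real (2 * n) * s \<le> 1"
  shows "\<bar>discrete_primitive s i n f x\<bar> \<le> A"
proof -
  have A: "0 \<le> A" using assms(1)[of 0] by linarith
  have "\<bar>\<Sum>j<n. f (x + tstep (real (2 * j + 1) * s) i)\<bar> \<le> real n * A"
    using sum_bounded_above[of "{..<n}" "\<lambda>j. \<bar>f (x + tstep (real (2 * j + 1) * s) i)\<bar>" A] assms(1)
    by (intro order_trans[OF sum_abs]) simp
  then have "\<bar>discrete_primitive s i n f x\<bar> \<le> 2 * s * (real n * A)"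
    unfolding discrete_primitive_def abs_mult using assms(2) by (intro mult_mono) auto
  also have "\<dots> = (real (2 * n) * s) * A" by simp
  also have "\<dots> \<le> 1 * A" using assms(3) A by (rule mult_right_mono)
  finally show ?thesis by simp
qed

subsection \<open>Twice differentiable functions under the heat flow\<close>

context C2_torus
begin

lemma gradient_lip:
  obtains K where "0 < K" "\<And>x y. norm (gradient U x - gradient U y) \<le> K * norm (x - y)"
proof -
  let ?N = "real CARD('n)"
  obtain K where K: "0 < K" "\<And>i j y. \<bar>pd2 U i j y\<bar> \<le> K" by (fact pd2_bound)
  have d: "dirder U (axis i 1) differentiable (at x)" for i x
    by (rule Ck_SucD(1)[OF Ck_SucD(2)[OF Ck2']]) (simp add: axis_in_Basis_iff)
  have comp: "\<bar>gradient U x $ i - gradient U y $ i\<bar> \<le> ?N * K * norm (x - y)" for x y i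
  proof -
    let ?h = "\<lambda>t. dirder U (axis i 1) (y + t *\<^sub>R (x - y))"
    have "\<exists>z. 0 < z \<and> z < 1 \<and> ?h 1 - ?h 0 = (1 - 0) * dirder (dirder U (axis i 1)) (x - y) (y + z *\<^sub>R (x - y))"
      by (rule MVT2[OF zero_less_one dirder_line[OF d]])
    then obtain z where "?h 1 - ?h 0 = dirder (dirder U (axis i 1)) (x - y) (y + z *\<^sub>R (x - y))" by auto
    also have "\<dots> = (\<Sum>j\<in>UNIV. (x - y) $ j * pd2 U i j (y + z *\<^sub>R (x - y)))"
      by (subst dirder_sum[OF d], subst sum_Basis_vec) (simp add: inner_axis pd2_def)
    also have "\<bar>\<dots>\<bar> \<le> (\<Sum>j\<in>(UNIV::'n set). norm (x - y) * K)"
      by (rule order_trans[OF sum_abs], unfold abs_mult, intro sum_mono mult_mono component_le_norm_cart K(2)) auto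
    finally show ?thesis by (simp add: gradient_def dirder_def mult_ac)
  qed
  have "norm (gradient U x - gradient U y) \<le> (?N * (?N * K)) * norm (x - y)" for x y
  proof -
    have "norm (gradient U x - gradient U y) \<le> (\<Sum>i\<in>UNIV. \<bar>(gradient U x - gradient U y) $ i\<bar>)" by (rule norm_le_l1_cart)
    also have "\<dots> \<le> ?N * (?N * K * norm (x - y))" using comp[of x _ y] by (intro sum_bounded_above) auto
    finally show ?thesis by (simp add: mult.assoc)
  qed
  then show ?thesis using K(1) by (intro that[of "?N * (?N * K)"]) auto
qed

lemma neg_semiconvex: obtains C where "0 \<le> C" "semiconvex C (\<lambda>x. - u x)"
proof -
  obtain C where C: "0 \<le> C" "\<And>x y. \<bar>U (x + y) - U x - gradient U x \<bullet> y\<bar> \<le> C * (norm y)\<^sup>2"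
    by (fact taylor_quadratic)
  have "semiconvex (2 * C) (\<lambda>x. - u x)" unfolding semiconvex_def
  proof (intro allI)
    fix x :: "'n torus" and h :: "real^'n"
    obtain y where y: "x = tproj y" by (rule tproj_cases)
    have "\<bar>U (y + h) - U y - gradient U y \<bullet> h\<bar> \<le> C * (norm h)\<^sup>2" "\<bar>U (y - h) - U y + gradient U y \<bullet> h\<bar> \<le> C * (norm h)\<^sup>2"
      using C(2)[of y h] C(2)[of y "- h"] by simp_all
    moreover have "U (y + h) = u (x + tproj h)" "U (y - h) = u (x - tproj h)" "U y = u x"
      by (simp_all add: U_def y tproj_add tproj_diff)
    ultimately show "- (2 * C) * (norm h)\<^sup>2 \<le> - u (x + tproj h) + - u (x - tproj h) - 2 * - u x"
      by (simp add: abs_le_iff)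
  qed
  then show ?thesis using C(1) by (intro that[of "2 * C"]) auto
qed

text \<open>The velocity v is unrestricted, so the error may grow with it, but only as t^2 |v|^2:
  Taylor's bound controls the displacement, and \<open>periodic_modulus\<close> the change of the
  Laplacian between y and y + t v.\<close>

lemma heat_conv_displaced:
  assumes e: "0 < e"
  obtains t0 C where "0 < t0" "0 \<le> C" "\<And>t y v. 0 < t \<Longrightarrow> t < t0 \<Longrightarrow>
     \<bar>heat_conv t u (tproj y + tproj (t *\<^sub>R v)) - u (tproj y) - t * (laplacian U y + gradient U y \<bullet> v)\<bar> \<le> t * (e + C * t * (norm v)\<^sup>2)"
proof -
  have e2: "0 < e / 2" using e by simp
  obtain t1 where t1: "0 < t1" "\<And>t y. 0 < t \<Longrightarrow> t < t1 \<Longrightarrow> \<bar>heat_conv t u (tproj y) - u (tproj y) - t * laplacian U y\<bar> \<le> t * (e / 2)"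
    by (fact heat_conv_expansion[OF e2])
  obtain C1 where C1: "0 \<le> C1" "\<And>x y. \<bar>U (x + y) - U x - gradient U x \<bullet> y\<bar> \<le> C1 * (norm y)\<^sup>2"
    by (fact taylor_quadratic)
  obtain C2 where C2: "0 \<le> C2" "\<And>x h. \<bar>laplacian U (x + h) - laplacian U x\<bar> \<le> e / 2 + C2 * (norm h)\<^sup>2"
    by (fact periodic_modulus[OF laplacian_periodic laplacian_continuous e2])
  have "\<bar>heat_conv t u (tproj y + tproj (t *\<^sub>R v)) - u (tproj y) - t * (laplacian U y + gradient U y \<bullet> v)\<bar> \<le> t * (e + (C1 + C2) * t * (norm v)\<^sup>2)"
    if t: "0 < t" "t < min t1 1" for t y v
  proof -
    let ?z = "y + t *\<^sub>R v"
    have "\<bar>heat_conv t u (tproj ?z) - U ?z - t * laplacian U ?z\<bar> \<le> t * (e / 2)"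
      using t1(2)[of t ?z] t by (simp add: U_def)
    moreover have "\<bar>U ?z - U y - t * (gradient U y \<bullet> v)\<bar> \<le> C1 * (t\<^sup>2 * (norm v)\<^sup>2)"
      using C1(2)[of y "t *\<^sub>R v"] by (simp add: power_mult_distrib)
    moreover have "\<bar>t * laplacian U ?z - t * laplacian U y\<bar> \<le> t * (e / 2) + C2 * (t\<^sup>2 * (norm v)\<^sup>2)"
    proof -
      have "\<bar>laplacian U ?z - laplacian U y\<bar> \<le> e / 2 + C2 * (t\<^sup>2 * (norm v)\<^sup>2)"
        using C2(2)[of y "t *\<^sub>R v"] by (simp add: power_mult_distrib)
      from mult_left_mono[OF this, of t] have "\<bar>t * laplacian U ?z - t * laplacian U y\<bar> \<le> t * (e / 2 + C2 * (t\<^sup>2 * (norm v)\<^sup>2))"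
        using t by (simp add: abs_mult right_diff_distrib[symmetric])
      also have "\<dots> = t * (e / 2) + t * (C2 * (t\<^sup>2 * (norm v)\<^sup>2))" by (simp add: distrib_left)
      also have "t * (C2 * (t\<^sup>2 * (norm v)\<^sup>2)) \<le> 1 * (C2 * (t\<^sup>2 * (norm v)\<^sup>2))"
        using t C2(1) by (intro mult_right_mono) auto
      finally show ?thesis by simp
    qed
    ultimately have "\<bar>heat_conv t u (tproj ?z) - U y - t * (laplacian U y + gradient U y \<bullet> v)\<bar>
      \<le> t * (e / 2) + C1 * (t\<^sup>2 * (norm v)\<^sup>2) + (t * (e / 2) + C2 * (t\<^sup>2 * (norm v)\<^sup>2))"
      unfolding distrib_left by linarith
    also have "\<dots> = t * (e + (C1 + C2) * t * (norm v)\<^sup>2)" by (simp add: algebra_simps power2_eq_square)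
    finally show ?thesis by (simp add: U_def tproj_add)
  qed
  then show ?thesis using t1(1) C1(1) C2(1) by (intro that[of "min t1 1" "C1 + C2"]) auto
qed

end

lemma heat_conv_diff:
  fixes a b :: "'n::finite torus \<Rightarrow> real"
  assumes t: "t > 0" and a: "continuous_on UNIV a" and b: "continuous_on UNIV b"
  shows "heat_conv t (\<lambda>x. a x - b x) y = heat_conv t a y - heat_conv t b y"
  unfolding heat_conv_cont[OF t a] heat_conv_cont[OF t b] heat_conv_cont[OF t continuous_on_diff[OF a b]]
  by (intro Bochner_Integration.integral_diff integrable_gauss t a b)

lemma semiconvex_add:
  assumes "semiconvex C f" "semiconvex D g" shows "semiconvex (C + D) (\<lambda>x. f x + g x)"
  unfolding semiconvex_def
proof (intro allI)
  fix x h
  show "- (C + D) * (norm h)\<^sup>2 \<le> f (x + tproj h) + g (x + tproj h) + (f (x - tproj h) + g (x - tproj h)) - 2 * (f x + g x)"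
    using semiconvexD[OF assms(1), of h x] semiconvexD[OF assms(2), of h x] by (simp add: algebra_simps)
qed

subsection \<open>Testing each system with the solution of the other\<close>

locale mfg_limit =
  fixes L :: "'n::finite torus \<Rightarrow> real^'n \<Rightarrow> real"
    and F :: "'n torus \<Rightarrow> 'n torus measure \<Rightarrow> real"
    and c0 k0 k1 k2 :: real and x0 :: "'n torus"
    and rt :: "real \<Rightarrow> real" and ut :: "real \<Rightarrow> 'n torus \<Rightarrow> real"
    and Mt :: "real \<Rightarrow> ('n torus \<times> (real^'n)) measure"
    and rho :: real and u m :: "'n torus \<Rightarrow> real"
  assumes tonelli: "tonelli_lagrangian L"
    and c0_pos: "c0 > 0"
    and hess: "\<And>x q v. v \<bullet> (hessian (L x) q *v v) \<ge> c0 * (norm v)\<^sup>2"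
    and L_second: "\<And>x h q v. L (tproj (x + h)) (q + v) - 2 * L (tproj x) q + L (tproj (x - h)) (q - v)
           \<le> k1 * (norm h)\<^sup>2 + k2 * (norm v)\<^sup>2"
    and F_cont: "continuous_map (prod_topology euclidean weak_topology) euclidean (\<lambda>(x, M). F x M)"
    and F_mono: "\<And>M M'. M \<in> borel_prob_measures \<Longrightarrow> M' \<in> borel_prob_measures \<Longrightarrow> M \<noteq> M' \<Longrightarrow>
           (LINT x|M. F x M - F x M') - (LINT x|M'. F x M - F x M') > 0"
    and F_second: "\<And>x h M. M \<in> borel_prob_measures \<Longrightarrow>
           F (tproj (x + h)) M - 2 * F (tproj x) M + F (tproj (x - h)) M \<le> k0 * (norm h)\<^sup>2"
    and discrete: "\<And>t. t > 0 \<Longrightarrow> discrete_mfg_solution L F t (rt t) (ut t) (Mt t)"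
    and ut0: "\<And>t. t > 0 \<Longrightarrow> ut t x0 = 0"
    and ergodic: "ergodic_mfg_solution L F rho u m"
    and u0: "u x0 = 0"
begin

sublocale CL: convex_lagrangian L c0
  using tonelli c0_pos hess by unfold_locales (auto simp: tonelli_lagrangian_def)

sublocale cu: C2_torus u "u \<circ> tproj"
  using ergodic by unfold_locales (auto simp: ergodic_mfg_solution_def)

sublocale cm: C2_torus m "m \<circ> tproj"
  using ergodic by unfold_locales (auto simp: ergodic_mfg_solution_def)

lemma m_pos: "0 < m x" and m_int: "(LINT x|torus_lebesgue. m x) = 1"
  using ergodic by (auto simp: ergodic_mfg_solution_def)

lemmas m_cont = cm.u_cont and u_cont = cu.u_cont

definition fm :: "'n torus \<Rightarrow> real" where "fm x = F x (density_measure m)"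
definition Ft :: "real \<Rightarrow> 'n torus \<Rightarrow> real" where "Ft t x = F x (Pr1 (Mt t))"
definition G :: "real^'n \<Rightarrow> real^'n" where "G = gradient (u \<circ> tproj)"
definition Q :: "real^'n \<Rightarrow> real^'n" where "Q y = CL.qs y (G y)"
definition DM :: "'n torus \<Rightarrow> real" where "DM x = laplacian (m \<circ> tproj) (torus_section x)"
definition Z :: "real^'n \<Rightarrow> real^'n" where "Z y = m (tproj y) *\<^sub>R Q y"

lemma m_low_ex: "\<exists>c>0. \<forall>x. c \<le> m x"
proof -
  have "\<exists>x\<in>UNIV. \<forall>y\<in>UNIV. m x \<le> m y" by (intro continuous_attains_inf compact_torus m_cont) simp
  then show ?thesis using m_pos by blast
qed

definition mlow :: real where "mlow = (SOME c. 0 < c \<and> (\<forall>x. c \<le> m x))"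

lemma mlow: "0 < mlow" "mlow \<le> m x"
  using someI_ex[OF m_low_ex] unfolding mlow_def by auto

lemma HJ: "laplacian (u \<circ> tproj) y + (G y \<bullet> Q y - L (tproj y) (Q y)) = rho + fm (tproj y)"
  using ergodic by (simp add: ergodic_mfg_solution_def CL.hamiltonian_eq G_def Q_def fm_def)

lemma FP: "laplacian (m \<circ> tproj) y = divergence Z y"
proof -
  have "Z = (\<lambda>y. m (tproj y) *\<^sub>R gradient (hamiltonian L (tproj y)) (gradient (u \<circ> tproj) y))"
    by (simp add: Z_def[abs_def] Q_def G_def CL.hamiltonian_gradient)
  then show ?thesis using ergodic by (simp add: ergodic_mfg_solution_def)
qed

lemma density_prob: "density_measure m \<in> borel_prob_measures"
proof -
  have i: "integrable torus_lebesgue m" by (rule integrable_torus[OF m_cont])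
  have [measurable]: "m \<in> borel_measurable torus_lebesgue" using i by simp
  have "prob_space (density_measure m)"
  proof
    have "emeasure (density_measure m) UNIV = (\<integral>\<^sup>+x. ennreal (m x) \<partial>torus_lebesgue)"
      unfolding density_measure_def by (subst emeasure_density) auto
    also have "\<dots> = 1" using nn_integral_eq_integral[OF i] m_pos m_int by (simp add: less_imp_le)
    finally show "emeasure (density_measure m) (space (density_measure m)) = 1" by (simp add: density_measure_def)
  qed
  then show ?thesis by (simp add: borel_prob_measures_def density_measure_def)
qed

lemma density_integral:
  assumes "continuous_on UNIV f"
  shows "(LINT x|density_measure m. f x) = (LINT x|torus_lebesgue. f x * m x)"
proof -
  have "f \<in> borel_measurable torus_lebesgue" "m \<in> borel_measurable torus_lebesgue"
    using integrable_torus[OF assms] integrable_torus[OF m_cont] by simp_all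
  then show ?thesis unfolding density_measure_def
    by (subst integral_density) (auto simp: m_pos less_imp_le mult.commute)
qed

lemma Mt_C: "t > 0 \<Longrightarrow> Mt t \<in> C_set t" and ut_cont: "t > 0 \<Longrightarrow> continuous_on UNIV (ut t)"
  using discrete by (auto simp: discrete_mfg_solution_def)

lemma mu_prob: "t > 0 \<Longrightarrow> Pr1 (Mt t) \<in> borel_prob_measures"
  using C_set_prob[OF Mt_C] by blast

lemma fm_cont: "continuous_on UNIV fm"
  unfolding fm_def by (rule section_continuous_F[OF F_cont density_prob])

lemma Ft_cont: "t > 0 \<Longrightarrow> continuous_on UNIV (Ft t)"
  unfolding Ft_def by (rule section_continuous_F[OF F_cont mu_prob])

lemma G_periodic: "periodic G"
  unfolding G_def by (rule cu.gradient_periodic)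

lemma Q_periodic: "periodic Q"
  unfolding periodic_def
proof (intro allI ballI)
  fix x k :: "real^'n" assume k: "k \<in> int_lattice"
  then have "G (x + k) = G x" using G_periodic by (simp add: periodic_def)
  then show "Q (x + k) = Q x" unfolding Q_def using CL.qs_tproj[OF tproj_lattice[OF k]] by simp
qed

text \<open>\<open>frechet_derivative\<close> is an arbitrary choice where no derivative exists, so
  the divergence in the Fokker-Planck equation can be used as a limit of difference quotients only
  once the flux is known to be differentiable.\<close>

lemma Q_differentiable: "Q differentiable (at y)"
proof -
  have "(\<lambda>y. \<Sum>i\<in>UNIV. G y $ i *\<^sub>R (axis i 1 :: real^'n)) differentiable (at y)"
    unfolding G_def by (intro differentiable_sum ballI differentiable_scaleR cu.pd_diff differentiable_const finite)
  then have "G differentiable (at y)" by (simp add: vec_eq_sum_axis)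
  then obtain G' where G': "(G has_derivative G') (at y)" by (auto simp: differentiable_def)
  obtain q' where q': "((\<lambda>z. CL.qs (fst z) (snd z)) has_derivative q') (at (y, G y))"
    using CL.qs_differentiable by (auto simp: differentiable_def)
  have "((\<lambda>y. (y, G y)) has_derivative (\<lambda>h. (h, G' h))) (at y)" by (intro has_derivative_Pair has_derivative_ident G')
  from has_derivative_compose[OF this q'] have "((\<lambda>y. CL.qs y (G y)) has_derivative (\<lambda>h. q' (h, G' h))) (at y)" by simp
  then have "(\<lambda>y. CL.qs y (G y)) differentiable (at y)" by (rule differentiableI)
  then show ?thesis by (simp add: Q_def[abs_def])
qed

lemma Q_cont: "continuous_on UNIV Q"
  by (intro continuous_at_imp_continuous_on ballI differentiable_imp_continuous_within Q_differentiable)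

lemma Q_bound: obtains R where "0 < R" "\<And>y. norm (Q y) \<le> R"
  by (fact periodic_bounded[OF Q_periodic Q_cont])

lemma Q_lip: obtains K where "0 < K" "\<And>x y. norm (Q x - Q y) \<le> K * norm (x - y)"
proof -
  obtain R where R: "0 < R" "\<And>y. norm (Q y) \<le> R" by (fact Q_bound)
  obtain K where K: "0 < K" "\<And>x y q. norm q \<le> R \<Longrightarrow> norm (CL.Lq x q - CL.Lq y q) \<le> K * norm (x - y)"
    by (fact CL.Lq_lipschitz)
  obtain K' where K': "0 < K'" "\<And>x y. norm (G x - G y) \<le> K' * norm (x - y)"
    unfolding G_def by (fact cu.gradient_lip)
  have "norm (Q x - Q y) \<le> ((K + K') / c0) * norm (x - y)" for x y
  proof -
    have "c0 * norm (Q x - Q y) \<le> norm (CL.Lq y (Q x) - CL.Lq y (Q y))" by (rule CL.Lq_dist)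
    also have "CL.Lq y (Q x) - CL.Lq y (Q y) = (CL.Lq y (Q x) - CL.Lq x (Q x)) + (G x - G y)" by (simp add: Q_def)
    also have "norm \<dots> \<le> norm (CL.Lq y (Q x) - CL.Lq x (Q x)) + norm (G x - G y)" by (rule norm_triangle_ineq)
    also have "\<dots> \<le> K * norm (y - x) + K' * norm (x - y)" by (intro add_mono K(2) K'(2) R)
    also have "\<dots> = (K + K') * norm (x - y)" by (simp add: norm_minus_commute distrib_right)
    finally show ?thesis using c0_pos by (simp add: pos_le_divide_eq mult.commute)
  qed
  then show ?thesis using K(1) K'(1) c0_pos by (intro that[of "(K + K') / c0"]) auto
qed

lemma m_bound: obtains B where "0 < B" "\<And>x. m x \<le> B"
proof -
  obtain B where B: "0 < B" "\<And>x. \<bar>m x\<bar> \<le> B" by (fact torus_continuous_bounded[OF m_cont])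
  have "m x \<le> B" for x using B(2)[of x] by simp
  then show ?thesis by (rule that[OF B(1)])
qed

lemma DM_cont: "continuous_on UNIV DM"
  unfolding DM_def by (rule periodic_descend_continuous[OF cm.laplacian_periodic cm.laplacian_continuous])

lemma DM_tproj: "DM (tproj y) = laplacian (m \<circ> tproj) y"
  unfolding DM_def by (rule periodic_section[OF cm.laplacian_periodic])

text \<open>By the Fokker-Planck equation the continuous divergence demanded by
  \<open>torus_field\<close> is the Laplacian of m. The discrete divergence of m Q and the heat-flow
  increment of m per unit time thus cancel in the limit.\<close>

lemma field: obtains K where "torus_field Z DM K"
proof -
  obtain B where B: "0 < B" "\<And>x. m x \<le> B" by (fact m_bound)
  obtain R where R: "0 < R" "\<And>y. norm (Q y) \<le> R" by (fact Q_bound)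
  obtain KQ where KQ: "0 < KQ" "\<And>x y. norm (Q x - Q y) \<le> KQ * norm (x - y)" by (fact Q_lip)
  obtain Km where Km: "torus_lip Km m" by (fact cm.u_lip)
  have "torus_field Z DM (B * KQ + Km * R)"
  proof
    show "periodic Z" using Q_periodic by (simp add: periodic_def Z_def tproj_lattice)
    show "\<bar>Z x $ i - Z y $ i\<bar> \<le> (B * KQ + Km * R) * norm (x - y)" for x y i
    proof -
      have "Z x $ i - Z y $ i = m (tproj x) * (Q x - Q y) $ i + (m (tproj x) - m (tproj y)) * Q y $ i"
        by (simp add: Z_def algebra_simps)
      also have "\<bar>\<dots>\<bar> \<le> \<bar>m (tproj x)\<bar> * \<bar>(Q x - Q y) $ i\<bar> + \<bar>m (tproj x) - m (tproj y)\<bar> * \<bar>Q y $ i\<bar>"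
        by (rule order_trans[OF abs_triangle_ineq]) (simp add: abs_mult)
      also have "\<dots> \<le> B * (KQ * norm (x - y)) + (Km * norm (x - y)) * R"
      proof (intro add_mono mult_mono)
        show "\<bar>m (tproj x)\<bar> \<le> B" using B(2)[of "tproj x"] m_pos[of "tproj x"] by simp
        show "\<bar>(Q x - Q y) $ i\<bar> \<le> KQ * norm (x - y)" by (rule order_trans[OF component_le_norm_cart KQ(2)])
        show "\<bar>m (tproj x) - m (tproj y)\<bar> \<le> Km * norm (x - y)"
          using torus_lipD[OF Km, of "tproj y" "x - y"] by (simp add: tproj_add[symmetric])
        show "\<bar>Q y $ i\<bar> \<le> R" by (rule order_trans[OF component_le_norm_cart R(2)])
      qed (use B torus_lip_nonneg[OF Km] in auto)
      finally show ?thesis by (simp add: algebra_simps)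
    qed
    show "(\<lambda>y. Z y $ i) differentiable (at y)" for i y
    proof -
      obtain Q' where Q': "(Q has_derivative Q') (at y)" using Q_differentiable by (auto simp: differentiable_def)
      have "((\<lambda>y. Q y \<bullet> axis i 1) has_derivative (\<lambda>h. Q' h \<bullet> axis i 1)) (at y)"
        by (rule has_derivative_inner_left[OF Q'])
      then have "(\<lambda>y. Q y $ i) differentiable (at y)" unfolding inner_axis by (auto intro: differentiableI simp: inner_axis)
      then have "(\<lambda>y. (m \<circ> tproj) y * Q y $ i) differentiable (at y)" by (intro differentiable_mult cm.U_diff)
      then show ?thesis by (simp add: Z_def)
    qed
    show "continuous_on UNIV DM" by (rule DM_cont)
    show "DM (tproj y) = divergence Z y" for y by (simp add: DM_tproj FP)
  qed
  then show ?thesis by (rule that)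
qed

text \<open>The discrete solutions are semiconvex uniformly in t, and subtracting u preserves this
  because a C^2 function has second differences bounded on both sides.\<close>

lemma difference_semiconvex:
  obtains C where "0 \<le> C" "\<And>t. 0 < t \<Longrightarrow> t \<le> 1 \<Longrightarrow> semiconvex C (\<lambda>x. ut t x - u x)"
proof -
  obtain C where C: "0 \<le> C" "semiconvex C (\<lambda>x. - u x)" by (fact cu.neg_semiconvex)
  have "semiconvex (\<bar>k0\<bar> + \<bar>k1\<bar> + \<bar>k2\<bar> + C) (\<lambda>x. ut t x - u x)" if t: "0 < t" "t \<le> 1" for t
  proof -
    have "semiconvex (\<bar>k0\<bar> + \<bar>k1\<bar> + \<bar>k2\<bar>) (ut t)"
      by (rule discrete_mfg_semiconvex[OF discrete[OF t(1)] t CL.L_bounded_below L_second F_second[OF mu_prob[OF t(1)]]])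
    from semiconvex_add[OF this C(2)] show ?thesis by simp
  qed
  then show ?thesis using C(1) by (intro that[of "\<bar>k0\<bar> + \<bar>k1\<bar> + \<bar>k2\<bar> + C"]) auto
qed

lemma difference_cont: "t > 0 \<Longrightarrow> continuous_on UNIV (\<lambda>x. ut t x - u x)"
  by (intro continuous_on_diff ut_cont u_cont)

section \<open>The two energy inequalities\<close>

lemma norm_le_components:
  fixes v :: "real^'n" assumes "\<And>i. \<bar>v $ i\<bar> \<le> R" shows "norm v \<le> real CARD('n) * R"
proof -
  have "norm v \<le> (\<Sum>i\<in>UNIV. \<bar>v $ i\<bar>)" by (rule norm_le_l1_cart)
  also have "\<dots> \<le> real CARD('n) * R" using assms by (intro sum_bounded_above) auto
  finally show ?thesis .
qed

text \<open>The ergodic equation gives a pointwise bound on the Lax competitors of u, valid for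
  every velocity. Integrated against the discrete measure, both sides contain the integral of u,
  which cancels by \<open>C_set_integral\<close>; the second discrete equation converts the integral
  of L into - \<open>rt t\<close> minus the coupling term.\<close>

lemma upper_energy:
  assumes e: "0 < e"
  shows "\<forall>\<^sub>F t in at_right 0. rt t - rho + (LINT x|Pr1 (Mt t). Ft t x - fm x) \<le> e"
proof -
  have e2: "0 < e / 2" using e by simp
  obtain t1 C where t1: "0 < t1" and C: "0 \<le> C" and disp: "\<And>t y v. 0 < t \<Longrightarrow> t < t1 \<Longrightarrow>
     \<bar>heat_conv t u (tproj y + tproj (t *\<^sub>R v)) - u (tproj y) - t * (laplacian (u \<circ> tproj) y + gradient (u \<circ> tproj) y \<bullet> v)\<bar> \<le> t * (e / 2 + C * t * (norm v)\<^sup>2)"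
    using cu.heat_conv_displaced[OF e2, unfolded comp_apply] unfolding comp_def by blast
  obtain R where R: "0 < R" "\<And>y. norm (Q y) \<le> R" by (fact Q_bound)
  \<comment> \<open>Below t2 the part 2 C t |q - Q|^2 of the velocity error fits into the Legendre
    gap; below t3 the part 2 C t R^2 is at most e / 2.\<close>
  define t2 where "t2 = c0 / (4 * (C + 1))"
  define t3 where "t3 = e / (4 * (C + 1) * (R\<^sup>2 + 1))"
  have pos: "0 < t2" "0 < t3" using c0_pos e C by (auto simp: t2_def t3_def intro!: divide_pos_pos mult_pos_pos add_nonneg_pos)
  have "\<forall>\<^sub>F t in at_right 0. 0 < t \<and> t < t1 \<and> t < t2 \<and> t < t3"
    using eventually_at_right_less[of "0::real"] order_tendstoD(2)[OF tendsto_ident_at t1, of "{0<..}"]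
      order_tendstoD(2)[OF tendsto_ident_at pos(1), of "{0<..}"] order_tendstoD(2)[OF tendsto_ident_at pos(2), of "{0<..}"]
    by eventually_elim auto
  then show ?thesis
  proof eventually_elim
    case (elim t)
    then have t: "0 < t" "t < t1" "t < t2" "t < t3" by auto
    have Ct: "2 * C * t \<le> c0 / 2"
    proof -
      have "2 * C * t \<le> 2 * (C + 1) * t2" using t C by (intro mult_mono) auto
      also have "\<dots> = c0 / 2"
      proof -
        have half: "2 * a * (c0 / (4 * a)) = c0 / 2" if "0 < a" for a using that by simp
        show ?thesis unfolding t2_def by (rule half) (use C in simp)
      qed
      finally show ?thesis .
    qed
    have CR: "2 * C * t * R\<^sup>2 \<le> e / 2"
    proof -
      have "2 * C * t * R\<^sup>2 \<le> 2 * (C + 1) * t3 * (R\<^sup>2 + 1)" using t C by (intro mult_mono) auto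
      also have "\<dots> = e / 2"
      proof -
        have half: "2 * a * (e / (4 * a * b)) * b = e / 2" if "0 < a" "0 < b" for a b using that by simp
        show ?thesis unfolding t3_def by (rule half) (use C in \<open>auto intro: add_nonneg_pos\<close>)
      qed
      finally show ?thesis .
    qed
    have pt: "heat_conv t u (x + tproj (t *\<^sub>R q)) - t * L x q \<le> u x + t * (rho + fm x) + t * e" for x q
    proof -
      obtain y where y: "x = tproj y" by (rule tproj_cases)
      have "heat_conv t u (x + tproj (t *\<^sub>R q)) \<le> u x + t * (laplacian (u \<circ> tproj) y + G y \<bullet> q) + t * (e / 2 + C * t * (norm q)\<^sup>2)"
        using disp[OF t(1,2), of y q] unfolding y G_def by linarith
      moreover have "t * (G y \<bullet> q - L x q) \<le> t * (G y \<bullet> Q y - L x (Q y) - c0 / 2 * (norm (q - Q y))\<^sup>2)"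
        using CL.legendre_bound[of "G y" q y] t by (intro mult_left_mono) (auto simp: y Q_def)
      moreover have "C * t * (norm q)\<^sup>2 \<le> c0 / 2 * (norm (q - Q y))\<^sup>2 + e / 2"
      proof -
        have "(norm q)\<^sup>2 \<le> (norm (q - Q y) + R)\<^sup>2"
          using norm_triangle_ineq[of "q - Q y" "Q y"] R(2)[of y] by (intro power_mono) auto
        also have "\<dots> \<le> 2 * (norm (q - Q y))\<^sup>2 + 2 * R\<^sup>2"
          using sum_squares_bound[of "norm (q - Q y)" R] by (simp add: power2_sum)
        finally have "C * t * (norm q)\<^sup>2 \<le> C * t * (2 * (norm (q - Q y))\<^sup>2 + 2 * R\<^sup>2)"
          using C t by (intro mult_left_mono) auto
        also have "\<dots> = 2 * C * t * (norm (q - Q y))\<^sup>2 + 2 * C * t * R\<^sup>2" by (simp add: algebra_simps)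
        also have "\<dots> \<le> c0 / 2 * (norm (q - Q y))\<^sup>2 + e / 2" by (intro add_mono mult_right_mono Ct CR) auto
        finally show ?thesis .
      qed
      then have "t * (C * t * (norm q)\<^sup>2) \<le> t * (c0 / 2 * (norm (q - Q y))\<^sup>2 + e / 2)" using t by (intro mult_left_mono) auto
      moreover have "t * (laplacian (u \<circ> tproj) y + (G y \<bullet> Q y - L x (Q y))) = t * (rho + fm x)" using HJ[of y] by (simp add: y)
      ultimately show ?thesis by (simp add: algebra_simps)
    qed
    note MC = Mt_C[OF t(1)] and P = C_set_prob[OF Mt_C[OF t(1)]]
    interpret M: prob_space "Mt t" by (rule P)
    interpret PR: prob_space "Pr1 (Mt t)" by (rule P)
    note [measurable] = fst_snd_measurable[OF P(2)]
    obtain Ku where Ku: "torus_lip Ku u" by (fact cu.u_lip)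
    have hc: "continuous_on UNIV (heat_conv t u)" by (rule torus_lip_continuous[OF heat_conv_lip[OF t(1) Ku]])
    note [measurable] = continuous_borel[OF hc] continuous_borel[OF u_cont] continuous_borel[OF fm_cont] continuous_borel[OF Ft_cont[OF t(1)]]
    have fst_int: "integrable (Mt t) (\<lambda>p. f (fst p))" if f: "continuous_on UNIV (f :: 'n torus \<Rightarrow> real)" for f
    proof -
      obtain B where "\<And>x. \<bar>f x\<bar> \<le> B" using torus_continuous_bounded[OF f] by metis
      then show ?thesis using continuous_borel[OF f] by (intro M.integrable_const_bound[of _ B]) auto
    qed
    have iL: "integrable (Mt t) (\<lambda>p. L (fst p) (snd p))" and rtL: "- rt t = (LINT p|Mt t. L (fst p) (snd p)) + (LINT x|Pr1 (Mt t). Ft t x)"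
    proof -
      have s: "integrable (Mt t) (\<lambda>p. L (fst p) (snd p) + Ft t (fst p))" "- rt t = (LINT p|Mt t. L (fst p) (snd p) + Ft t (fst p))"
        using discrete[OF t(1)] by (auto simp: discrete_mfg_solution_def split_beta' Ft_def)
      from Bochner_Integration.integrable_diff[OF s(1) fst_int[OF Ft_cont[OF t(1)]]]
      show i: "integrable (Mt t) (\<lambda>p. L (fst p) (snd p))" by simp
      show "- rt t = (LINT p|Mt t. L (fst p) (snd p)) + (LINT x|Pr1 (Mt t). Ft t x)"
        using s(2) Bochner_Integration.integral_add[OF i fst_int[OF Ft_cont[OF t(1)]]] integral_Pr1[OF P(2), of "Ft t"] by simp
    qed
    have ih: "integrable (Mt t) (\<lambda>p. heat_conv t u (fst p + tproj (t *\<^sub>R snd p)))"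
    proof -
      obtain B where B: "\<And>x. \<bar>heat_conv t u x\<bar> \<le> B" using torus_continuous_bounded[OF hc] by metis
      have "(\<lambda>p. heat_conv t u (tproj (torus_section (fst p) + t *\<^sub>R snd p))) \<in> borel_measurable (Mt t)" by measurable
      then have "(\<lambda>p. heat_conv t u (fst p + tproj (t *\<^sub>R snd p))) \<in> borel_measurable (Mt t)" by (simp add: tproj_add)
      then show ?thesis using B by (intro M.integrable_const_bound[of _ B]) auto
    qed
    have iR: "integrable (Mt t) (\<lambda>p. u (fst p) + t * (rho + fm (fst p)) + t * e)"
      by (intro Bochner_Integration.integrable_add integrable_mult_right fst_int u_cont fm_cont) auto
    have "(LINT p|Mt t. heat_conv t u (fst p + tproj (t *\<^sub>R snd p)) - t * L (fst p) (snd p))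
        \<le> (LINT p|Mt t. u (fst p) + t * (rho + fm (fst p)) + t * e)"
      by (rule integral_mono[OF Bochner_Integration.integrable_diff[OF ih integrable_mult_right[OF iL]] iR pt])
    also have "(LINT p|Mt t. heat_conv t u (fst p + tproj (t *\<^sub>R snd p)) - t * L (fst p) (snd p))
      = (LINT x|Pr1 (Mt t). u x) - t * (LINT p|Mt t. L (fst p) (snd p))"
      using Bochner_Integration.integral_diff[OF ih integrable_mult_right[OF iL, of t]] C_set_integral[OF t(1) MC u_cont] by simp
    also have "(LINT p|Mt t. u (fst p) + t * (rho + fm (fst p)) + t * e)
      = (LINT x|Pr1 (Mt t). u x) + t * (rho + (LINT x|Pr1 (Mt t). fm x)) + t * e"
      using fst_int[OF u_cont] fst_int[OF fm_cont] integral_Pr1[OF P(2), of u] integral_Pr1[OF P(2), of fm]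
      by (simp add: M.prob_space[simplified])
    finally have "t * (- (LINT p|Mt t. L (fst p) (snd p))) \<le> t * (rho + (LINT x|Pr1 (Mt t). fm x) + e)"
      by (simp add: algebra_simps)
    then have "- (LINT p|Mt t. L (fst p) (snd p)) \<le> rho + (LINT x|Pr1 (Mt t). fm x) + e"
      by (rule mult_left_le_imp_le) (rule t(1))
    moreover have "(LINT x|Pr1 (Mt t). Ft t x - fm x) = (LINT x|Pr1 (Mt t). Ft t x) - (LINT x|Pr1 (Mt t). fm x)"
      by (intro Bochner_Integration.integral_diff integrable_torus_prob fm_cont Ft_cont t mu_prob)
    ultimately show ?case using rtL by linarith
  qed
qed


text \<open>The duality estimate \<open>heat_transport_lower\<close> is applied to \<open>ut t - u\<close> with the drift
  \<open>Q + \<epsilon> (g / m) e\<^sub>i\<close>. By the Fokker--Planck equation the flux \<open>m Q\<close> contributes only an error, so that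
  the perturbation \<open>\<epsilon> g e\<^sub>i\<close> of the flux is all that remains to first order in \<open>\<epsilon>\<close>.\<close>

lemma lower_energy:
  assumes eps: "0 \<le> \<epsilon>" "\<epsilon> \<le> 1" and e: "0 < e" and Gb: "0 \<le> Gb" and Gd: "0 \<le> Gd"
  shows "\<forall>\<^sub>F t in at_right 0. \<forall>i g. continuous_on UNIV g \<longrightarrow> (\<forall>x. \<bar>g x\<bar> \<le> Gb) \<longrightarrow> (\<forall>x. \<bar>cdiff t i g x\<bar> \<le> Gd) \<longrightarrow>
     - \<epsilon> * (LINT x|torus_lebesgue. (ut t x - u x) * cdiff t i g x)
       \<le> rt t - rho + (LINT x|torus_lebesgue. (Ft t x - fm x) * m x) + \<bar>k2\<bar> / 2 * \<epsilon>\<^sup>2 * (Gb\<^sup>2 / mlow) + e"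
proof -
  let ?N = "real CARD('n)"
  obtain C where C: "0 \<le> C" "\<And>t. 0 < t \<Longrightarrow> t \<le> 1 \<Longrightarrow> semiconvex C (\<lambda>x. ut t x - u x)" by (fact difference_semiconvex)
  obtain B where B: "0 < B" "\<And>x. m x \<le> B" by (fact m_bound)
  obtain R where R: "0 < R" "\<And>y. norm (Q y) \<le> R" by (fact Q_bound)
  obtain K where K: "torus_field Z DM K" by (fact field)
  interpret Z: torus_field Z DM K by (fact K)
  obtain Km where Km: "torus_lip Km m" by (fact cm.u_lip)
  define RV where "RV = R + Gb / mlow"
  define S where "S = ?N * K + Gd"
  \<comment> \<open>Lipschitz constant C N times the bound N on norms in the unit cube: it bounds
    \<open>ut t - u\<close>, which vanishes at x0.\<close>
  define A where "A = C * ?N * ?N"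
  have A0: "0 \<le> A" using C by (simp add: A_def)
  have RV0: "0 \<le> RV" using R Gb mlow by (simp add: RV_def)
  define e1 where "e1 = e / (4 * (A + 1))"
  have e1: "0 < e1" using e A0 by (simp add: e1_def)
  have e1A: "e1 * A \<le> e / 4"
  proof -
    have "e1 * A \<le> e1 * (A + 1)" using e1 by (intro mult_left_mono) auto
    also have "\<dots> = e / 4"
    proof -
      have q: "e / (4 * a) * a = e / 4" if "0 < a" for a using that by simp
      show ?thesis unfolding e1_def by (rule q) (use A0 in simp)
    qed
    finally show ?thesis .
  qed
  have e4: "0 < e / 4" using e by simp
  obtain t1 where t1: "0 < t1" "\<And>t y. 0 < t \<Longrightarrow> t < t1 \<Longrightarrow>
      \<bar>heat_conv t m (tproj y) - m (tproj y) - t * laplacian (m \<circ> tproj) y\<bar> \<le> t * e1"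
    by (fact cm.heat_conv_expansion[OF e1])
  obtain t2 D where t2: "0 < t2" and D: "0 \<le> D" and disp: "\<And>t y v. 0 < t \<Longrightarrow> t < t2 \<Longrightarrow>
     \<bar>heat_conv t u (tproj y + tproj (t *\<^sub>R v)) - u (tproj y) - t * (laplacian (u \<circ> tproj) y + gradient (u \<circ> tproj) y \<bullet> v)\<bar> \<le> t * (e / 4 + D * t * (norm v)\<^sup>2)"
    by (fact cu.heat_conv_displaced[OF e4])
  define I where "I t = (LINT x|torus_lebesgue. \<bar>Z.dZ t x - DM x\<bar>)" for t
  have I: "(I \<longlongrightarrow> 0) (at_right 0)" unfolding I_def by (rule Z.dZ_L1)
  define c1 where "c1 = S * (C * ?N) * (?N + 1)"
  define c2 where "c2 = B * C * ?N * (RV\<^sup>2 + 2 * RV)"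
  define c3 where "c3 = D * (?N * RV)\<^sup>2"
  \<comment> \<open>The total error per unit time. It depends on the perturbation only through Gb
    and Gd, so one threshold for t serves all g at once; later g itself depends on t.\<close>
  define E where "E t = A * I t + e1 * A + c1 * sqrt t + t * c2 + e / 4 + t * c3" for t
  have "(E \<longlongrightarrow> A * 0 + e1 * A + c1 * sqrt 0 + 0 * c2 + e / 4 + 0 * c3) (at_right 0)"
    unfolding E_def by (intro tendsto_intros I)
  then have "\<forall>\<^sub>F t in at_right 0. E t < e" by (rule order_tendstoD(2)) (use e1A e in simp)
  moreover have "\<forall>\<^sub>F t in at_right 0. 0 < t \<and> t < t1 \<and> t < t2 \<and> t < 1"
    using eventually_at_right_less[of "0::real"] order_tendstoD(2)[OF tendsto_ident_at t1(1), of "{0<..}"]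
      order_tendstoD(2)[OF tendsto_ident_at t2, of "{0<..}"] order_tendstoD(2)[OF tendsto_ident_at zero_less_one, of "{0<..}"]
    by eventually_elim auto
  ultimately show ?thesis
  proof eventually_elim
    case (elim t)
    then have Et: "E t < e" and t: "0 < t" "t < t1" "t < t2" "t < 1" by auto
    show ?case
    proof (intro allI impI)
      fix i :: 'n and g :: "'n torus \<Rightarrow> real"
      assume gc: "continuous_on UNIV g" and g: "\<forall>x. \<bar>g x\<bar> \<le> Gb" and gd: "\<forall>x. \<bar>cdiff t i g x\<bar> \<le> Gd"
      define f where "f x = ut t x - u x" for x
      have fs: "semiconvex C f" unfolding f_def using C(2) t by simp
      have fc: "continuous_on UNIV f" unfolding f_def by (rule difference_cont[OF t(1)])
      have fA: "\<bar>f x\<bar> \<le> A" for x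
        using torus_lip_osc[OF semiconvex_lip[OF fs fc C(1)], of x x0] ut0[OF t(1)] u0 by (simp add: f_def A_def)
      define Qs where "Qs x = Q (torus_section x)" for x
      have Qc: "continuous_on UNIV Qs" unfolding Qs_def by (rule periodic_descend_continuous[OF Q_periodic Q_cont])
      define V where "V x = Qs x + (\<epsilon> * g x / m x) *\<^sub>R (axis i 1 :: real^'n)" for x
      have mne: "m x \<noteq> 0" for x using m_pos[of x] by simp
      have Vc: "continuous_on UNIV V" unfolding V_def using mne by (intro continuous_intros Qc gc m_cont) auto
      have gm: "\<bar>\<epsilon> * g x / m x\<bar> \<le> Gb / mlow" for x
      proof -
        have "\<bar>\<epsilon>\<bar> * \<bar>g x\<bar> \<le> 1 * Gb" using eps g by (intro mult_mono) auto
        then have "\<bar>\<epsilon> * g x\<bar> / m x \<le> Gb / mlow" using mlow mlow(2)[of x] m_pos[of x] Gb by (intro frac_le) (auto simp: abs_mult)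
        then show ?thesis using m_pos[of x] by simp
      qed
      have VR: "\<bar>V x $ j\<bar> \<le> RV" for x j
      proof -
        have "\<bar>V x $ j\<bar> \<le> \<bar>Qs x $ j\<bar> + \<bar>\<epsilon> * g x / m x\<bar> * \<bar>(axis i 1 :: real^'n) $ j\<bar>"
          using abs_triangle_ineq[of "Qs x $ j" "\<epsilon> * g x / m x * (axis i 1 :: real^'n) $ j"] by (simp add: V_def abs_mult)
        also have "\<dots> \<le> R + (Gb / mlow) * 1"
        proof (intro add_mono mult_mono gm)
          show "\<bar>Qs x $ j\<bar> \<le> R" unfolding Qs_def by (rule order_trans[OF component_le_norm_cart R(2)])
        qed (use Gb mlow in \<open>auto simp: axis_def\<close>)
        finally show ?thesis by (simp add: RV_def)
      qed
      have W: "V x $ j * m x = Z.Zi j x + (if j = i then \<epsilon> * g x else 0)" for x j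
        using mne[of x] by (auto simp: V_def Z.Zi_def Z_def Qs_def axis_def algebra_simps)
      have cd: "(\<Sum>j\<in>UNIV. cdiff t j (\<lambda>x. V x $ j * m x) x) = Z.dZ t x + \<epsilon> * cdiff t i g x" for x
      proof -
        have "cdiff t j (\<lambda>x. V x $ j * m x) x = cdiff t j (Z.Zi j) x + (if j = i then \<epsilon> * cdiff t i g x else 0)" for j
          unfolding W by (simp add: cdiff_def add_divide_distrib diff_divide_distrib algebra_simps)
        then show ?thesis by (simp add: sum.distrib Z.dZ_def)
      qed
      have cdS: "\<bar>\<Sum>j\<in>UNIV. cdiff t j (\<lambda>x. V x $ j * m x) x\<bar> \<le> S" for x
      proof -
        have "\<bar>\<epsilon> * cdiff t i g x\<bar> \<le> 1 * Gd" unfolding abs_mult using eps gd by (intro mult_mono) auto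
        then show ?thesis unfolding cd S_def using Z.dZ_bound[OF t(1), of x] by linarith
      qed
      have Dm: "\<bar>heat_conv t m x - m x - t * DM x\<bar> \<le> t * e1" for x
      proof -
        obtain y where y: "x = tproj y" by (rule tproj_cases)
        show ?thesis using t1(2)[OF t(1,2), of y] by (simp add: y DM_tproj)
      qed
      have hm: "continuous_on UNIV (heat_conv t m)" by (rule torus_lip_continuous[OF heat_conv_lip[OF t(1) Km]])
      let ?lhs = "LINT x|torus_lebesgue. (heat_conv t f (x + tproj (t *\<^sub>R V x)) - f x) * m x"
      have low: "t * (LINT x|torus_lebesgue. f x * (DM x - (\<Sum>j\<in>UNIV. cdiff t j (\<lambda>x. V x $ j * m x) x)))
          - t * (e1 * A + S * (C * ?N) * (?N + 1) * sqrt t + t * (B * C * ?N * (RV\<^sup>2 + 2 * RV))) \<le> ?lhs"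
        by (rule heat_transport_lower[OF fs fc C(1) fA Vc VR m_cont less_imp_le[OF m_pos] B(2) t(1) DM_cont Dm cdS hm])
      have dZc: "continuous_on UNIV (Z.dZ t)" by (rule Z.dZ_continuous)
      have gdc: "continuous_on UNIV (cdiff t i g)" by (rule continuous_cdiff[OF gc])
      have fsplit: "(LINT x|torus_lebesgue. f x * (DM x - (\<Sum>j\<in>UNIV. cdiff t j (\<lambda>x. V x $ j * m x) x)))
          = (LINT x|torus_lebesgue. f x * (DM x - Z.dZ t x)) - \<epsilon> * (LINT x|torus_lebesgue. f x * cdiff t i g x)"
      proof -
        have "(LINT x|torus_lebesgue. f x * (DM x - (\<Sum>j\<in>UNIV. cdiff t j (\<lambda>x. V x $ j * m x) x)))
          = (LINT x|torus_lebesgue. f x * (DM x - Z.dZ t x) - \<epsilon> * (f x * cdiff t i g x))"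
          unfolding cd by (simp add: algebra_simps)
        also have "\<dots> = (LINT x|torus_lebesgue. f x * (DM x - Z.dZ t x)) - (LINT x|torus_lebesgue. \<epsilon> * (f x * cdiff t i g x))"
          by (intro Bochner_Integration.integral_diff integrable_torus continuous_intros fc DM_cont dZc gdc)
        finally show ?thesis by simp
      qed
      have "- (A * I t) \<le> (LINT x|torus_lebesgue. f x * (DM x - Z.dZ t x))"
      proof -
        have "\<bar>LINT x|torus_lebesgue. f x * (DM x - Z.dZ t x)\<bar> \<le> (LINT x|torus_lebesgue. \<bar>f x * (DM x - Z.dZ t x)\<bar>)"
          by (rule integral_abs_bound)
        also have "\<dots> \<le> (LINT x|torus_lebesgue. A * \<bar>Z.dZ t x - DM x\<bar>)"
        proof (rule integral_mono)
          show "integrable torus_lebesgue (\<lambda>x. \<bar>f x * (DM x - Z.dZ t x)\<bar>)" "integrable torus_lebesgue (\<lambda>x. A * \<bar>Z.dZ t x - DM x\<bar>)"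
            by (intro integrable_torus continuous_intros fc DM_cont dZc)+
          show "\<bar>f x * (DM x - Z.dZ t x)\<bar> \<le> A * \<bar>Z.dZ t x - DM x\<bar>" for x
            unfolding abs_mult by (intro mult_mono fA) (auto simp: A0)
        qed
        also have "\<dots> = A * I t" by (simp add: I_def)
        finally show ?thesis by linarith
      qed
      then have low': "t * (- \<epsilon> * (LINT x|torus_lebesgue. f x * cdiff t i g x) - A * I t) - t * (e1 * A + c1 * sqrt t + t * c2) \<le> ?lhs"
      proof -
        have "t * (- \<epsilon> * (LINT x|torus_lebesgue. f x * cdiff t i g x) - A * I t)
           \<le> t * (LINT x|torus_lebesgue. f x * (DM x - (\<Sum>j\<in>UNIV. cdiff t j (\<lambda>x. V x $ j * m x) x)))"
          unfolding fsplit using \<open>- (A * I t) \<le> _\<close> t(1) by (intro mult_left_mono) auto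
        then show ?thesis using low unfolding c1_def c2_def by linarith
      qed
      let ?b = "\<bar>k2\<bar> / 2 * \<epsilon>\<^sup>2 * (Gb\<^sup>2 / mlow)"
      have pt: "(heat_conv t f (x + tproj (t *\<^sub>R V x)) - f x) * m x
          \<le> t * ((rt t - rho) * m x + (Ft t x - fm x) * m x + ?b + (e / 4 + t * c3) * m x)" for x
      proof -
        define y where "y = torus_section x"
        have xy: "x = tproj y" by (simp add: y_def)
        define d where "d = \<epsilon> * g x / m x"
        have Vx: "V x = Q y + d *\<^sub>R axis i 1" by (simp add: V_def Qs_def y_def d_def)
        obtain b where "\<forall>q. b \<le> L x q" using CL.L_bounded_below by blast
        then have 1: "heat_conv t (ut t) (x + tproj (t *\<^sub>R V x)) - t * L x (V x) \<le> ut t x + t * rt t + t * Ft t x"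
          unfolding Ft_def by (intro discrete_mfg_upper[OF discrete[OF t(1)] t(1)]) blast
        have 2: "u x + t * (laplacian (u \<circ> tproj) y + G y \<bullet> V x) - t * (e / 4 + D * t * (norm (V x))\<^sup>2) \<le> heat_conv t u (x + tproj (t *\<^sub>R V x))"
          using disp[OF t(1,3), of y "V x"] unfolding xy G_def by linarith
        have k2: "L x (q + v) - 2 * L x q + L x (q - v) \<le> k2 * (norm v)\<^sup>2" for x q v
          using L_second[of "torus_section x" 0 q v] by simp
        \<comment> \<open>At the optimal drift the velocity derivative of L equals G y, so the
          first-order cost of the perturbation cancels against G y \<bullet> V x and only k2 / 2 d^2
          remains.\<close>
        have "L x (V x) \<le> L x (Q y) + G y \<bullet> (d *\<^sub>R axis i 1) + k2 / 2 * (norm (d *\<^sub>R axis i 1 :: real^'n))\<^sup>2"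
          using CL.L_upper[OF k2, of y "Q y" "d *\<^sub>R axis i 1"] unfolding Vx by (simp add: Q_def xy[symmetric])
        also have "(norm (d *\<^sub>R axis i 1 :: real^'n))\<^sup>2 = d\<^sup>2" by simp
        finally have "L x (V x) - G y \<bullet> V x \<le> L x (Q y) - G y \<bullet> Q y + k2 / 2 * d\<^sup>2" unfolding Vx by (simp add: inner_add_right)
        then have "t * (L x (V x) - G y \<bullet> V x - laplacian (u \<circ> tproj) y) \<le> t * (k2 / 2 * d\<^sup>2 - rho - fm x)"
          using HJ[of y] t(1) by (intro mult_left_mono) (auto simp: xy)
        moreover have "D * t * (norm (V x))\<^sup>2 \<le> t * c3"
        proof -
          have "(norm (V x))\<^sup>2 \<le> (?N * RV)\<^sup>2" by (intro power_mono norm_le_components VR) auto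
          then have "D * t * (norm (V x))\<^sup>2 \<le> D * t * (?N * RV)\<^sup>2" using D t by (intro mult_left_mono) auto
          then show ?thesis by (simp add: c3_def mult_ac)
        qed
        then have "t * (e / 4 + D * t * (norm (V x))\<^sup>2) \<le> t * (e / 4 + t * c3)" using t by (intro mult_left_mono) auto
        ultimately have "heat_conv t (ut t) (x + tproj (t *\<^sub>R V x)) - heat_conv t u (x + tproj (t *\<^sub>R V x)) - (ut t x - u x)
           \<le> t * (rt t - rho + (Ft t x - fm x) + k2 / 2 * d\<^sup>2 + (e / 4 + t * c3))"
          using 1 2 by (simp add: algebra_simps)
        then have "heat_conv t f (x + tproj (t *\<^sub>R V x)) - f x \<le> t * (rt t - rho + (Ft t x - fm x) + k2 / 2 * d\<^sup>2 + (e / 4 + t * c3))"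
          unfolding f_def heat_conv_diff[OF t(1) ut_cont[OF t(1)] u_cont] .
        \<comment> \<open>Weighting by m turns the cost d^2 into \<epsilon>^2 g^2 / m, which the
          lower bound on m controls.\<close>
        from mult_right_mono[OF this less_imp_le[OF m_pos[of x]]]
        have "(heat_conv t f (x + tproj (t *\<^sub>R V x)) - f x) * m x
           \<le> t * ((rt t - rho) * m x + (Ft t x - fm x) * m x + k2 / 2 * d\<^sup>2 * m x + (e / 4 + t * c3) * m x)"
          by (simp add: algebra_simps)
        also have "\<dots> \<le> t * ((rt t - rho) * m x + (Ft t x - fm x) * m x + ?b + (e / 4 + t * c3) * m x)"
        proof -
          have "k2 / 2 * d\<^sup>2 * m x = k2 / 2 * \<epsilon>\<^sup>2 * ((g x)\<^sup>2 / m x)"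
            using mne[of x] by (simp add: d_def power_divide power_mult_distrib power2_eq_square)
          also have "\<dots> \<le> \<bar>k2\<bar> / 2 * \<epsilon>\<^sup>2 * ((g x)\<^sup>2 / m x)"
            using m_pos[of x] by (intro mult_right_mono) auto
          also have "(g x)\<^sup>2 / m x \<le> Gb\<^sup>2 / mlow"
          proof (rule frac_le)
            show "(g x)\<^sup>2 \<le> Gb\<^sup>2" using g Gb by (metis abs_le_square_iff abs_of_nonneg)
          qed (use mlow in auto)
          then have "\<bar>k2\<bar> / 2 * \<epsilon>\<^sup>2 * ((g x)\<^sup>2 / m x) \<le> ?b" by (intro mult_left_mono) auto
          finally have "k2 / 2 * d\<^sup>2 * m x \<le> ?b" .
          then show ?thesis using t(1) by (intro mult_left_mono) auto
        qed
        finally show ?thesis .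
      qed
      have hfc: "continuous_on UNIV (heat_conv t f)"
        by (rule torus_lip_continuous[OF heat_conv_lip[OF t(1) semiconvex_lip[OF fs fc C(1)]]])
      note Fc = Ft_cont[OF t(1)]
      interpret T: prob_space "torus_lebesgue :: 'n torus measure" by (rule prob_space_torus_lebesgue)
      have "?lhs \<le> (LINT x|torus_lebesgue. t * ((rt t - rho) * m x + (Ft t x - fm x) * m x + ?b + (e / 4 + t * c3) * m x))"
      proof (rule integral_mono[OF _ _ pt])
        show "integrable torus_lebesgue (\<lambda>x. (heat_conv t f (x + tproj (t *\<^sub>R V x)) - f x) * m x)"
          by (intro integrable_torus continuous_intros continuous_torus_displace hfc Vc fc m_cont)
        show "integrable torus_lebesgue (\<lambda>x. t * ((rt t - rho) * m x + (Ft t x - fm x) * m x + ?b + (e / 4 + t * c3) * m x))"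
          by (intro integrable_torus continuous_intros Fc fm_cont m_cont)
      qed
      also have "\<dots> = t * (rt t - rho + (LINT x|torus_lebesgue. (Ft t x - fm x) * m x) + ?b + (e / 4 + t * c3))"
      proof -
        have i1: "integrable torus_lebesgue m" and i2: "integrable torus_lebesgue (\<lambda>x. (Ft t x - fm x) * m x)"
          by (intro integrable_torus continuous_intros Fc fm_cont m_cont)+
        have "(LINT x|torus_lebesgue. (rt t - rho) * m x + (Ft t x - fm x) * m x + ?b + (e / 4 + t * c3) * m x)
           = (rt t - rho) * (LINT x|torus_lebesgue. m x) + (LINT x|torus_lebesgue. (Ft t x - fm x) * m x) + ?b + (e / 4 + t * c3) * (LINT x|torus_lebesgue. m x)"
          using i1 i2 by (simp add: T.prob_space[simplified] del: distrib_right)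
        then show ?thesis by (simp add: m_int)
      qed
      finally have "t * (- \<epsilon> * (LINT x|torus_lebesgue. f x * cdiff t i g x) - A * I t - (e1 * A + c1 * sqrt t + t * c2))
         \<le> t * (rt t - rho + (LINT x|torus_lebesgue. (Ft t x - fm x) * m x) + ?b + (e / 4 + t * c3))"
        using low' by (simp add: right_diff_distrib)
      then have "- \<epsilon> * (LINT x|torus_lebesgue. f x * cdiff t i g x) - A * I t - (e1 * A + c1 * sqrt t + t * c2)
         \<le> rt t - rho + (LINT x|torus_lebesgue. (Ft t x - fm x) * m x) + ?b + (e / 4 + t * c3)"
        by (rule mult_left_le_imp_le) (rule t(1))
      then show "- \<epsilon> * (LINT x|torus_lebesgue. (ut t x - u x) * cdiff t i g x)
        \<le> rt t - rho + (LINT x|torus_lebesgue. (Ft t x - fm x) * m x) + ?b + e"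
        using Et unfolding E_def f_def by linarith
    qed
  qed
qed

lemma lower_energy0:
  assumes e: "0 < e"
  shows "\<forall>\<^sub>F t in at_right 0. 0 \<le> rt t - rho + (LINT x|density_measure m. Ft t x - fm x) + e"
proof -
  from lower_energy[OF order_refl zero_le_one e order_refl order_refl] eventually_at_right_less[of "0::real"]
  show ?thesis
  proof eventually_elim
    case (elim t)
    then have t: "0 < t" by simp
    have "continuous_on UNIV (\<lambda>x. Ft t x - fm x)" by (intro continuous_on_diff Ft_cont fm_cont t)
    from density_integral[OF this] show ?case
      using elim(1)[rule_format, where g="\<lambda>_. 0"] by (simp add: cdiff_def)
  qed
qed

subsection \<open>Convergence of the measures\<close>

lemma monotonicity_defect:
  assumes e: "0 < e"
  shows "\<forall>\<^sub>F t in at_right 0. (LINT x|Pr1 (Mt t). Ft t x - fm x) - (LINT x|density_measure m. Ft t x - fm x) \<le> e"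
proof -
  have e2: "0 < e / 2" using e by simp
  show ?thesis using upper_energy[OF e2] lower_energy0[OF e2] by eventually_elim linarith
qed

text \<open>A sequence staying away from the limit would have a weak cluster point N. There the
  defect of monotonicity is nonpositive, while strict monotonicity makes it positive unless N is the
  density measure.\<close>

lemma measure_convergence_seq:
  assumes X: "\<And>k. 0 < X k" "X \<longlonglongrightarrow> 0" and phi: "continuous_on UNIV (\<phi> :: 'n torus \<Rightarrow> real)"
  shows "(\<lambda>k. LINT x|Pr1 (Mt (X k)). \<phi> x) \<longlonglongrightarrow> (LINT x|density_measure m. \<phi> x)"
proof (rule ccontr)
  let ?nu = "density_measure m"
  let ?I = "\<lambda>k. LINT x|Pr1 (Mt (X k)). \<phi> x"
  assume "\<not> ?I \<longlonglongrightarrow> (LINT x|?nu. \<phi> x)"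
  then obtain e where e: "0 < e" and "\<not> (\<forall>\<^sub>F k in sequentially. dist (?I k) (LINT x|?nu. \<phi> x) < e)"
    unfolding tendsto_iff by blast
  then have "\<forall>N. \<exists>k\<ge>N. e \<le> dist (?I k) (LINT x|?nu. \<phi> x)" unfolding eventually_sequentially by (simp add: not_less)
  then have inf: "infinite {k. e \<le> dist (?I k) (LINT x|?nu. \<phi> x)}" unfolding infinite_nat_iff_unbounded_le by blast
  define s where "s = enumerate {k. e \<le> dist (?I k) (LINT x|?nu. \<phi> x)}"
  have s: "strict_mono s" unfolding s_def by (rule strict_mono_enumerate[OF inf])
  have bad: "e \<le> dist (?I (s k)) (LINT x|?nu. \<phi> x)" for k
    using enumerate_in_set[OF inf, of k] by (simp add: s_def)
  obtain r N where r: "strict_mono r" and N: "N \<in> borel_prob_measures"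
    and lim: "\<And>\<phi> :: 'n torus \<Rightarrow> real. continuous_on UNIV \<phi> \<Longrightarrow> (\<lambda>k. LINT x|Pr1 (Mt (X (s (r k)))). \<phi> x) \<longlonglongrightarrow> (LINT x|N. \<phi> x)"
    using torus_prob_compact[of "\<lambda>k. Pr1 (Mt (X (s k)))"] mu_prob[OF X(1)] by metis
  define Y where "Y k = X (s (r k))" for k
  have Y: "0 < Y k" "filterlim Y (at_right 0) sequentially" for k
  proof -
    show "0 < Y k" for k by (simp add: Y_def X(1))
    have "Y \<longlonglongrightarrow> 0" unfolding Y_def
      using LIMSEQ_subseq_LIMSEQ[OF X(2) strict_mono_o[OF s r]] by (simp add: o_def)
    then show "filterlim Y (at_right 0) sequentially"
      unfolding filterlim_at using \<open>\<And>k. 0 < Y k\<close> by (auto intro!: always_eventually simp: less_imp_neq[symmetric])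
  qed
  define h where "h x = F x N - fm x" for x
  have hc: "continuous_on UNIV h" unfolding h_def by (intro continuous_on_diff fm_cont section_continuous_F[OF F_cont N])
  have weak: "limitin weak_topology (\<lambda>k. Pr1 (Mt (Y k))) N sequentially"
    by (rule limitin_weak_topologyI[OF N]) (use lim mu_prob[OF Y(1)] in \<open>auto simp: Y_def\<close>)
  have "(LINT x|N. h x) - (LINT x|?nu. h x) \<le> 0"
  proof (rule field_le_epsilon)
    fix d :: real assume d: "0 < d"
    \<comment> \<open>Four errors of size d / 4: the weak limit of the integral of h, the
      monotonicity defect, and the replacement of the moving coupling by F at N under each of the
      two measures.\<close>
    have d4: "0 < d / 4" using d by simp
    have "\<forall>\<^sub>F k in sequentially. \<bar>(LINT x|Pr1 (Mt (Y k)). h x) - (LINT x|N. h x)\<bar> < d / 4"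
      using tendstoD[OF lim[OF hc] d4] by (simp add: Y_def dist_real_def)
    moreover have "\<forall>\<^sub>F k in sequentially. (LINT x|Pr1 (Mt (Y k)). Ft (Y k) x - fm x) - (LINT x|?nu. Ft (Y k) x - fm x) \<le> d / 4"
      using filterlim_iff[THEN iffD1, OF Y(2)] monotonicity_defect[OF d4] by blast
    ultimately have "\<forall>\<^sub>F k in sequentially. (LINT x|N. h x) - (LINT x|?nu. h x) \<le> 0 + d"
      using weak_limit_uniform[OF F_cont weak d4]
    proof eventually_elim
      case (elim k)
      have cl: "\<bar>(LINT x|P. Ft (Y k) x - fm x) - (LINT x|P. h x)\<bar> \<le> d / 4" if P: "P \<in> borel_prob_measures" for P
      proof -
        interpret prob_space P using P by (simp add: borel_prob_measures_def)
        have c: "continuous_on UNIV (\<lambda>x. Ft (Y k) x - fm x)" by (intro continuous_on_diff Ft_cont fm_cont Y(1))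
        have "(LINT x|P. Ft (Y k) x - fm x) - (LINT x|P. h x) = (LINT x|P. (Ft (Y k) x - fm x) - h x)"
          by (rule Bochner_Integration.integral_diff[symmetric]) (intro integrable_torus_prob c hc P)+
        also have "\<bar>\<dots>\<bar> \<le> (LINT x|P. \<bar>(Ft (Y k) x - fm x) - h x\<bar>)" by (rule integral_abs_bound)
        also have "\<dots> \<le> (LINT x|P. d / 4)"
        proof (rule integral_mono)
          show "integrable P (\<lambda>x. \<bar>(Ft (Y k) x - fm x) - h x\<bar>)"
            by (intro integrable_torus_prob continuous_intros c hc P Ft_cont Y(1) fm_cont)
          show "\<bar>(Ft (Y k) x - fm x) - h x\<bar> \<le> d / 4" for x
            using elim(3)[rule_format, of x] by (simp add: Ft_def h_def less_imp_le)
        qed simp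
        also have "\<dots> = d / 4" by (simp add: prob_space)
        finally show ?thesis .
      qed
      show ?case using cl[OF mu_prob[OF Y(1)], of k] cl[OF density_prob] elim(1,2) by linarith
    qed
    then show "(LINT x|N. h x) - (LINT x|?nu. h x) \<le> 0 + d" by simp
  qed
  then have "N = ?nu"
    using F_mono[OF N density_prob] unfolding h_def fm_def by force
  then have "(\<lambda>k. ?I (s (r k))) \<longlonglongrightarrow> (LINT x|?nu. \<phi> x)" using lim[OF phi] by simp
  from tendstoD[OF this e] obtain k where "dist (?I (s (r k))) (LINT x|?nu. \<phi> x) < e"
    unfolding eventually_sequentially by blast
  then show False using bad[of "r k"] by simp
qed

lemma measure_convergence: "limitin weak_topology (\<lambda>t. Pr1 (Mt t)) (density_measure m) (at_right 0)"
proof (rule limitin_weak_topologyI[OF density_prob])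
  show "\<forall>\<^sub>F t in at_right 0. Pr1 (Mt t) \<in> borel_prob_measures"
    using eventually_at_right_less[of "0::real"] by (rule eventually_mono) (rule mu_prob)
  fix \<phi> :: "'n torus \<Rightarrow> real" assume phi: "continuous_on UNIV \<phi>"
  show "((\<lambda>t. LINT x|Pr1 (Mt t). \<phi> x) \<longlongrightarrow> (LINT x|density_measure m. \<phi> x)) (at_right 0)"
    unfolding tendsto_at_iff_sequentially
  proof (intro allI impI)
    fix X :: "nat \<Rightarrow> real" assume X: "\<forall>i. X i \<in> {0<..} - {0}" "X \<longlonglongrightarrow> 0"
    have "0 < X k" for k using X(1)[rule_format, of k] by simp
    from measure_convergence_seq[OF this X(2) phi]
    show "((\<lambda>t. LINT x|Pr1 (Mt t). \<phi> x) \<circ> X) \<longlonglongrightarrow> (LINT x|density_measure m. \<phi> x)" by (simp add: o_def)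
  qed
qed

lemma F_uniform:
  assumes "0 < e" shows "\<forall>\<^sub>F t in at_right 0. \<forall>x. \<bar>Ft t x - fm x\<bar> < e"
  using weak_limit_uniform[OF F_cont measure_convergence assms] by (simp add: Ft_def fm_def)

lemma coupling_small:
  assumes t: "0 < t" and P: "P \<in> borel_prob_measures" and e: "\<And>x. \<bar>Ft t x - fm x\<bar> < e"
  shows "\<bar>LINT x|P. Ft t x - fm x\<bar> \<le> e"
proof -
  interpret prob_space P using P by (simp add: borel_prob_measures_def)
  have c: "continuous_on UNIV (\<lambda>x. Ft t x - fm x)" by (intro continuous_on_diff Ft_cont fm_cont t)
  have "\<bar>LINT x|P. Ft t x - fm x\<bar> \<le> (LINT x|P. \<bar>Ft t x - fm x\<bar>)" by (rule integral_abs_bound)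
  also have "\<dots> \<le> (LINT x|P. e)"
  proof (rule integral_mono)
    show "integrable P (\<lambda>x. \<bar>Ft t x - fm x\<bar>)" by (intro integrable_abs integrable_torus_prob c P)
  qed (use e in \<open>auto intro: less_imp_le\<close>)
  also have "\<dots> = e" by (simp add: prob_space)
  finally show ?thesis .
qed

text \<open>Once the measures converge, the couplings are uniformly close, so their difference has
  small integral against either measure and the two energy inequalities bound
  \<open>rt t - rho\<close> from both sides.\<close>

lemma rho_close:
  assumes e: "0 < e" shows "\<forall>\<^sub>F t in at_right 0. \<bar>rt t - rho\<bar> \<le> e"
proof -
  have e2: "0 < e / 2" using e by simp
  show ?thesis
    using upper_energy[OF e2] lower_energy0[OF e2] F_uniform[OF e2] eventually_at_right_less[of "0::real"]
  proof eventually_elim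
    case (elim t)
    then show ?case
      using coupling_small[OF elim(4) mu_prob[OF elim(4)] elim(3)[rule_format]]
        coupling_small[OF elim(4) density_prob elim(3)[rule_format]]
      by linarith
  qed
qed

lemma rho_convergence: "(rt \<longlongrightarrow> rho) (at_right 0)"
proof (rule tendstoI)
  fix e :: real assume "0 < e"
  then have "0 < e / 2" by simp
  from rho_close[OF this] show "\<forall>\<^sub>F t in at_right 0. dist (rt t) rho < e"
    by (rule eventually_mono) (use \<open>0 < e\<close> in \<open>simp add: dist_real_def\<close>)
qed


subsection \<open>Convergence of the value functions\<close>

text \<open>For \<open>g = discrete_primitive t i n f\<close> the centred difference of \<open>g\<close> is the increment of \<open>f\<close> along
  \<open>2 n t e\<^sub>i\<close>, and translation invariance turns \<open>- \<integral> f (cdiff t i g)\<close> into half the mean square of this increment.\<close>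

lemma difference_increment_square:
  assumes d: "0 < d"
  shows "\<forall>\<^sub>F t in at_right 0. \<forall>i n. real (2 * n) * t \<le> 1 \<longrightarrow>
    (LINT x|torus_lebesgue. ((ut t (x + tstep (real (2 * n) * t) i) - u (x + tstep (real (2 * n) * t) i)) - (ut t x - u x))\<^sup>2) \<le> d"
proof -
  let ?N = "real CARD('n)"
  obtain C where C: "0 \<le> C" "\<And>t. 0 < t \<Longrightarrow> t \<le> 1 \<Longrightarrow> semiconvex C (\<lambda>x. ut t x - u x)" by (fact difference_semiconvex)
  define A where "A = C * ?N * ?N"
  have A0: "0 \<le> A" using C by (simp add: A_def)
  define B where "B = \<bar>k2\<bar> / 2 * (A\<^sup>2 / mlow)"
  have B0: "0 \<le> B" using mlow(1) by (simp add: B_def)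
  \<comment> \<open>The quadratic cost \<epsilon>^2 B becomes at most \<epsilon> d / 8. The
    remaining three errors get e = \<epsilon> d / 16 each, so that after division by \<epsilon> the
    total stays below d / 2.\<close>
  define \<epsilon> where "\<epsilon> = min 1 (d / (8 * (B + 1)))"
  have eps: "0 < \<epsilon>" "\<epsilon> \<le> 1" using d B0 by (auto simp: \<epsilon>_def)
  have epsB: "\<epsilon>\<^sup>2 * B \<le> \<epsilon> * (d / 8)"
  proof -
    have "\<epsilon> * B \<le> d / (8 * (B + 1)) * (B + 1)" using B0 d by (intro mult_mono) (auto simp: \<epsilon>_def)
    also have "\<dots> = d / 8"
    proof -
      have q: "d / (8 * a) * a = d / 8" if "0 < a" for a using that by simp
      show ?thesis by (rule q) (use B0 in simp)
    qed
    finally have "\<epsilon> * (\<epsilon> * B) \<le> \<epsilon> * (d / 8)" using eps by (intro mult_left_mono) auto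
    then show ?thesis by (simp add: power2_eq_square mult.assoc)
  qed
  define e where "e = \<epsilon> * (d / 16)"
  have e: "0 < e" using eps d by (simp add: e_def)
  have A2: "0 \<le> 2 * A" using A0 by simp
  have "\<forall>\<^sub>F t in at_right 0. t < (1::real)"
    by (rule order_tendstoD(2)[OF tendsto_ident_at zero_less_one])
  then show ?thesis
    using lower_energy[OF less_imp_le[OF eps(1)] eps(2) e A0 A2] rho_close[OF e] F_uniform[OF e] eventually_at_right_less[of "0::real"]
  proof eventually_elim
    case (elim t)
    then have t: "0 < t" "t < 1" by auto
    show ?case
    proof (intro allI impI)
      fix i :: 'n and n :: nat assume n: "real (2 * n) * t \<le> 1"
      define f where "f x = ut t x - u x" for x
      have fc: "continuous_on UNIV f" unfolding f_def by (rule difference_cont[OF t(1)])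
      have fs: "semiconvex C f" unfolding f_def using C(2) t by simp
      have fA: "\<bar>f x\<bar> \<le> A" for x
        using torus_lip_osc[OF semiconvex_lip[OF fs fc C(1)], of x x0] ut0[OF t(1)] u0 by (simp add: f_def A_def)
      let ?a = "tstep (real (2 * n) * t) i :: 'n torus"
      let ?g = "discrete_primitive t i n f"
      have g: "continuous_on UNIV ?g" "\<forall>x. \<bar>?g x\<bar> \<le> A" "\<forall>x. \<bar>cdiff t i ?g x\<bar> \<le> 2 * A"
      proof -
        show "continuous_on UNIV ?g" by (rule continuous_discrete_primitive[OF fc])
        show "\<forall>x. \<bar>?g x\<bar> \<le> A" proof
          fix x show "\<bar>?g x\<bar> \<le> A" by (rule discrete_primitive_bound[where f=f, OF fA less_imp_le[OF t(1)] n])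
        qed
        show "\<forall>x. \<bar>cdiff t i ?g x\<bar> \<le> 2 * A"
        proof
          fix x
          show "\<bar>cdiff t i ?g x\<bar> \<le> 2 * A"
            using cdiff_discrete_primitive[of t i n f x] fA[of "x + ?a"] fA[of x] t by (simp add: abs_le_iff)
        qed
      qed
      have main: "- \<epsilon> * (LINT x|torus_lebesgue. f x * cdiff t i ?g x)
          \<le> rt t - rho + (LINT x|torus_lebesgue. (Ft t x - fm x) * m x) + \<bar>k2\<bar> / 2 * \<epsilon>\<^sup>2 * (A\<^sup>2 / mlow) + e"
        unfolding f_def[abs_def] using elim(2) g unfolding f_def[abs_def] by blast
      have cF: "continuous_on UNIV (\<lambda>x. Ft t x - fm x)" by (intro continuous_on_diff Ft_cont fm_cont t)
      have b1: "(LINT x|torus_lebesgue. (Ft t x - fm x) * m x) \<le> e"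
        using coupling_small[OF t(1) density_prob elim(4)[rule_format]] unfolding density_integral[OF cF] by linarith
      have b2: "rt t - rho \<le> e" using elim(3) by linarith
      have b3: "\<bar>k2\<bar> / 2 * \<epsilon>\<^sup>2 * (A\<^sup>2 / mlow) \<le> \<epsilon> * (d / 8)" using epsB by (simp add: B_def mult_ac)
      have "\<epsilon> * (- (LINT x|torus_lebesgue. f x * cdiff t i ?g x)) \<le> \<epsilon> * (d / 2)"
        proof -
        have p: "0 \<le> \<epsilon> * d" using eps d by simp
        have q: "\<epsilon> * (- (LINT x|torus_lebesgue. f x * cdiff t i ?g x)) = - \<epsilon> * (LINT x|torus_lebesgue. f x * cdiff t i ?g x)"
          "\<epsilon> * (d / 8) = (\<epsilon> * d) / 8" "\<epsilon> * (d / 2) = (\<epsilon> * d) / 2" "e = (\<epsilon> * d) / 16"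
          by (simp_all add: e_def)
        from main b1 b2 b3 p show ?thesis unfolding q by linarith
      qed
      then have small: "- (LINT x|torus_lebesgue. f x * cdiff t i ?g x) \<le> d / 2"
        by (rule mult_left_le_imp_le) (rule eps(1))
      have cs: "continuous_on UNIV (\<lambda>x. f (x + ?a))" by (rule continuous_torus_shift[OF fc])
      have sq: "(LINT x|torus_lebesgue. (f (x + ?a))\<^sup>2) = (LINT x|torus_lebesgue. (f x)\<^sup>2)"
        using integral_torus_shift[of "\<lambda>x. (f x)\<^sup>2" ?a] by (simp add: continuous_borel continuous_on_power fc)
      have i1: "integrable torus_lebesgue (\<lambda>x. (f (x + ?a))\<^sup>2)" "integrable torus_lebesgue (\<lambda>x. (f x)\<^sup>2)" "integrable torus_lebesgue (\<lambda>x. f x * f (x + ?a))"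
        by (intro integrable_torus continuous_intros cs fc)+
      have "(LINT x|torus_lebesgue. (f (x + ?a) - f x)\<^sup>2) = (LINT x|torus_lebesgue. ((f (x + ?a))\<^sup>2 + (f x)\<^sup>2) - 2 * (f x * f (x + ?a)))"
        by (intro Bochner_Integration.integral_cong refl) (simp add: power2_eq_square algebra_simps)
      also have "\<dots> = 2 * ((LINT x|torus_lebesgue. (f x)\<^sup>2) - (LINT x|torus_lebesgue. f x * f (x + ?a)))"
        using i1 sq by simp
      also have "(LINT x|torus_lebesgue. (f x)\<^sup>2) - (LINT x|torus_lebesgue. f x * f (x + ?a)) = - (LINT x|torus_lebesgue. f x * cdiff t i ?g x)"
      proof -
        have "(LINT x|torus_lebesgue. f x * cdiff t i ?g x) = (LINT x|torus_lebesgue. f x * f (x + ?a) - (f x)\<^sup>2)"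
          using t by (intro Bochner_Integration.integral_cong refl) (simp add: cdiff_discrete_primitive power2_eq_square algebra_simps)
        also have "\<dots> = (LINT x|torus_lebesgue. f x * f (x + ?a)) - (LINT x|torus_lebesgue. (f x)\<^sup>2)"
          by (rule Bochner_Integration.integral_diff[OF i1(3,2)])
        finally show ?thesis by simp
      qed
      finally have "(LINT x|torus_lebesgue. (f (x + ?a) - f x)\<^sup>2) \<le> d" using small by simp
      then show "(LINT x|torus_lebesgue. ((ut t (x + ?a) - u (x + ?a)) - (ut t x - u x))\<^sup>2) \<le> d"
        unfolding f_def .
    qed
  qed
qed

text \<open>Starting from x0, where the difference vanishes, each point is reached by at most one
  step of length up to 1 along each axis. A step is a multiple of 2 t, handled by the mean-square
  estimate and \<open>torus_lip_sup_small\<close>, followed by a rest shorter than 2 t, handled by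
  the Lipschitz bound. With a = e / (2 N) the N steps cost 2 a each and e in all. The constant K + K
  is the Lipschitz constant of an increment of f.\<close>

lemma difference_small:
  assumes e: "0 < e"
  shows "\<forall>\<^sub>F t in at_right 0. \<forall>x. \<bar>ut t x - u x\<bar> \<le> e"
proof -
  let ?N = "real CARD('n)"
  obtain C where C: "0 \<le> C" "\<And>t. 0 < t \<Longrightarrow> t \<le> 1 \<Longrightarrow> semiconvex C (\<lambda>x. ut t x - u x)" by (fact difference_semiconvex)
  define K where "K = C * ?N"
  have K0: "0 \<le> K" "0 \<le> K + K" using C by (auto simp: K_def)
  have N: "0 < ?N" by simp
  define a where "a = e / (2 * ?N)"
  have a: "0 < a" using e by (simp add: a_def)
  obtain d where d: "0 < d" "\<And>G x. torus_lip (K + K) (G :: 'n torus \<Rightarrow> real) \<Longrightarrow>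
     (LINT x|torus_lebesgue. (G x)\<^sup>2) \<le> d \<Longrightarrow> \<bar>G x\<bar> \<le> a"
    by (fact torus_lip_sup_small[OF a K0(2)])
  define t3 where "t3 = a / (2 * (K + 1))"
  have t3: "0 < t3" using a K0 by (simp add: t3_def)
  have "\<forall>\<^sub>F t in at_right 0. t < (1::real)" "\<forall>\<^sub>F t in at_right 0. t < t3"
    by (rule order_tendstoD(2)[OF tendsto_ident_at zero_less_one], rule order_tendstoD(2)[OF tendsto_ident_at t3])
  then show ?thesis
    using difference_increment_square[OF d(1)] eventually_at_right_less[of "0::real"]
  proof eventually_elim
    case (elim t)
    then have t: "0 < t" "t < 1" "t < t3" by auto
    define f where "f x = ut t x - u x" for x
    have fc: "continuous_on UNIV f" unfolding f_def by (rule difference_cont[OF t(1)])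
    have fs: "semiconvex C f" unfolding f_def using C(2) t by simp
    have fl: "torus_lip K f" unfolding K_def by (rule semiconvex_lip[OF fs fc C(1)])
    have Kt: "K * (2 * t) \<le> a"
    proof -
      have "K * (2 * t) \<le> (K + 1) * (2 * t3)" using t K0 by (intro mult_mono) auto
      also have "\<dots> = a"
      proof -
        have q: "c * (2 * (a / (2 * c))) = a" if "0 < c" for c using that by simp
        show ?thesis unfolding t3_def by (rule q) (use K0 in simp)
      qed
      finally show ?thesis .
    qed
    have step: "\<bar>f (y + tstep s i) - f y\<bar> \<le> a + a" if s: "0 \<le> s" "s \<le> 1" for y s i
    proof -
      \<comment> \<open>The number of whole steps of length 2 t in s; rounding down keeps the total
        length at most 1, as the mean-square estimate requires.\<close>
      define n where "n = nat \<lfloor>s / (2 * t)\<rfloor>"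
      have "0 \<le> s / (2 * t)" using s t by simp
      then have nn: "real n \<le> s / (2 * t)" "s / (2 * t) < real n + 1" unfolding n_def by linarith+
      then have n: "real (2 * n) * t \<le> s" "s < real (2 * n) * t + 2 * t"
        using t(1) by (simp_all add: pos_le_divide_eq pos_divide_less_eq algebra_simps)
      let ?b = "tstep (real (2 * n) * t) i :: 'n torus"
      have "\<bar>f (y + ?b) - f y\<bar> \<le> a"
      proof (rule d(2)[of "\<lambda>x. f (x + ?b) - f x"])
        show "torus_lip (K + K) (\<lambda>x. f (x + ?b) - f x)"
          unfolding torus_lip_def
        proof (intro allI)
          fix x and h :: "real^'n"
          show "\<bar>f (x + tproj h + ?b) - f (x + tproj h) - (f (x + ?b) - f x)\<bar> \<le> (K + K) * norm h"
            using torus_lipD[OF fl, of "x + ?b" h] torus_lipD[OF fl, of x h] by (simp add: add_ac distrib_right abs_le_iff)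
        qed
        show "(LINT x|torus_lebesgue. (f (x + ?b) - f x)\<^sup>2) \<le> d"
          unfolding f_def using elim(3) n(1) s(2) order_trans by blast
      qed
      moreover have "\<bar>f (y + tstep s i) - f (y + ?b)\<bar> \<le> a"
      proof -
        have "tstep s i = ?b + tproj ((s - real (2 * n) * t) *\<^sub>R axis i 1)"
          using tstep_add[of "real (2 * n) * t" "s - real (2 * n) * t" i] by (simp add: tstep_def)
        then have "\<bar>f (y + tstep s i) - f (y + ?b)\<bar> \<le> K * \<bar>s - real (2 * n) * t\<bar>"
          using torus_lipD[OF fl, of "y + ?b" "(s - real (2 * n) * t) *\<^sub>R axis i 1"] by (simp add: add.assoc)
        also have "\<dots> \<le> K * (2 * t)" using n K0 by (intro mult_left_mono) auto
        finally show ?thesis using Kt by linarith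
      qed
      ultimately show ?thesis by linarith
    qed
    have path: "\<bar>f (x0 + tproj (\<Sum>i\<in>J. h $ i *\<^sub>R axis i 1)) - f x0\<bar> \<le> real (card J) * (a + a)"
      if h: "h \<in> unit_cube" for J :: "'n set" and h :: "real^'n"
    proof -
      have "finite J" by simp
      then show ?thesis
      proof (induction J rule: finite_induct)
        case (insert j J)
        let ?y = "x0 + tproj (\<Sum>i\<in>J. h $ i *\<^sub>R axis i 1)"
        have "0 \<le> h $ j" "h $ j \<le> 1" using h by (auto simp: unit_cube_def less_imp_le)
        from step[OF this, of ?y j] have "\<bar>f (?y + tstep (h $ j) j) - f ?y\<bar> \<le> a + a" .
        moreover have eq: "x0 + tproj (\<Sum>i\<in>insert j J. h $ i *\<^sub>R axis i 1) = ?y + tstep (h $ j) j"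
          using insert(1,2) by (simp add: tproj_add tstep_def add_ac)
        ultimately have "\<bar>f (x0 + tproj (\<Sum>i\<in>insert j J. h $ i *\<^sub>R axis i 1)) - f x0\<bar> \<le> real (card J) * (a + a) + (a + a)"
          unfolding eq using insert.IH by linarith
        then show ?case using insert(1,2) by (simp add: distrib_right)
      qed simp
    qed
    show "\<forall>x. \<bar>ut t x - u x\<bar> \<le> e"
    proof
      fix x
      have "\<bar>f (x0 + tproj (torus_section (x - x0))) - f x0\<bar> \<le> ?N * (a + a)"
        using path[OF section_in_cube, of "x - x0" UNIV] by (simp add: vec_eq_sum_axis)
      moreover have "f x0 = 0" using ut0[OF t(1)] u0 by (simp add: f_def)
      moreover have "?N * (a + a) = e" by (simp add: a_def)
      ultimately show "\<bar>ut t x - u x\<bar> \<le> e" by (simp add: f_def)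
    qed
  qed
qed

lemma value_convergence: "uniform_limit UNIV ut u (at_right 0)"
proof (rule uniform_limitI)
  fix e :: real assume "0 < e"
  then have "0 < e / 2" by simp
  from difference_small[OF this] show "\<forall>\<^sub>F t in at_right 0. \<forall>x\<in>UNIV. dist (ut t x) (u x) < e"
  proof eventually_elim
    case (elim t)
    show ?case
    proof
      fix x
      have "\<bar>ut t x - u x\<bar> \<le> e / 2" using elim by blast
      then show "dist (ut t x) (u x) < e" using \<open>0 < e\<close> unfolding dist_real_def by linarith
    qed
  qed
qed

end

theorem theorem2:
  fixes L :: "'n::finite torus \<Rightarrow> real^'n \<Rightarrow> real"
    and F :: "'n torus \<Rightarrow> 'n torus measure \<Rightarrow> real"
    and c0 k0 k1 k2 :: real
    and x0 :: "'n torus"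
    and \<rho>\<tau> :: "real \<Rightarrow> real"
    and u\<tau> :: "real \<Rightarrow> 'n torus \<Rightarrow> real"
    and \<mu>\<tau> :: "real \<Rightarrow> ('n torus \<times> (real^'n)) measure"
    and \<rho> :: real
    and u m :: "'n torus \<Rightarrow> real"
  assumes "tonelli_lagrangian L"
    and "c0 > 0"
    and "\<And>x q v. v \<bullet> (hessian (L x) q *v v) \<ge> c0 * (norm v)\<^sup>2"
    and "\<And>x h q v. L (tproj (x + h)) (q + v) - 2 * L (tproj x) q + L (tproj (x - h)) (q - v)
           \<le> k1 * (norm h)\<^sup>2 + k2 * (norm v)\<^sup>2"
    and "continuous_map (prod_topology euclidean weak_topology) euclidean (\<lambda>(x, M). F x M)"
    and "\<And>M M'. M \<in> borel_prob_measures \<Longrightarrow> M' \<in> borel_prob_measures \<Longrightarrow> M \<noteq> M' \<Longrightarrow>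
           (LINT x|M. F x M - F x M') - (LINT x|M'. F x M - F x M') > 0"
    and "k0 > 0"
    and "\<And>x h M. M \<in> borel_prob_measures \<Longrightarrow>
           F (tproj (x + h)) M - 2 * F (tproj x) M + F (tproj (x - h)) M \<le> k0 * (norm h)\<^sup>2"
    and "\<And>\<tau>. \<tau> > 0 \<Longrightarrow> discrete_mfg_solution L F \<tau> (\<rho>\<tau> \<tau>) (u\<tau> \<tau>) (\<mu>\<tau> \<tau>)"
    and "\<And>\<tau>. \<tau> > 0 \<Longrightarrow> u\<tau> \<tau> x0 = 0"
    and "ergodic_mfg_solution L F \<rho> u m"
    and "u x0 = 0"
  shows "(\<rho>\<tau> \<longlongrightarrow> \<rho>) (at_right 0) \<and>
    uniform_limit UNIV u\<tau> u (at_right 0) \<and>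
    limitin weak_topology (\<lambda>\<tau>. Pr1 (\<mu>\<tau> \<tau>)) (density_measure m) (at_right 0)"
proof -
  interpret mfg_limit L F c0 k0 k1 k2 x0 \<rho>\<tau> u\<tau> \<mu>\<tau> \<rho> u m
    by unfold_locales (fact assms)+
  show ?thesis using rho_convergence value_convergence measure_convergence by blast
qed

end
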